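(* Let $d\ge 3$, $H\in(0,1)$, $T>0$, $\mathbb{T}=[0,T]$, and let $(A_\ell,\ell\in\mathbb{N}_0)$, $A_\ell\ge0$, satisfy for some $\eta>0$ $$\sum_{\ell=0}^{\infty}A_\ell\,\ell^{d-2+\eta}<\infty .$$ Let $$B_Q^H(t,x)=\sum_{\ell=0}^\infty\sum_{m=1}^{h(\ell,d)}\sqrt{A_\ell}\,\beta^H_{\ell,m}(t)\,S^{(d-1)}_{\ell,m}(x),\qquad t\in\mathbb{T},\ x\in\mathbb{S}^{d-1}.$$ Then $B_Q^H$ has a continuous modification which is in $C^{H^-,(\eta/2)^-}(\mathbb{T}\times\mathbb{S}^{d-1})$.
   Context: $\mathbb{S}^{d-1}$ is the unit sphere in $\mathbb{R}^d$ with geodesic distance $d_{\mathbb{S}^{d-1}}(x,y)=\arccos\langle x,y\rangle$. $(S^{(d-1)}_{\ell,m},\ \ell\in\mathbb{N}_0,\ m=1,\dots,h(\ell,d))$ are the real-valued spherical harmonics on $\mathbb{S}^{d-1}$, an orthonormal basis of $L^2(\mathbb{S}^{d-1})$, where $h(\ell,d)=(2\ell+d-2)(\ell+d-3)!/((d-2)!\,\ell!)$. $(\beta^H_{\ell,m})$ are independent real-valued fractional Brownian motions with Hurst parameter $H$ (continuous centered Gaussian processes with covariance $\frac12(t^{2H}+s^{2H}-|t-s|^{2H})$). $B_Q^H$ is the isotropic $Q$-fractional Brownian motion on $\mathbb{S}^{d-1}$ with covariance operator $QS^{(d-1)}_{\ell,m}=A_\ell S^{(d-1)}_{\ell,m}$.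 For $\gamma>0$, "$\in C^{\gamma^-}$" means $\in C^{\gamma'}$ for every $\gamma'\in(0,\gamma)$ (standard extension of Hölder spaces to orders greater than 1). $C^{\alpha,\beta}(\mathbb{T}\times\mathbb{S}^{d-1})$ is the set of $f\in C^{\min\{\alpha,\beta\}}(\mathbb{T}\times\mathbb{S}^{d-1})$ (metric $|t-s|+d_{\mathbb{S}^{d-1}}(x,y)$) with $f(\cdot,x)\in C^\alpha(\mathbb{T})$ for all $x$ and $f(t,\cdot)\in C^\beta(\mathbb{S}^{d-1})$ for all $t$; $\min\{\alpha^-,\beta^-\}$ is read as $\min\{\alpha,\beta\}^-$. *)

theory Defs
  imports "HOL-Probability.Probability"
begin

definition geo_dist :: "real^'n \<Rightarrow> real^'n \<Rightarrow> real" where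
  "geo_dist x y = arccos (x \<bullet> y)"

text \<open>Integral w.r.t. the (unnormalised) surface measure on the unit sphere,
  via the cone measure: int_S f d sigma = d * int_{|x| <= 1} f(x/|x|) dx.\<close>
definition sphere_integral :: "(real^'n \<Rightarrow> real) \<Rightarrow> real" where
  "sphere_integral f = real CARD('n) *
     (LINT x : cball 0 1 | lborel. f (x /\<^sub>R norm x))"

definition sphere_integrable :: "(real^'n \<Rightarrow> real) \<Rightarrow> bool" where
  "sphere_integrable f = set_integrable lborel (cball 0 1) (\<lambda>x. f (x /\<^sub>R norm x))"

definition harm_dim :: "nat \<Rightarrow> nat \<Rightarrow> nat" where
  "harm_dim l d = ((2*l + d - 2) * fact (l + d - 3)) div (fact (d - 2) * fact l)"

definition homog_poly :: "nat \<Rightarrow> (real^'n \<Rightarrow> real) \<Rightarrow> bool" where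
  "homog_poly l p \<longleftrightarrow> (\<exists>c :: ('n \<Rightarrow> nat) \<Rightarrow> real. \<forall>x.
      p x = (\<Sum>\<alpha>\<in>{\<alpha>. (\<Sum>i\<in>UNIV. \<alpha> i) = l}. c \<alpha> * (\<Prod>i\<in>UNIV. (x $ i) ^ \<alpha> i)))"

definition laplacian :: "(real^'n \<Rightarrow> real) \<Rightarrow> real^'n \<Rightarrow> real" where
  "laplacian p x = (\<Sum>i\<in>UNIV. deriv (\<lambda>s. deriv (\<lambda>r. p (x + r *\<^sub>R axis i 1)) s) 0)"

definition harmonic_homog_poly :: "nat \<Rightarrow> (real^'n \<Rightarrow> real) \<Rightarrow> bool" where
  "harmonic_homog_poly l p \<longleftrightarrow> homog_poly l p \<and> (\<forall>x. laplacian p x = 0)"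

text \<open>A family S l m (l in N_0, 1 <= m <= h(l,d)) of real spherical harmonics:
  each S l m is, on the sphere, the restriction of a harmonic homogeneous polynomial
  of degree l, and the family is orthonormal in L^2(S^{d-1}).  (The degree-l ones then form
  an orthonormal basis of the degree-l harmonics, and the whole family an ONB of L^2.)\<close>
definition spherical_harmonics :: "(nat \<Rightarrow> nat \<Rightarrow> real^'n \<Rightarrow> real) \<Rightarrow> bool" where
  "spherical_harmonics S \<longleftrightarrow>
     (\<forall>l m. 1 \<le> m \<and> m \<le> harm_dim l CARD('n) \<longrightarrow>
        (\<exists>p. harmonic_homog_poly l p \<and> (\<forall>x\<in>sphere 0 1. S l m x = p x))) \<and>
     (\<forall>l m l' m'. 1 \<le> m \<and> m \<le> harm_dim l CARD('n) \<and> 1 \<le> m' \<and> m' \<le> harm_dim l' CARD('n) \<longrightarrow>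
        sphere_integrable (\<lambda>x. S l m x * S l' m' x) \<and>
        sphere_integral (\<lambda>x. S l m x * S l' m' x) = (if (l, m) = (l', m') then 1 else 0))"

definition centered_gaussian_rv :: "'a measure \<Rightarrow> ('a \<Rightarrow> real) \<Rightarrow> bool" where
  "centered_gaussian_rv M Y \<longleftrightarrow>
     (\<exists>\<sigma>>0. distributed M lborel Y (\<lambda>x. ennreal (normal_density 0 \<sigma> x))) \<or>
     (Y \<in> borel_measurable M \<and> (AE \<omega> in M. Y \<omega> = 0))"

definition fbm :: "'a measure \<Rightarrow> real \<Rightarrow> (real \<Rightarrow> 'a \<Rightarrow> real) \<Rightarrow> bool" where
  "fbm M H X \<longleftrightarrow>
     (\<forall>t\<ge>0. X t \<in> borel_measurable M) \<and>
     (\<forall>F c. finite F \<and> F \<subseteq> {0..} \<longrightarrow>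
        centered_gaussian_rv M (\<lambda>\<omega>. \<Sum>t\<in>F. c t * X t \<omega>)) \<and>
     (\<forall>s\<ge>0. \<forall>t\<ge>0. prob_space.expectation M (\<lambda>\<omega>. X s \<omega> * X t \<omega>)
        = (t powr (2*H) + s powr (2*H) - \<bar>t - s\<bar> powr (2*H)) / 2) \<and>
     (AE \<omega> in M. continuous_on {0..} (\<lambda>t. X t \<omega>))"

definition holder_wrt :: "('a \<Rightarrow> 'a \<Rightarrow> real) \<Rightarrow> real \<Rightarrow> 'a set \<Rightarrow> ('a \<Rightarrow> real) \<Rightarrow> bool" where
  "holder_wrt dst g D f \<longleftrightarrow> (\<exists>C. \<forall>x\<in>D. \<forall>y\<in>D. \<bar>f x - f y\<bar> \<le> C * dst x y powr g)"

fun pderivs :: "'n list \<Rightarrow> (real^'n \<Rightarrow> real) \<Rightarrow> real^'n \<Rightarrow> real" where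
  "pderivs [] F = F"
| "pderivs (i # is) F = (\<lambda>y. frechet_derivative (pderivs is F) (at y) (axis i 1))"

text \<open>C^gamma(S^{d-1}) for gamma > 0, gamma = k + a with k = ceil gamma - 1 and a in (0,1]:
  the 0-homogeneous extension F(x) = f(x/|x|) has Frechet differentiable partial derivatives
  of all orders < k on R^d \ {0}, and its partial derivatives of order k are a-Hoelder on the
  sphere (geodesic distance).\<close>
definition sphere_holder :: "real \<Rightarrow> (real^'n \<Rightarrow> real) \<Rightarrow> bool" where
  "sphere_holder g f \<longleftrightarrow>
     (let k = nat (\<lceil>g\<rceil> - 1); a = g - real k; F = (\<lambda>x. f (x /\<^sub>R norm x)) in
       (\<forall>is. length is < k \<longrightarrow> (\<forall>y. y \<noteq> 0 \<longrightarrow> pderivs is F differentiable (at y))) \<and>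
       (\<forall>is. length is = k \<longrightarrow> holder_wrt geo_dist a (sphere 0 1) (pderivs is F)))"

definition sphere_holder_minus :: "real \<Rightarrow> (real^'n \<Rightarrow> real) \<Rightarrow> bool" where
  "sphere_holder_minus g f \<longleftrightarrow> (\<forall>g'. 0 < g' \<and> g' < g \<longrightarrow> sphere_holder g' f)"

text \<open>Membership in C^{a-,b-}([0,T] x S^{d-1}) for a \<le> 1 (the only case used: a = H < 1):
  jointly Hoelder of every order < min a b w.r.t. |t-s| + d_S(x,y), Hoelder of every order
  < a in time for each x, and in C^{b-}(S^{d-1}) for each t.\<close>
definition space_time_holder_minus ::
  "real \<Rightarrow> real \<Rightarrow> real \<Rightarrow> (real \<Rightarrow> real^'n \<Rightarrow> real) \<Rightarrow> bool" where
  "space_time_holder_minus T a b f \<longleftrightarrow>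
     (\<forall>g. 0 < g \<and> g < min a b \<longrightarrow>
        holder_wrt (\<lambda>(t,x) (s,y). \<bar>t - s\<bar> + geo_dist x y) g ({0..T} \<times> sphere 0 1)
          (\<lambda>(t,x). f t x)) \<and>
     (\<forall>x\<in>sphere 0 1. \<forall>g. 0 < g \<and> g < a \<longrightarrow> holder_wrt (\<lambda>t s. \<bar>t - s\<bar>) g {0..T} (\<lambda>t. f t x)) \<and>
     (\<forall>t\<in>{0..T}. sphere_holder_minus b (\<lambda>x. f t x))"

definition QfBm :: "(nat \<Rightarrow> real) \<Rightarrow> (nat \<times> nat \<Rightarrow> real \<Rightarrow> 'a \<Rightarrow> real) \<Rightarrow>
    (nat \<Rightarrow> nat \<Rightarrow> real^'n \<Rightarrow> real) \<Rightarrow> real \<Rightarrow> real^'n \<Rightarrow> 'a \<Rightarrow> real" where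
  "QfBm A \<beta> S t x \<omega> =
     (\<Sum>l. \<Sum>m=1..harm_dim l CARD('n). sqrt (A l) * \<beta> (l, m) t \<omega> * S l m x)"

end

theory Submission
  imports Defs "HOL-Complex_Analysis.Conformal_Mappings" "HOL-Library.Discrete_Functions"
begin

text \<open>
  Group the degrees into dyadic blocks \<open>2\<^sup>k \<le> l + 1 < 2\<^bsup>k+1\<^esup>\<close> and let \<open>Y\<^sub>k(t, \<cdot>)\<close> be the part of the series
  coming from the \<open>k\<close>-th block; on the sphere it is a polynomial of degree at most \<open>2\<^bsup>k+1\<^esup>\<close>.
  By rotation invariance the reproducing kernel of the degree-\<open>l\<close> harmonics is constant on the
  diagonal, so it is bounded by their dimension, \<open>O(l\<^bsup>d-2\<^esup>)\<close>; hence \<open>Y\<^sub>k(t, x) - Y\<^sub>k(s, x)\<close> is Gaussian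
  with variance \<open>O(2\<^bsup>-k\<eta>\<^esup> \<bar>t - s\<bar>\<^bsup>2H\<^esup>)\<close>.
  Bernstein's inequality on great circles shows that the maximum of \<open>Y\<^sub>k(t, \<cdot>)\<close> is controlled by its
  maximum over a net with \<open>O(2\<^bsup>kd\<^esup>)\<close> points, and moments of high order together with dyadic chaining
  in time give, almost surely and for all \<open>a < H\<close> and \<open>\<delta> < \<eta>/2\<close>,
  \<open>sup\<^sub>x \<bar>Y\<^sub>k(t, x) - Y\<^sub>k(s, x)\<bar> \<le> C 2\<^bsup>-k\<delta>\<^esup> \<bar>t - s\<bar>\<^sup>a\<close>.
  Summing over \<open>k\<close> yields the regularity in time. Applying Bernstein's inequality to derivatives
  costs a factor \<open>2\<^sup>k\<close> for each order, so the block series may be differentiated termwise up to every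
  order below \<open>\<eta>/2\<close>, which yields the regularity in space. At a fixed point, the block sums and the original
  partial sums differ by an incomplete block, which tends to zero almost surely by the same moment bound.
\<close>

section \<open>Polynomial functions of bounded degree\<close>

text \<open>Estimating degree by degree would not suffice: the degree-\<open>l\<close> part has
  standard deviation bounded by a multiple of \<open>l\<close> to the power
  \<open>-\<eta>/2\<close>, which is not summable for small \<open>\<eta>\<close>. Within a block,
  independence adds variances instead of standard deviations, and the resulting decay is geometric
  in \<open>k\<close>, so the triangle inequality over blocks is harmless. Replacing the sphere by a
  net costs a factor of order \<open>2 ^ (k * d)\<close> in a union bound, while the moment of order
  \<open>2 * p\<close>, normalised by \<open>2 powr (k * \<delta>)\<close>, gains
  \<open>2 powr (- k * p * (\<eta> - 2 * \<delta>))\<close>. All moments of a Gaussian are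
  controlled by its variance, so \<open>p\<close> can be taken so large that the cost is absorbed
  and no exponent is lost. The same device pays for the \<open>2 ^ n\<close> time increments of
  level \<open>n\<close>. Smoothness above order 1 is defined through derivatives of the
  0-homogeneous extension. On the sphere these are again polynomials, so one Bernstein argument
  serves every order. Numerical constants may be crude as long as they do not depend on the
  block.\<close>

inductive poly_deg :: "nat \<Rightarrow> (real^'n \<Rightarrow> real) \<Rightarrow> bool" where
  poly_deg_const: "poly_deg N (\<lambda>x. c)"
| poly_deg_coord: "poly_deg N f \<Longrightarrow> poly_deg (Suc N) (\<lambda>x. x $ i * f x)"
| poly_deg_add: "poly_deg N f \<Longrightarrow> poly_deg N g \<Longrightarrow> poly_deg N (\<lambda>x. f x + g x)"

lemma poly_deg_mono: "poly_deg N f \<Longrightarrow> N \<le> N' \<Longrightarrow> poly_deg N' f"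
proof (induction arbitrary: N' rule: poly_deg.induct)
  case (poly_deg_coord N f i)
  then obtain K where "N' = Suc K" "N \<le> K"
    by (metis Suc_le_D Suc_le_mono)
  with poly_deg_coord show ?case
    using poly_deg.poly_deg_coord by blast
qed (auto intro: poly_deg.intros)

lemma poly_deg_cmult: "poly_deg N f \<Longrightarrow> poly_deg N (\<lambda>x. c * f x)"
proof (induction rule: poly_deg.induct)
  case (poly_deg_coord N f i)
  have "(\<lambda>x. c * (x $ i * f x)) = (\<lambda>x. x $ i * (c * f x))"
    by (simp add: algebra_simps)
  then show ?case using poly_deg.poly_deg_coord[OF poly_deg_coord.IH] by simp
qed (auto simp: distrib_left intro: poly_deg.intros)

lemma poly_deg_diff: "poly_deg N f \<Longrightarrow> poly_deg N g \<Longrightarrow> poly_deg N (\<lambda>x. f x - g x)"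
  using poly_deg_add[of N f "\<lambda>x. - 1 * g x"] poly_deg_cmult[of N g "-1"] by simp

lemma poly_deg_sum: "(\<And>i. i \<in> I \<Longrightarrow> poly_deg N (f i)) \<Longrightarrow> poly_deg N (\<lambda>x. \<Sum>i\<in>I. f i x)"
  by (induction I rule: infinite_finite_induct) (auto intro: poly_deg.intros)

text \<open>Expressed through \<open>frechet_derivative\<close> so that it is literally one step of
  \<open>pderivs\<close>.\<close>

definition pd :: "'n \<Rightarrow> (real^'n \<Rightarrow> real) \<Rightarrow> real^'n \<Rightarrow> real" where
  "pd i f x = frechet_derivative f (at x) (axis i 1)"

lemma pd_eqI:
  assumes "(f has_derivative (\<lambda>h. \<Sum>i\<in>UNIV. h $ i * g i)) (at x)"
  shows "pd i f x = g i"
proof -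
  have "pd i f x = (\<Sum>j\<in>UNIV. axis i (1::real) $ j * g j)"
    unfolding pd_def frechet_derivative_at[OF assms, symmetric] ..
  also have "\<dots> = (\<Sum>j\<in>UNIV. if j = i then g i else 0)"
    by (intro sum.cong) (auto simp: axis_def)
  finally show ?thesis by simp
qed

text \<open>The gradient is built along the induction before it can be identified with
  \<open>pd\<close>, hence the existential form. The degree bound \<open>N\<close> is kept for the
  derivatives instead of being lowered, which changes later estimates only by constants.\<close>

lemma poly_deg_has_derivative_ex:
  "poly_deg N f \<Longrightarrow> \<exists>g. (\<forall>i. poly_deg N (g i)) \<and>
     (\<forall>x. (f has_derivative (\<lambda>h. \<Sum>i\<in>UNIV. h $ i * g i x)) (at x))"
proof (induction rule: poly_deg.induct)
  case (poly_deg_const N c)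
  show ?case
    by (rule exI[of _ "\<lambda>i x. 0"]) (auto intro: poly_deg.intros)
next
  case (poly_deg_coord N f k)
  then obtain g where g: "\<And>i. poly_deg N (g i)"
    "\<And>x. (f has_derivative (\<lambda>h. \<Sum>i\<in>UNIV. h $ i * g i x)) (at x)" by blast
  define G where "G i x = x $ k * g i x + (if i = k then 1 else 0) * f x" for i x
  have "poly_deg (Suc N) (G i)" for i
    unfolding G_def using g(1) poly_deg_coord.hyps
    by (intro poly_deg.poly_deg_add poly_deg.poly_deg_coord poly_deg_cmult) (auto intro: poly_deg_mono)
  moreover have "((\<lambda>x. x $ k * f x) has_derivative (\<lambda>h. \<Sum>i\<in>UNIV. h $ i * G i x)) (at x)" for x
  proof -
    have "((\<lambda>x. x $ k * f x) has_derivative (\<lambda>h. x $ k * (\<Sum>i\<in>UNIV. h $ i * g i x) + h $ k * f x)) (at x)"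
      by (intro has_derivative_mult g(2) bounded_linear_imp_has_derivative bounded_linear_vec_nth)
    moreover have "x $ k * (\<Sum>i\<in>UNIV. h $ i * g i x) + h $ k * f x = (\<Sum>i\<in>UNIV. h $ i * G i x)" for h
    proof -
      have "h $ i * G i x = x $ k * (h $ i * g i x) + (if i = k then h $ k * f x else 0)" for i
        by (simp add: G_def algebra_simps)
      then show ?thesis by (simp add: sum.distrib sum_distrib_left)
    qed
    ultimately show ?thesis by simp
  qed
  ultimately show ?case by blast
next
  case (poly_deg_add N f1 f2)
  then obtain g1 g2 where g: "\<And>i. poly_deg N (g1 i)" "\<And>i. poly_deg N (g2 i)"
    "\<And>x. (f1 has_derivative (\<lambda>h. \<Sum>i\<in>UNIV. h $ i * g1 i x)) (at x)"
    "\<And>x. (f2 has_derivative (\<lambda>h. \<Sum>i\<in>UNIV. h $ i * g2 i x)) (at x)" by blast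
  show ?case
  proof (intro exI[of _ "\<lambda>i x. g1 i x + g2 i x"] conjI allI)
    show "poly_deg N (\<lambda>x. g1 i x + g2 i x)" for i
      using g by (intro poly_deg.poly_deg_add)
    show "((\<lambda>x. f1 x + f2 x) has_derivative (\<lambda>h. \<Sum>i\<in>UNIV. h $ i * (g1 i x + g2 i x))) (at x)" for x
      using has_derivative_add[OF g(3,4)[of x]] by (simp add: distrib_left sum.distrib)
  qed
qed

lemma
  assumes "poly_deg N f"
  shows poly_deg_pd: "poly_deg N (pd i f)"
    and poly_deg_has_derivative: "(f has_derivative (\<lambda>h. \<Sum>i\<in>UNIV. h $ i * pd i f x)) (at x)"
proof -
  obtain g where g: "\<And>i. poly_deg N (g i)"
    "\<And>x. (f has_derivative (\<lambda>h. \<Sum>i\<in>UNIV. h $ i * g i x)) (at x)"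
    using poly_deg_has_derivative_ex[OF assms] by blast
  have "pd i f = g i" for i
    using pd_eqI[OF g(2)] by blast
  with g show "poly_deg N (pd i f)"
    "(f has_derivative (\<lambda>h. \<Sum>i\<in>UNIV. h $ i * pd i f x)) (at x)" by auto
qed

lemma poly_deg_continuous_on: "poly_deg N f \<Longrightarrow> continuous_on A f"
  by (intro continuous_at_imp_continuous_on ballI has_derivative_continuous[OF poly_deg_has_derivative])

section \<open>Bernstein's inequality on the sphere\<close>

text \<open>The reversed polynomial \<open>g\<close>, equal to
  \<open>w ^ n * poly R (inverse w)\<close> off 0, is bounded by \<open>M\<close> on the unit
  circle. The maximum modulus principle at \<open>inverse z\<close> turns this into growth of
  \<open>R\<close> outside the disc.\<close>

lemma poly_norm_le_outside_disc:
  fixes R :: "complex poly"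
  assumes "degree R \<le> n" and bd: "\<And>z. norm z = 1 \<Longrightarrow> norm (poly R z) \<le> M" and z: "norm z \<ge> 1"
  shows "norm (poly R z) \<le> M * norm z ^ n"
proof -
  define g where "g w = (\<Sum>i\<le>n. coeff R i * w ^ (n - i))" for w
  have R: "poly R w = (\<Sum>i\<le>n. coeff R i * w ^ i)" for w
    unfolding poly_altdef using assms(1)
    by (intro sum.mono_neutral_left) (auto simp: coeff_eq_0)
  have g_eq: "g w = w ^ n * poly R (inverse w)" if "w \<noteq> 0" for w
    unfolding g_def R sum_distrib_left using that
    by (intro sum.cong) (auto simp: power_diff power_inverse field_simps)
  have "norm (g (inverse z)) \<le> M"
  proof (rule maximum_modulus_frontier[of g "cball 0 1" M "inverse z"])
    show "g holomorphic_on interior (cball 0 1)" "continuous_on (closure (cball 0 1)) g"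
      unfolding g_def by (auto intro!: holomorphic_intros continuous_intros)
    show "bounded (cball (0::complex) 1)" by simp
    show "inverse z \<in> cball 0 1"
      using z by (simp add: norm_inverse inverse_le_1_iff)
    show "norm (g w) \<le> M" if "w \<in> frontier (cball 0 1)" for w
    proof -
      have w: "norm w = 1" using that by simp
      then have "w \<noteq> 0" by auto
      then show ?thesis
        using bd[of "inverse w"] w by (simp add: g_eq norm_mult norm_power norm_inverse)
    qed
  qed
  moreover have "z \<noteq> 0" using z by auto
  ultimately have "norm (poly R z) / norm z ^ n \<le> M"
    by (simp add: g_eq norm_mult norm_power norm_inverse norm_divide divide_inverse power_inverse mult.commute)
  then show ?thesis using \<open>z \<noteq> 0\<close> by (simp add: field_simps)
qed

text \<open>Cauchy's estimate on the disc of radius \<open>1 / n\<close> around \<open>z\<close>: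
  this radius is small enough that \<open>R\<close> grows there by at most
  \<open>(1 + 1/n) ^ n \<le> exp 1 \<le> 3\<close>.\<close>

lemma poly_bernstein_unit_circle:
  fixes R :: "complex poly"
  assumes "degree R \<le> n" "n \<ge> 1" and bd: "\<And>z. norm z = 1 \<Longrightarrow> norm (poly R z) \<le> M" and z: "norm z = 1"
  shows "norm (poly (pderiv R) z) \<le> 3 * real n * M"
proof -
  have M: "0 \<le> M" using bd[OF z] norm_ge_zero order_trans by blast
  have "norm ((deriv ^^ 1) (poly R) z) \<le> fact 1 * (3 * M) / (1 / real n) ^ 1"
  proof (rule Cauchy_inequality)
    show "poly R holomorphic_on ball z (1 / real n)" "continuous_on (cball z (1 / real n)) (poly R)"
      by (auto intro!: holomorphic_intros continuous_intros)
    show "0 < 1 / real n" using assms by simp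
    fix w assume w: "norm (z - w) = 1 / real n"
    have "norm w \<le> 1 + 1 / real n"
      using norm_triangle_ineq4[of z "z - w"] w z by simp
    then have "norm w ^ n \<le> (1 + 1 / real n) ^ n" by (intro power_mono) auto
    also have "\<dots> \<le> exp 1" using exp_ge_one_plus_x_over_n_power_n[of n 1] assms by simp
    also have "\<dots> \<le> 3" by (rule exp_le)
    finally have w3: "norm w ^ n \<le> 3" .
    show "norm (poly R w) \<le> 3 * M"
    proof (cases "norm w \<ge> 1")
      case True
      have "norm (poly R w) \<le> M * norm w ^ n"
        using poly_norm_le_outside_disc[OF assms(1) bd True] .
      also have "\<dots> \<le> M * 3" using M w3 by (intro mult_left_mono)
      finally show ?thesis by simp
    next
      case False
      have "norm (poly R w) \<le> M"
        by (rule maximum_modulus_frontier[of _ "cball 0 1"])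
          (use False bd in \<open>auto intro!: holomorphic_intros continuous_intros\<close>)
      with M show ?thesis by simp
    qed
  qed
  moreover have "deriv (poly R) z = poly (pderiv R) z"
    by (rule DERIV_imp_deriv) (rule poly_DERIV)
  ultimately show ?thesis using assms by (simp add: field_simps)
qed

text \<open>On a great circle \<open>f\<close> is a trigonometric polynomial with frequencies
  between \<open>-N\<close> and \<open>N\<close>; multiplying by \<open>cis t ^ N\<close> shifts
  them to \<open>0..2 * N\<close> and leaves an algebraic polynomial in
  \<open>cis t\<close>.\<close>

lemma poly_deg_great_circle:
  fixes u v :: "real^'n"
  assumes "poly_deg N f"
  shows "\<exists>R :: complex poly. degree R \<le> 2 * N \<and>
    (\<forall>t. poly R (cis t) = cis t ^ N * of_real (f (cos t *\<^sub>R u + sin t *\<^sub>R v)))"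
  using assms
proof (induction rule: poly_deg.induct)
  case (poly_deg_const N c)
  show ?case
    by (rule exI[of _ "monom (of_real c) N"])
      (auto simp: poly_monom degree_monom_le intro: order_trans[OF degree_monom_le])
next
  case (poly_deg_coord N f i)
  then obtain R where R: "degree R \<le> 2 * N"
    "\<And>t. poly R (cis t) = cis t ^ N * of_real (f (cos t *\<^sub>R u + sin t *\<^sub>R v))" by blast
  \<comment> \<open>With \<open>z = cis t\<close>, cos is \<open>(z + 1/z) / 2\<close> and sin is
    \<open>(z - 1/z) / (2 * \<i>)\<close>; \<open>P\<close> is \<open>z\<close> times the i-th
    coordinate of the circle, written out in powers of \<open>z\<close>.\<close>
  define P where "P = [: Complex (u $ i / 2) (v $ i / 2), 0, Complex (u $ i / 2) (- v $ i / 2) :]"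
  have P: "poly P (cis t) = cis t * of_real (cos t * u $ i + sin t * v $ i)" for t
  proof -
    define c s where "c = cos t" and "s = sin t"
    have *: "c * c + s * s = 1"
      unfolding c_def s_def by (metis power2_eq_square sin_cos_squared_add2)
    have "Re (poly P (cis t)) = u $ i / 2 * (1 + (c * c - s * s)) + v $ i * s * c"
      "Im (poly P (cis t)) = v $ i / 2 * (1 - (c * c - s * s)) + u $ i * s * c"
      unfolding P_def c_def s_def by (simp_all add: algebra_simps)
    moreover have "1 + (c * c - s * s) = 2 * c * c" "1 - (c * c - s * s) = 2 * s * s"
      using * by auto
    ultimately have "Re (poly P (cis t)) = u $ i / 2 * (2 * c * c) + v $ i * s * c"
      "Im (poly P (cis t)) = v $ i / 2 * (2 * s * s) + u $ i * s * c"
      by presburger+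
    then show ?thesis
      unfolding complex_eq_iff by (simp add: c_def s_def algebra_simps)
  qed
  have "degree P \<le> 2" unfolding P_def by (auto intro: order_trans[OF degree_pCons_le])
  then have "degree (P * R) \<le> 2 * Suc N"
    using degree_mult_le[of P R] R(1) by simp
  moreover have "poly (P * R) (cis t) = cis t ^ Suc N *
      of_real ((cos t *\<^sub>R u + sin t *\<^sub>R v) $ i * f (cos t *\<^sub>R u + sin t *\<^sub>R v))" for t
    by (simp add: P R(2) algebra_simps)
  ultimately show ?case by blast
next
  case (poly_deg_add N f g)
  then obtain R1 R2 where "degree R1 \<le> 2 * N" "degree R2 \<le> 2 * N"
    "\<And>t. poly R1 (cis t) = cis t ^ N * of_real (f (cos t *\<^sub>R u + sin t *\<^sub>R v))"
    "\<And>t. poly R2 (cis t) = cis t ^ N * of_real (g (cos t *\<^sub>R u + sin t *\<^sub>R v))" by blast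
  then show ?case
    by (intro exI[of _ "R1 + R2"]) (auto simp: algebra_simps degree_add_le)
qed

text \<open>Differentiating \<open>poly R (cis t) = cis t ^ N * g t\<close> at 0 gives
  \<open>\<i> * poly (pderiv R) 1 = D + \<i> * N * g 0\<close>. As \<open>R\<close> has degree at
  most \<open>2 * N\<close>, the left side is at most \<open>6 * N * M\<close>, and the last term
  adds \<open>N * M\<close>: hence the constant 7.\<close>

lemma sphere_bernstein_unit:
  fixes u v :: "real^'n"
  assumes f: "poly_deg N f" "N \<ge> 1" and bd: "\<And>x. norm x = 1 \<Longrightarrow> \<bar>f x\<bar> \<le> M"
    and u: "norm u = 1" and v: "norm v = 1" and uv: "u \<bullet> v = 0"
  shows "\<bar>\<Sum>i\<in>UNIV. v $ i * pd i f u\<bar> \<le> 7 * real N * M"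
proof -
  define g where "g t = f (cos t *\<^sub>R u + sin t *\<^sub>R v)" for t
  define D where "D = (\<Sum>i\<in>UNIV. v $ i * pd i f u)"
  obtain R where R: "degree R \<le> 2 * N" "\<And>t. poly R (cis t) = cis t ^ N * of_real (g t)"
    using poly_deg_great_circle[OF f(1), of u v] unfolding g_def by blast
  have nrm: "norm (cos t *\<^sub>R u + sin t *\<^sub>R v) = 1" for t
  proof -
    have "norm (cos t *\<^sub>R u + sin t *\<^sub>R v) ^ 2 = (cos t)\<^sup>2 * norm u ^ 2 + (sin t)\<^sup>2 * norm v ^ 2"
      unfolding power2_norm_eq_inner using uv
      by (simp add: inner_add_left inner_add_right inner_commute power2_eq_square algebra_simps)
    then have "norm (cos t *\<^sub>R u + sin t *\<^sub>R v) ^ 2 = 1 ^ 2" using u v by simp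
    then show ?thesis by (subst (asm) power2_eq_iff_nonneg) auto
  qed
  have g_bd: "\<bar>g t\<bar> \<le> M" for t unfolding g_def using bd nrm by blast
  have "norm (poly R z) \<le> M" if "norm z = 1" for z
  proof -
    have "z = cis (Arg z)"
      using that by (subst cis_Arg) (auto simp: sgn_eq)
    then have "poly R z = cis (Arg z) ^ N * of_real (g (Arg z))"
      using R(2)[of "Arg z"] by simp
    then show ?thesis using g_bd[of "Arg z"] by (simp add: norm_mult norm_power)
  qed
  then have R': "norm (poly (pderiv R) 1) \<le> 3 * real (2 * N) * M"
    using f(2) by (intro poly_bernstein_unit_circle[OF R(1)]) auto
  have g': "(g has_real_derivative D) (at 0)"
  proof -
    have "((\<lambda>t. cos t *\<^sub>R u + sin t *\<^sub>R v) has_derivative (\<lambda>h. h *\<^sub>R v)) (at 0)"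
      by (auto intro!: derivative_eq_intros)
    moreover have "(f has_derivative (\<lambda>h. \<Sum>i\<in>UNIV. h $ i * pd i f u)) (at (cos 0 *\<^sub>R u + sin 0 *\<^sub>R v))"
      using poly_deg_has_derivative[OF f(1)] by simp
    ultimately have "(g has_derivative (\<lambda>h. \<Sum>i\<in>UNIV. (h *\<^sub>R v) $ i * pd i f u)) (at 0)"
      unfolding g_def by (rule has_derivative_compose)
    then show ?thesis unfolding has_field_derivative_def D_def
      by (simp add: sum_distrib_left[symmetric] mult.assoc mult_commute_abs)
  qed
  have c: "(cis has_vector_derivative \<i>) (at 0)"
    unfolding has_vector_derivative_complex_iff by (auto intro!: derivative_eq_intros)
  have "((\<lambda>t. poly R (cis t)) has_vector_derivative \<i> * poly (pderiv R) (cis 0)) (at 0)"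
    using field_vector_diff_chain_at[OF c poly_DERIV] by (simp add: o_def)
  moreover have "((\<lambda>t. cis t ^ N * of_real (g t)) has_vector_derivative
      of_real D + \<i> * of_nat N * of_real (g 0)) (at 0)"
  proof -
    have "((\<lambda>t. cis t ^ N) has_vector_derivative \<i> * of_nat N) (at 0)"
      using field_vector_diff_chain_at[OF c DERIV_power[OF DERIV_ident, where n=N]] by (simp add: o_def)
    moreover have "((\<lambda>t. complex_of_real (g t)) has_vector_derivative of_real D) (at 0)"
      using has_vector_derivative_of_real[OF g'] .
    ultimately show ?thesis
      using has_vector_derivative_mult[of "\<lambda>t. cis t ^ N" "\<i> * of_nat N" 0 UNIV "\<lambda>t. complex_of_real (g t)" "of_real D"]
      by simp
  qed
  ultimately have "\<i> * poly (pderiv R) 1 = of_real D + \<i> * of_nat N * of_real (g 0)"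
    unfolding R(2) cis_zero by (rule vector_derivative_unique_at)
  then have "of_real D = \<i> * poly (pderiv R) 1 - \<i> * of_nat N * of_real (g 0)"
    by simp
  then have "\<bar>D\<bar> = norm (\<i> * poly (pderiv R) 1 - \<i> * of_nat N * of_real (g 0))"
    by (metis norm_of_real)
  also have "\<dots> \<le> norm (poly (pderiv R) 1) + real N * \<bar>g 0\<bar>"
    using norm_triangle_ineq4[of "\<i> * poly (pderiv R) 1" "\<i> * of_nat N * of_real (g 0)"]
    by (simp add: norm_mult)
  also have "\<dots> \<le> 3 * real (2 * N) * M + real N * M"
    using R' g_bd[of 0] by (intro add_mono mult_left_mono) auto
  finally show ?thesis unfolding D_def by (simp add: mult_ac)
qed

lemma sphere_bernstein:
  fixes u v :: "real^'n"
  assumes f: "poly_deg N f" "N \<ge> 1" and bd: "\<And>x. norm x = 1 \<Longrightarrow> \<bar>f x\<bar> \<le> M"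
    and u: "norm u = 1" and uv: "u \<bullet> v = 0"
  shows "\<bar>\<Sum>i\<in>UNIV. v $ i * pd i f u\<bar> \<le> 7 * real N * M * norm v"
proof (cases "v = 0")
  case False
  have "\<bar>\<Sum>i\<in>UNIV. (v /\<^sub>R norm v) $ i * pd i f u\<bar> \<le> 7 * real N * M"
    by (rule sphere_bernstein_unit[OF f bd u]) (use False uv in auto)
  moreover have "(\<Sum>i\<in>UNIV. (v /\<^sub>R norm v) $ i * pd i f u) = (\<Sum>i\<in>UNIV. v $ i * pd i f u) / norm v"
    by (simp add: sum_distrib_left[symmetric] divide_inverse mult.assoc mult.commute[of _ "inverse _"])
  ultimately show ?thesis using False
    by (simp del: vector_scaleR_component add: pos_divide_le_eq)
qed simp

section \<open>Radial extensions\<close>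

text \<open>For unit \<open>u\<close> this is the i-th component of the tangential gradient, the
  gradient with its radial part removed.\<close>

definition tang :: "'n \<Rightarrow> (real^'n \<Rightarrow> real) \<Rightarrow> real^'n \<Rightarrow> real" where
  "tang i f u = pd i f u - u $ i * (\<Sum>j\<in>UNIV. u $ j * pd j f u)"

lemma poly_deg_tang: "poly_deg N f \<Longrightarrow> poly_deg (N + 2) (tang i f)"
  unfolding tang_def[abs_def]
  by (intro poly_deg_diff)
    (auto simp: numeral_2_eq_2 intro!: poly_deg_coord poly_deg_sum intro: poly_deg_mono poly_deg_pd)

text \<open>The tangential projection is symmetric, so it can be moved from the gradient onto the
  direction \<open>h\<close>; the projected direction is orthogonal to \<open>u\<close>, as
  Bernstein's inequality requires.\<close>

lemma sum_tang:
  "(\<Sum>i\<in>UNIV. h $ i * tang i f u) = (\<Sum>i\<in>UNIV. (h - (h \<bullet> u) *\<^sub>R u) $ i * pd i f u)"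
proof -
  define D where "D = (\<Sum>j\<in>UNIV. u $ j * pd j f u)"
  have "(\<Sum>i\<in>UNIV. h $ i * tang i f u) = (\<Sum>i\<in>UNIV. h $ i * pd i f u) - (h \<bullet> u) * D"
    unfolding tang_def D_def[symmetric]
    by (simp add: right_diff_distrib sum_subtractf inner_vec_def sum_distrib_right mult.assoc)
  also have "\<dots> = (\<Sum>i\<in>UNIV. (h - (h \<bullet> u) *\<^sub>R u) $ i * pd i f u)"
    unfolding D_def by (simp add: left_diff_distrib sum_subtractf sum_distrib_left mult.assoc)
  finally show ?thesis .
qed

lemma norm_tangential_le:
  fixes h u :: "'a::real_inner"
  assumes "norm u = 1"
  shows "norm (h - (h \<bullet> u) *\<^sub>R u) \<le> norm h" "u \<bullet> (h - (h \<bullet> u) *\<^sub>R u) = 0"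
proof -
  have u: "u \<bullet> u = 1" using assms by (simp add: dot_square_norm)
  have "norm (h - (h \<bullet> u) *\<^sub>R u) ^ 2 = norm h ^ 2 - (h \<bullet> u) ^ 2"
    unfolding power2_norm_eq_inner
    by (simp add: algebra_simps inner_commute u power2_eq_square)
  then have "norm (h - (h \<bullet> u) *\<^sub>R u) ^ 2 \<le> norm h ^ 2" by simp
  then show "norm (h - (h \<bullet> u) *\<^sub>R u) \<le> norm h"
    by (rule power2_le_imp_le) simp
  show "u \<bullet> (h - (h \<bullet> u) *\<^sub>R u) = 0"
    by (simp add: algebra_simps u inner_commute)
qed

lemma sum_tang_bound:
  assumes "poly_deg N f" "N \<ge> 1" "\<And>x. norm x = 1 \<Longrightarrow> \<bar>f x\<bar> \<le> M" "norm u = 1"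
  shows "\<bar>\<Sum>i\<in>UNIV. h $ i * tang i f u\<bar> \<le> 7 * real N * M * norm h"
proof -
  have "0 \<le> M" using assms(3)[OF assms(4)] by linarith
  have "\<bar>\<Sum>i\<in>UNIV. h $ i * tang i f u\<bar> \<le> 7 * real N * M * norm (h - (h \<bullet> u) *\<^sub>R u)"
    unfolding sum_tang
    using sphere_bernstein[OF assms norm_tangential_le(2)[OF assms(4), of h]] .
  also have "\<dots> \<le> 7 * real N * M * norm h"
    using \<open>0 \<le> M\<close> norm_tangential_le(1)[OF assms(4)] by (intro mult_left_mono) auto
  finally show ?thesis .
qed

lemma tang_bound:
  assumes "poly_deg N f" "N \<ge> 1" "\<And>x. norm x = 1 \<Longrightarrow> \<bar>f x\<bar> \<le> M" "norm u = 1"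
  shows "\<bar>tang i f u\<bar> \<le> 7 * real N * M"
proof -
  have "(\<Sum>j\<in>UNIV. axis i (1::real) $ j * tang j f u) = (\<Sum>j\<in>UNIV. if j = i then tang i f u else 0)"
    by (intro sum.cong) (auto simp: axis_def)
  then show ?thesis
    using sum_tang_bound[OF assms, of "axis i 1"] by simp
qed

lemma has_derivative_radial:
  fixes f :: "real^'n \<Rightarrow> real"
  assumes f: "poly_deg N f" and x: "x \<noteq> 0"
  shows "((\<lambda>x. f (x /\<^sub>R norm x)) has_derivative
    (\<lambda>h. (\<Sum>i\<in>UNIV. h $ i * tang i f (x /\<^sub>R norm x)) / norm x)) (at x)"
proof -
  define u where "u = x /\<^sub>R norm x"
  have "((\<lambda>x. x /\<^sub>R norm x) has_derivative
      (\<lambda>h. inverse (norm x) *\<^sub>R h + (- (inverse (norm x) * (h \<bullet> sgn x) * inverse (norm x))) *\<^sub>R x)) (at x)"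
    by (intro has_derivative_scaleR Deriv.has_derivative_inverse has_derivative_norm has_derivative_ident)
      (use x in auto)
  moreover have "inverse (norm x) *\<^sub>R h + (- (inverse (norm x) * (h \<bullet> sgn x) * inverse (norm x))) *\<^sub>R x
      = (h - (h \<bullet> u) *\<^sub>R u) /\<^sub>R norm x" for h
    by (simp add: u_def sgn_div_norm algebra_simps)
  ultimately have "((\<lambda>x. x /\<^sub>R norm x) has_derivative (\<lambda>h. (h - (h \<bullet> u) *\<^sub>R u) /\<^sub>R norm x)) (at x)"
    by simp
  then have "((\<lambda>x. f (x /\<^sub>R norm x)) has_derivative
    (\<lambda>h. \<Sum>i\<in>UNIV. ((h - (h \<bullet> u) *\<^sub>R u) /\<^sub>R norm x) $ i * pd i f u)) (at x)"
    unfolding u_def by (rule has_derivative_compose) (rule poly_deg_has_derivative[OF f])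
  moreover have "(\<Sum>i\<in>UNIV. ((h - (h \<bullet> u) *\<^sub>R u) /\<^sub>R norm x) $ i * pd i f u)
      = (\<Sum>i\<in>UNIV. h $ i * tang i f u) / norm x" for h
    unfolding sum_tang vector_scaleR_component mult.assoc real_scaleR_def sum_distrib_left[symmetric]
    by (simp add: divide_inverse mult.commute)
  ultimately show ?thesis unfolding u_def by simp
qed

text \<open>Differentiation maps "polynomial of the direction divided by \<open>norm x ^ j\<close>"
  to the same shape with \<open>Suc j\<close>: the angular factor contributes \<open>tang\<close>,
  the power of the norm contributes the term with \<open>real j\<close>. This closure makes repeated
  differentiation tractable.\<close>

lemma has_derivative_radial_homogeneous:
  fixes f :: "real^'n \<Rightarrow> real"
  assumes f: "poly_deg N f" and x: "x \<noteq> 0"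
  shows "((\<lambda>x. f (x /\<^sub>R norm x) / norm x ^ j) has_derivative
    (\<lambda>h. \<Sum>i\<in>UNIV. h $ i * ((tang i f (x /\<^sub>R norm x) -
        real j * ((x /\<^sub>R norm x) $ i * f (x /\<^sub>R norm x))) / norm x ^ Suc j))) (at x)"
proof -
  define u where "u = x /\<^sub>R norm x"
  have "((\<lambda>x. inverse (norm x ^ j)) has_derivative
      (\<lambda>h. - (inverse (norm x ^ j) * (real j * (h \<bullet> sgn x) * norm x ^ (j - 1)) * inverse (norm x ^ j)))) (at x)"
    using has_derivative_power[OF has_derivative_norm[OF x], of j]
    by (intro Deriv.has_derivative_inverse) (use x in \<open>auto simp: mult_ac\<close>)
  moreover have "- (inverse (norm x ^ j) * (real j * (h \<bullet> sgn x) * norm x ^ (j - 1)) * inverse (norm x ^ j))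
      = - real j * (h \<bullet> u) / norm x ^ Suc j" for h
    by (cases j) (use x in \<open>auto simp: u_def sgn_div_norm field_simps\<close>)
  ultimately have "((\<lambda>x. inverse (norm x ^ j)) has_derivative (\<lambda>h. - real j * (h \<bullet> u) / norm x ^ Suc j)) (at x)"
    by simp
  from has_derivative_mult[OF has_derivative_radial[OF f x] this]
  have "((\<lambda>x. f (x /\<^sub>R norm x) / norm x ^ j) has_derivative (\<lambda>h. f u * (- real j * (h \<bullet> u) / norm x ^ Suc j) +
     (\<Sum>i\<in>UNIV. h $ i * tang i f u) / norm x * inverse (norm x ^ j))) (at x)"
    by (simp add: u_def divide_inverse)
  moreover have "f u * (- real j * (h \<bullet> u) / norm x ^ Suc j) +
     (\<Sum>i\<in>UNIV. h $ i * tang i f u) / norm x * inverse (norm x ^ j) =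
     (\<Sum>i\<in>UNIV. h $ i * ((tang i f u - real j * (u $ i * f u)) / norm x ^ Suc j))" for h
  proof -
    have "(\<Sum>i\<in>UNIV. h $ i * ((tang i f u - real j * (u $ i * f u)) / norm x ^ Suc j)) =
      ((\<Sum>i\<in>UNIV. h $ i * tang i f u) - real j * f u * (h \<bullet> u)) / norm x ^ Suc j"
      by (simp add: inner_vec_def sum_divide_distrib sum_distrib_left sum_subtractf[symmetric] algebra_simps diff_divide_distrib)
    then show ?thesis by (simp add: divide_inverse algebra_simps)
  qed
  ultimately show ?thesis unfolding u_def by simp
qed

lemma pderivs_Cons_pd: "pderivs (i # is) F x = pd i (pderivs is F) x"
  by (simp add: pd_def)

text \<open>\<open>C\<close> depends only on the order \<open>j\<close> and the dimension. The bound
  for \<open>Q\<close> is therefore uniform over all polynomials, and each order costs exactly one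
  factor \<open>N\<close>.\<close>

lemma pderivs_radial:
  "\<exists>C\<ge>0. \<forall>N (f :: real^'n \<Rightarrow> real) is. length is = j \<longrightarrow> N \<ge> 1 \<longrightarrow> poly_deg N f \<longrightarrow>
     (\<exists>Q. poly_deg (N + 2 * j) Q \<and>
       (\<forall>x. x \<noteq> 0 \<longrightarrow> pderivs is (\<lambda>x. f (x /\<^sub>R norm x)) x = Q (x /\<^sub>R norm x) / norm x ^ j) \<and>
       (\<forall>M. (\<forall>x. norm x = 1 \<longrightarrow> \<bar>f x\<bar> \<le> M) \<longrightarrow> (\<forall>x. norm x = 1 \<longrightarrow> \<bar>Q x\<bar> \<le> C * real N ^ j * M)))"
proof (induction j)
  case 0
  show ?case by (rule exI[of _ 1]) auto
next
  case (Suc j)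
  then obtain C where C: "C \<ge> 0" and IH: "\<And>N (f :: real^'n \<Rightarrow> real) is. length is = j \<Longrightarrow> N \<ge> 1 \<Longrightarrow> poly_deg N f \<Longrightarrow>
     (\<exists>Q. poly_deg (N + 2 * j) Q \<and>
       (\<forall>x. x \<noteq> 0 \<longrightarrow> pderivs is (\<lambda>x. f (x /\<^sub>R norm x)) x = Q (x /\<^sub>R norm x) / norm x ^ j) \<and>
       (\<forall>M. (\<forall>x. norm x = 1 \<longrightarrow> \<bar>f x\<bar> \<le> M) \<longrightarrow> (\<forall>x. norm x = 1 \<longrightarrow> \<bar>Q x\<bar> \<le> C * real N ^ j * M)))"
    by blast
  have "\<exists>Q. poly_deg (N + 2 * Suc j) Q \<and>
       (\<forall>x. x \<noteq> 0 \<longrightarrow> pderivs is (\<lambda>x. f (x /\<^sub>R norm x)) x = Q (x /\<^sub>R norm x) / norm x ^ Suc j) \<and>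
       (\<forall>M. (\<forall>x. norm x = 1 \<longrightarrow> \<bar>f x\<bar> \<le> M) \<longrightarrow>
          (\<forall>x. norm x = 1 \<longrightarrow> \<bar>Q x\<bar> \<le> (7 + 15 * real j) * C * real N ^ Suc j * M))"
    if "length is = Suc j" and N: "N \<ge> 1" and f: "poly_deg N f" for N and f :: "real^'n \<Rightarrow> real" and "is"
  proof -
    from that(1) obtain i js where is_eq: "is = i # js" and js: "length js = j"
      by (cases "is") auto
    obtain Q where Q: "poly_deg (N + 2 * j) Q"
      "\<And>x. x \<noteq> 0 \<Longrightarrow> pderivs js (\<lambda>x. f (x /\<^sub>R norm x)) x = Q (x /\<^sub>R norm x) / norm x ^ j"
      "\<And>M x. (\<And>x. norm x = 1 \<Longrightarrow> \<bar>f x\<bar> \<le> M) \<Longrightarrow> norm x = 1 \<Longrightarrow> \<bar>Q x\<bar> \<le> C * real N ^ j * M"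
      using IH[OF js N f] by blast
    define R where "R u = tang i Q u - real j * (u $ i * Q u)" for u
    have "poly_deg (N + 2 * Suc j) R"
      unfolding R_def[abs_def]
      by (intro poly_deg_diff poly_deg_cmult)
        (use poly_deg_tang[OF Q(1), of i] poly_deg_mono[OF poly_deg_coord[OF Q(1), of i]] in auto)
    moreover have "pderivs is (\<lambda>x. f (x /\<^sub>R norm x)) x = R (x /\<^sub>R norm x) / norm x ^ Suc j" if x: "x \<noteq> 0" for x
      unfolding is_eq pderivs_Cons_pd R_def
    proof (rule pd_eqI[where g = "\<lambda>i. (tang i Q (x /\<^sub>R norm x) -
          real j * ((x /\<^sub>R norm x) $ i * Q (x /\<^sub>R norm x))) / norm x ^ Suc j"])
      show "(pderivs js (\<lambda>x. f (x /\<^sub>R norm x)) has_derivative (\<lambda>h. \<Sum>i\<in>UNIV. h $ i * ((tang i Q (x /\<^sub>R norm x) -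
        real j * ((x /\<^sub>R norm x) $ i * Q (x /\<^sub>R norm x))) / norm x ^ Suc j))) (at x)"
        by (rule has_derivative_transform_within_open[OF has_derivative_radial_homogeneous[OF Q(1) x, of j], of "- {0}"])
          (use x Q(2) in auto)
    qed
    moreover have "\<bar>R x\<bar> \<le> (7 + 15 * real j) * C * real N ^ Suc j * M"
      if M: "\<And>x. norm x = 1 \<Longrightarrow> \<bar>f x\<bar> \<le> M" and x: "norm x = 1" for M x
    proof -
      define B where "B = C * real N ^ j * M"
      have Qb: "\<bar>Q x\<bar> \<le> B" if "norm x = 1" for x using Q(3)[OF M that] unfolding B_def by blast
      have B0: "B \<ge> 0" using Qb[OF x] by linarith
      have "\<bar>x $ i * Q x\<bar> \<le> 1 * B"
        unfolding abs_mult using Qb[OF x] component_le_norm_cart[of x i] x B0 by (intro mult_mono) auto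
      then have "\<bar>real j * (x $ i * Q x)\<bar> \<le> real j * B"
        by (simp add: abs_mult mult_left_mono)
      moreover have "\<bar>tang i Q x\<bar> \<le> 7 * real (N + 2 * j) * B"
        by (rule tang_bound[OF Q(1) _ Qb x]) (use N in auto)
      \<comment> \<open>The tangential part contributes \<open>7 * (N + 2 * j)\<close>, the radial
        correction \<open>j\<close>; since \<open>N \<ge> 1\<close> the total is at most
        \<open>(7 + 15 * j) * N\<close>.\<close>
      ultimately have "\<bar>R x\<bar> \<le> (7 * real N + 15 * real j) * B"
        unfolding R_def by (simp add: algebra_simps)
      also have "\<dots> \<le> ((7 + 15 * real j) * real N) * B"
      proof (intro mult_right_mono B0)
        have "15 * real j * 1 \<le> 15 * real j * real N" using N by (intro mult_left_mono) auto
        then show "7 * real N + 15 * real j \<le> (7 + 15 * real j) * real N" by (simp add: algebra_simps)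
      qed
      finally show ?thesis by (simp add: B_def mult_ac)
    qed
    ultimately show ?thesis by blast
  qed
  then show ?case using C by (intro exI[of _ "(7 + 15 * real j) * C"]) auto
qed

text \<open>Existence of partial derivatives does not give a Frechet derivative; the explicit
  polynomial form does, and termwise differentiation of series relies on it.\<close>

lemma pderivs_radial_has_derivative:
  fixes f :: "real^'n \<Rightarrow> real"
  assumes "poly_deg N f" and x: "x \<noteq> 0"
  shows "(pderivs is (\<lambda>x. f (x /\<^sub>R norm x)) has_derivative
    (\<lambda>h. \<Sum>i\<in>UNIV. h $ i * pderivs (i # is) (\<lambda>x. f (x /\<^sub>R norm x)) x)) (at x)"
proof -
  obtain N where N: "N \<ge> 1" "poly_deg N f"
    using assms(1) poly_deg_mono[OF assms(1), of "Suc N"] by auto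
  obtain Q where Q: "poly_deg (N + 2 * length is) Q"
    "\<And>x. x \<noteq> 0 \<Longrightarrow> pderivs is (\<lambda>x. f (x /\<^sub>R norm x)) x = Q (x /\<^sub>R norm x) / norm x ^ length is"
    using pderivs_radial[of "length is", where 'n='n] N by blast
  have D: "(pderivs is (\<lambda>x. f (x /\<^sub>R norm x)) has_derivative (\<lambda>h. \<Sum>i\<in>UNIV. h $ i * ((tang i Q (x /\<^sub>R norm x) -
        real (length is) * ((x /\<^sub>R norm x) $ i * Q (x /\<^sub>R norm x))) / norm x ^ Suc (length is)))) (at x)"
    by (rule has_derivative_transform_within_open[OF has_derivative_radial_homogeneous[OF Q(1) x], of "- {0}"])
      (use x Q(2) in auto)
  show ?thesis using D unfolding pderivs_Cons_pd pd_eqI[OF D] .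
qed

section \<open>Lipschitz and Hoelder bounds on the sphere, and finite nets\<close>

text \<open>Any point of the chord is within 1/2 of one of its endpoints. Short chords thus avoid
  the origin, where the radial extension is singular.\<close>

lemma closed_segment_unit_norm_ge:
  fixes x y :: "'a::real_normed_vector"
  assumes "norm x = 1" "norm y = 1" "norm (x - y) \<le> 1" "z \<in> closed_segment x y"
  shows "norm z \<ge> 1 / 2"
proof -
  obtain t where t: "0 \<le> t" "t \<le> 1" and z: "z = (1 - t) *\<^sub>R x + t *\<^sub>R y"
    using assms(4) unfolding closed_segment_def by blast
  have "x - z = t *\<^sub>R (x - y)" "y - z = (t - 1) *\<^sub>R (x - y)"
    unfolding z by (auto simp: algebra_simps)
  then have e: "norm (x - z) = t * norm (x - y)" "norm (y - z) = (1 - t) * norm (x - y)"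
    using t by auto
  have "t * norm (x - y) \<le> 1 / 2 \<or> (1 - t) * norm (x - y) \<le> 1 / 2"
    using t assms(3) mult_mono[of t "1/2" "norm (x - y)" 1] mult_mono[of "1 - t" "1/2" "norm (x - y)" 1]
    by (cases "t \<le> 1/2") auto
  then show ?thesis
    using norm_triangle_ineq2[of x z] norm_triangle_ineq2[of y z] e assms by auto
qed

text \<open>Mean value theorem for the radial extension along the chord; its derivative carries
  \<open>1 / norm z \<le> 2\<close>, which doubles the Bernstein constant 7 to 14. For distant
  points the trivial bound \<open>2 * M\<close> is already smaller.\<close>

lemma poly_deg_sphere_lipschitz:
  fixes f :: "real^'n \<Rightarrow> real"
  assumes f: "poly_deg N f" "N \<ge> 1" and bd: "\<And>x. norm x = 1 \<Longrightarrow> \<bar>f x\<bar> \<le> M"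
    and xy: "norm x = 1" "norm y = 1"
  shows "\<bar>f x - f y\<bar> \<le> 14 * real N * M * norm (x - y)"
proof (cases "norm (x - y) \<le> 1")
  case True
  have M: "0 \<le> M" using bd[OF xy(1)] by linarith
  have "norm (f (x /\<^sub>R norm x) - f (y /\<^sub>R norm y)) \<le> 14 * real N * M * norm (x - y)"
  proof (rule differentiable_bound[of "closed_segment x y" "\<lambda>x. f (x /\<^sub>R norm x)"])
    fix z assume z: "z \<in> closed_segment x y"
    have nz: "norm z \<ge> 1 / 2"
      using closed_segment_unit_norm_ge[OF xy True z] .
    then have z0: "z \<noteq> 0" by auto
    show "((\<lambda>x. f (x /\<^sub>R norm x)) has_derivative
        (\<lambda>h. (\<Sum>i\<in>UNIV. h $ i * tang i f (z /\<^sub>R norm z)) / norm z)) (at z within closed_segment x y)"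
      using has_derivative_radial[OF f(1) z0] by (rule has_derivative_at_withinI)
    have "onorm (\<lambda>h. (\<Sum>i\<in>UNIV. h $ i * tang i f (z /\<^sub>R norm z)) / norm z) \<le> 14 * real N * M"
    proof (rule onorm_le)
      fix h :: "real^'n"
      have "\<bar>\<Sum>i\<in>UNIV. h $ i * tang i f (z /\<^sub>R norm z)\<bar> \<le> 7 * real N * M * norm h"
        by (rule sum_tang_bound[OF f bd]) (use z0 in auto)
      also have "\<dots> \<le> 7 * real N * M * norm h * (2 * norm z)"
        using nz M mult_left_mono[of 1 "2 * norm z" "7 * real N * M * norm h"] by simp
      finally show "norm ((\<Sum>i\<in>UNIV. h $ i * tang i f (z /\<^sub>R norm z)) / norm z) \<le> 14 * real N * M * norm h"
        using z0 by (simp add: divide_le_eq mult_ac)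
    qed
    then show "onorm (\<lambda>h. (\<Sum>i\<in>UNIV. h $ i * tang i f (z /\<^sub>R norm z)) / norm z) \<le> 14 * real N * M" .
  qed auto
  with xy show ?thesis by simp
next
  case False
  have M: "0 \<le> M" using bd[OF xy(1)] by linarith
  have "\<bar>f x - f y\<bar> \<le> 2 * M" using bd[OF xy(1)] bd[OF xy(2)] by linarith
  also have "\<dots> \<le> 14 * real N * M * 1" using f(2) M mult_right_mono[of 1 "7 * real N" "2 * M"] by simp
  also have "\<dots> \<le> 14 * real N * M * norm (x - y)" using False M by (intro mult_left_mono) auto
  finally show ?thesis .
qed

text \<open>A chord subtending the angle \<open>t\<close> has length
  \<open>2 * sin (t / 2) \<le> t\<close>.\<close>

lemma norm_diff_le_geo_dist:
  fixes x y :: "real^'n"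
  assumes "norm x = 1" "norm y = 1"
  shows "norm (x - y) \<le> geo_dist x y"
proof -
  have b: "\<bar>x \<bullet> y\<bar> \<le> 1" using Cauchy_Schwarz_ineq2[of x y] assms by simp
  define t where "t = arccos (x \<bullet> y)"
  have t: "0 \<le> t" "cos t = x \<bullet> y" using b arccos_lbound[of "x \<bullet> y"] unfolding t_def by auto
  have "norm (x - y) ^ 2 = 2 - 2 * (x \<bullet> y)"
    using assms unfolding power2_norm_eq_inner norm_eq_1
    by (simp add: inner_diff_left inner_diff_right inner_commute)
  also have "\<dots> = 4 * (sin (t / 2)) ^ 2"
    using cos_double_sin[of "t / 2"] t(2) by simp
  also have "\<dots> \<le> 4 * (t / 2) ^ 2"
  proof -
    have "\<bar>sin (t / 2)\<bar> \<le> \<bar>t / 2\<bar>" by (rule abs_sin_x_le_abs_x)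
    then show ?thesis unfolding abs_le_square_iff by (intro mult_left_mono) auto
  qed
  finally have "norm (x - y) ^ 2 \<le> t ^ 2" by (simp add: power_divide)
  then show ?thesis unfolding geo_dist_def t_def[symmetric] using t(1) by (rule power2_le_imp_le)
qed

text \<open>Interpolation between the Lipschitz bound and the sup bound: the smaller of
  \<open>s\<close> and 1 is at most \<open>s powr a\<close>, with
  \<open>s = N * norm (x - y)\<close>.\<close>

lemma poly_deg_sphere_holder:
  fixes f :: "real^'n \<Rightarrow> real"
  assumes f: "poly_deg N f" "N \<ge> 1" and bd: "\<And>x. norm x = 1 \<Longrightarrow> \<bar>f x\<bar> \<le> M"
    and xy: "norm x = 1" "norm y = 1" and a: "0 < a" "a \<le> 1"
  shows "\<bar>f x - f y\<bar> \<le> 14 * M * real N powr a * geo_dist x y powr a"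
proof -
  define s where "s = real N * norm (x - y)"
  have M: "0 \<le> M" using bd[OF xy(1)] by linarith
  have s: "s \<ge> 0" unfolding s_def by simp
  have 1: "\<bar>f x - f y\<bar> \<le> 14 * M * s"
    using poly_deg_sphere_lipschitz[OF f bd xy] unfolding s_def by (simp add: mult_ac)
  have 2: "\<bar>f x - f y\<bar> \<le> 14 * M" using bd[OF xy(1)] bd[OF xy(2)] M by linarith
  have "\<bar>f x - f y\<bar> \<le> 14 * M * s powr a"
  proof (cases "s \<le> 1")
    case True
    have "s \<le> s powr a"
      using powr_mono'[of a 1 s] True s a by (cases "s = 0") auto
    then have "14 * M * s \<le> 14 * M * s powr a" using M by (intro mult_left_mono) auto
    with 1 show ?thesis by linarith
  next
    case False
    then have "1 \<le> s powr a" using a by (intro ge_one_powr_ge_zero) auto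
    then have "14 * M * 1 \<le> 14 * M * s powr a" using M by (intro mult_left_mono) auto
    with 2 show ?thesis by linarith
  qed
  also have "\<dots> \<le> 14 * M * (real N powr a * geo_dist x y powr a)"
    unfolding s_def powr_mult using M a norm_diff_le_geo_dist[OF xy]
    by (intro mult_left_mono powr_mono2) auto
  finally show ?thesis by (simp add: mult_ac)
qed

text \<open>At a maximum point \<open>y\<close> of \<open>\<bar>f\<bar>\<close> the Lipschitz bound
  holds with \<open>M = \<bar>f y\<bar>\<close> itself, so moving to a net point within
  \<open>1 / (28 * N)\<close> loses at most half of the maximum.\<close>

lemma sphere_net:
  assumes N: "N \<ge> 1"
  obtains Z :: "(real^'n) set" where "finite Z" "Z \<subseteq> sphere 0 1"
    "real (card Z) \<le> (84 * real CARD('n) * real N) ^ CARD('n)"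
    "\<And>f B x. poly_deg N f \<Longrightarrow> (\<And>z. z \<in> Z \<Longrightarrow> \<bar>f z\<bar> \<le> B) \<Longrightarrow> norm x = 1 \<Longrightarrow> \<bar>f x\<bar> \<le> 2 * B"
proof -
  \<comment> \<open>The mesh is \<open>1 / n\<close>; the l1 bound for the norm over
    \<open>CARD('n)\<close> coordinates gives distance at most \<open>1 / (28 * N)\<close>, and 28
    is twice the Lipschitz constant 14. The 84 in the cardinality comes from
    \<open>2 * n + 1 \<le> 3 * n\<close>.\<close>
  define n where "n = 28 * N * CARD('n)"
  have n: "n \<ge> 1" using N unfolding n_def by (simp add: Suc_le_eq)
  define \<phi> :: "real^'n \<Rightarrow> 'n \<Rightarrow> int" where "\<phi> x i = \<lfloor>real n * x $ i\<rfloor>" for x i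
  define S :: "(real^'n) set" where "S = sphere 0 1"
  \<comment> \<open>One representative of each grid cell that meets the sphere, chosen on the sphere
    itself.\<close>
  define Z where "Z = inv_into S \<phi> ` (\<phi> ` S)"
  have sub: "\<phi> ` S \<subseteq> (\<Pi>\<^sub>E i\<in>UNIV. {- int n..int n})"
  proof safe
    fix x i assume "x \<in> S"
    then have "\<bar>x $ i\<bar> \<le> 1" using component_le_norm_cart[of x i] by (simp add: S_def)
    then have "\<bar>real n * x $ i\<bar> \<le> real n" by (simp add: abs_mult mult_left_le)
    then show "\<phi> x i \<in> {- int n..int n}" unfolding \<phi>_def
      by (auto simp: le_floor_iff floor_le_iff)
  qed auto
  have fin: "finite (\<Pi>\<^sub>E i\<in>(UNIV::'n set). {- int n..int n})" by (intro finite_PiE) auto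
  have finZ: "finite Z" unfolding Z_def using finite_subset[OF sub fin] by blast
  have ZS: "Z \<subseteq> S" unfolding Z_def using inv_into_into by (auto intro: inv_into_into)
  have "card Z \<le> card (\<phi> ` S)" unfolding Z_def by (intro card_image_le finite_subset[OF sub fin])
  also have "\<dots> \<le> card (\<Pi>\<^sub>E i\<in>(UNIV::'n set). {- int n..int n})" by (intro card_mono sub fin)
  also have "\<dots> = (2 * n + 1) ^ CARD('n)" by (subst card_PiE) (auto simp: nat_add_distrib nat_mult_distrib)
  also have "\<dots> \<le> (3 * n) ^ CARD('n)" using n by (intro power_mono) auto
  finally have "real (card Z) \<le> real ((3 * n) ^ CARD('n))" by (rule of_nat_mono)
  then have cardZ: "real (card Z) \<le> (84 * real CARD('n) * real N) ^ CARD('n)"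
    unfolding n_def by (simp add: mult_ac)
  have close: "\<exists>z\<in>Z. 28 * real N * norm (x - z) \<le> 1" if x: "x \<in> S" for x
  proof
    define z where "z = inv_into S \<phi> (\<phi> x)"
    show "inv_into S \<phi> (\<phi> x) \<in> Z" unfolding Z_def using x by blast
    have "\<phi> z = \<phi> x" unfolding z_def using x by (intro f_inv_into_f) auto
    have "\<bar>(x - z) $ i\<bar> \<le> 1 / real n" for i
    proof -
      have "\<lfloor>real n * x $ i\<rfloor> = \<lfloor>real n * z $ i\<rfloor>"
        using \<open>\<phi> z = \<phi> x\<close> unfolding \<phi>_def by (metis)
      then have "\<bar>real n * x $ i - real n * z $ i\<bar> \<le> 1" by linarith
      then have "real n * \<bar>(x - z) $ i\<bar> \<le> 1"
        by (simp add: right_diff_distrib[symmetric] abs_mult)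
      then show ?thesis using n by (simp add: field_simps)
    qed
    then have "norm (x - z) \<le> (\<Sum>i\<in>(UNIV::'n set). 1 / real n)"
      using norm_le_l1_cart[of "x - z"] sum_mono[of UNIV "\<lambda>i. \<bar>(x - z) $ i\<bar>" "\<lambda>i. 1 / real n"] by simp
    also have "\<dots> = 1 / (28 * real N)" unfolding n_def by simp
    finally show "28 * real N * norm (x - inv_into S \<phi> (\<phi> x)) \<le> 1"
      using N unfolding z_def by (simp add: field_simps)
  qed
  have bound: "\<bar>f x\<bar> \<le> 2 * B"
    if f: "poly_deg N f" and B: "\<And>z. z \<in> Z \<Longrightarrow> \<bar>f z\<bar> \<le> B" and x: "norm x = 1" for f B x
  proof -
    have "compact S" "x \<in> S" unfolding S_def using x by auto
    then obtain y where y: "y \<in> S" "\<And>w. w \<in> S \<Longrightarrow> \<bar>f w\<bar> \<le> \<bar>f y\<bar>"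
      using continuous_attains_sup[of S "\<lambda>x. \<bar>f x\<bar>"] poly_deg_continuous_on[OF f]
      by (metis continuous_on_rabs empty_iff)
    obtain z where z: "z \<in> Z" "28 * real N * norm (y - z) \<le> 1" using close[OF y(1)] by blast
    have "\<bar>f y - f z\<bar> \<le> 14 * real N * \<bar>f y\<bar> * norm (y - z)"
      using y z ZS unfolding S_def by (intro poly_deg_sphere_lipschitz[OF f N]) auto
    also have "\<dots> = (28 * real N * norm (y - z)) * (\<bar>f y\<bar> / 2)" by simp
    also have "\<dots> \<le> 1 * (\<bar>f y\<bar> / 2)" using z by (intro mult_right_mono) auto
    finally have "\<bar>f y\<bar> \<le> 2 * \<bar>f z\<bar>" by linarith
    with B[OF z(1)] y(2)[OF \<open>x \<in> S\<close>] show ?thesis by linarith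
  qed
  show thesis
  proof (rule that[OF finZ ZS[unfolded S_def] cardZ])
    fix f :: "real^'n \<Rightarrow> real" and B and x :: "real^'n"
    assume "poly_deg N f" "\<And>z. z \<in> Z \<Longrightarrow> \<bar>f z\<bar> \<le> B" "norm x = 1"
    then show "\<bar>f x\<bar> \<le> 2 * B" by (rule bound)
  qed
qed

section \<open>Smoothness of series of polynomials on the sphere\<close>

text \<open>One further derivative of the sum: locally uniform convergence of the next partial
  derivatives, by the M-test with \<open>pderivs_radial\<close>, permits termwise
  differentiation.\<close>

lemma sphere_series_pderivs_step:
  fixes f :: "nat \<Rightarrow> real^'n \<Rightarrow> real" and F :: "real^'n \<Rightarrow> real" and N :: "nat \<Rightarrow> nat"
  defines "E \<equiv> \<lambda>k x. f k (x /\<^sub>R norm x)" and "G \<equiv> \<lambda>x. F (x /\<^sub>R norm x)"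
  assumes f: "\<And>k. poly_deg (N k) (f k)" and N: "\<And>k. N k \<ge> 1"
    and bd: "\<And>k x. norm x = 1 \<Longrightarrow> \<bar>f k x\<bar> \<le> M k"
    and summ: "summable (\<lambda>k. real (N k) ^ Suc (length is) * M k)"
    and IH: "\<And>x. x \<noteq> 0 \<Longrightarrow> (\<lambda>k. pderivs is (E k) x) sums pderivs is G x"
    and y: "y \<noteq> 0"
  shows "pderivs is G differentiable (at y)"
    and "(\<lambda>k. pderivs (i # is) (E k) y) sums pderivs (i # is) G y"
proof -
  define j where "j = Suc (length is)"
  \<comment> \<open>On this ball the norm stays above \<open>norm y / 2\<close>, so the factor
    \<open>1 / norm x ^ j\<close> in the derivative bounds is uniformly controlled.\<close>
  define B where "B = ball y (norm y / 2)"
  have By: "y \<in> B" using y by (simp add: B_def)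
  have Bn: "norm x \<ge> norm y / 2" if "x \<in> B" for x
    using that norm_triangle_ineq2[of y x] unfolding B_def by (simp add: dist_norm)
  then have B0: "x \<noteq> 0" if "x \<in> B" for x using that y by fastforce
  define D where "D k i x = pderivs (i # is) (E k) x" for k i x
  obtain C where C: "C \<ge> 0" and Cb: "\<And>k i x. x \<noteq> 0 \<Longrightarrow> \<bar>D k i x\<bar> \<le> C * real (N k) ^ j * M k / norm x ^ j"
  proof -
    obtain C where C: "C \<ge> 0" and Cb: "\<And>N (f :: real^'n \<Rightarrow> real) is. length is = j \<Longrightarrow> N \<ge> 1 \<Longrightarrow> poly_deg N f \<Longrightarrow>
       \<exists>Q. poly_deg (N + 2 * j) Q \<and>
       (\<forall>x. x \<noteq> 0 \<longrightarrow> pderivs is (\<lambda>x. f (x /\<^sub>R norm x)) x = Q (x /\<^sub>R norm x) / norm x ^ j) \<and>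
       (\<forall>M. (\<forall>x. norm x = 1 \<longrightarrow> \<bar>f x\<bar> \<le> M) \<longrightarrow> (\<forall>x. norm x = 1 \<longrightarrow> \<bar>Q x\<bar> \<le> C * real N ^ j * M))"
      using pderivs_radial[of j, where 'n='n] by blast
    have "\<bar>D k i x\<bar> \<le> C * real (N k) ^ j * M k / norm x ^ j" if x: "x \<noteq> 0" for k i x
    proof -
      obtain Q where Q: "\<And>x. x \<noteq> 0 \<Longrightarrow> D k i x = Q (x /\<^sub>R norm x) / norm x ^ j"
        "\<And>x. norm x = 1 \<Longrightarrow> \<bar>Q x\<bar> \<le> C * real (N k) ^ j * M k"
        using Cb[of "i # is" "N k" "f k"] f N bd unfolding D_def E_def j_def by force
      have "\<bar>Q (x /\<^sub>R norm x)\<bar> \<le> C * real (N k) ^ j * M k" by (rule Q(2)) (use x in simp)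
      then show ?thesis unfolding Q(1)[OF x] abs_divide
        by (simp add: divide_right_mono)
    qed
    with C that show thesis by blast
  qed
  have Mk: "M k \<ge> 0" for k
    using bd[of "axis undefined 1" k] by (simp add: norm_axis_1)
  have ul: "uniform_limit B (\<lambda>n x. \<Sum>k<n. D k i x) (\<lambda>x. \<Sum>k. D k i x) sequentially" for i
  proof (rule Weierstrass_m_test)
    show "summable (\<lambda>k. (C / (norm y / 2) ^ j) * (real (N k) ^ j * M k))"
      using summ unfolding j_def by (rule summable_mult)
    fix k x assume x: "x \<in> B"
    have "norm (D k i x) \<le> C * real (N k) ^ j * M k / norm x ^ j"
      using Cb[OF B0[OF x]] by simp
    also have "\<dots> \<le> C * real (N k) ^ j * M k / (norm y / 2) ^ j"
      using Bn[OF x] y C Mk by (intro divide_left_mono power_mono mult_nonneg_nonneg mult_pos_pos zero_less_power) (use B0[OF x] in auto)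
    finally show "norm (D k i x) \<le> (C / (norm y / 2) ^ j) * (real (N k) ^ j * M k)"
      by (simp add: mult_ac)
  qed
  have ev: "\<forall>\<^sub>F n in sequentially. \<forall>x\<in>B. \<forall>h. norm ((\<Sum>k<n. \<Sum>i\<in>UNIV. h $ i * D k i x)
      - (\<Sum>i\<in>UNIV. h $ i * (\<Sum>k. D k i x))) \<le> e * norm h" if e: "e > 0" for e
  proof -
    define e' where "e' = e / real CARD('n)"
    have e': "e' > 0" using e unfolding e'_def by simp
    have "\<forall>\<^sub>F n in sequentially. \<forall>i\<in>UNIV. \<forall>x\<in>B. dist (\<Sum>k<n. D k i x) (\<Sum>k. D k i x) < e'"
      using uniform_limitD[OF ul e'] by (intro eventually_ball_finite) auto
    then show ?thesis
    proof eventually_elim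
      case (elim n)
      show ?case
      proof (intro ballI allI)
        fix x and h :: "real^'n" assume x: "x \<in> B"
        have "(\<Sum>k<n. \<Sum>i\<in>UNIV. h $ i * D k i x) - (\<Sum>i\<in>UNIV. h $ i * (\<Sum>k. D k i x))
          = (\<Sum>i\<in>UNIV. h $ i * ((\<Sum>k<n. D k i x) - (\<Sum>k. D k i x)))"
          by (subst sum.swap) (simp add: sum_distrib_left right_diff_distrib sum_subtractf)
        also have "norm \<dots> \<le> (\<Sum>i\<in>(UNIV::'n set). norm h * e')"
        proof (rule order_trans[OF norm_sum sum_mono])
          fix i
          show "norm (h $ i * ((\<Sum>k<n. D k i x) - (\<Sum>k. D k i x))) \<le> norm h * e'"
            unfolding norm_mult using elim x component_le_norm_cart[of h i]
            by (intro mult_mono) (auto simp: dist_norm less_imp_le)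
        qed
        also have "\<dots> = e * norm h" unfolding e'_def by simp
        finally show "norm ((\<Sum>k<n. \<Sum>i\<in>UNIV. h $ i * D k i x)
          - (\<Sum>i\<in>UNIV. h $ i * (\<Sum>k. D k i x))) \<le> e * norm h" .
      qed
    qed
  qed
  have "\<exists>g. \<forall>x\<in>B. (\<lambda>k. pderivs is (E k) x) sums (g x) \<and>
     (g has_derivative (\<lambda>h. \<Sum>i\<in>UNIV. h $ i * (\<Sum>k. D k i x))) (at x within B)"
  proof (rule has_derivative_series[where f' = "\<lambda>k x h. \<Sum>i\<in>UNIV. h $ i * D k i x"])
    show "convex B" unfolding B_def by simp
    show "(pderivs is (E k) has_derivative (\<lambda>h. \<Sum>i\<in>UNIV. h $ i * D k i x)) (at x within B)" if "x \<in> B" for k x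
      unfolding D_def E_def
      using pderivs_radial_has_derivative[OF f B0[OF that]] by (rule has_derivative_at_withinI)
    show "y \<in> B" by fact
    show "(\<lambda>k. pderivs is (E k) y) sums pderivs is G y" using IH[OF y] .
  qed (use ev in blast)
  then obtain g where g: "\<And>x. x \<in> B \<Longrightarrow> (\<lambda>k. pderivs is (E k) x) sums (g x)"
    "\<And>x. x \<in> B \<Longrightarrow> (g has_derivative (\<lambda>h. \<Sum>i\<in>UNIV. h $ i * (\<Sum>k. D k i x))) (at x within B)"
    by blast
  have "(g has_derivative (\<lambda>h. \<Sum>i\<in>UNIV. h $ i * (\<Sum>k. D k i y))) (at y)"
    using g(2)[OF By] By at_within_open[of y B] unfolding B_def by simp
  then have dG: "(pderivs is G has_derivative (\<lambda>h. \<Sum>i\<in>UNIV. h $ i * (\<Sum>k. D k i y))) (at y)"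
  proof (rule has_derivative_transform_within_open)
    show "open B" "y \<in> B" using By unfolding B_def by auto
    show "g x = pderivs is G x" if "x \<in> B" for x
      using sums_unique2[OF g(1)[OF that] IH[OF B0[OF that]]] .
  qed
  then show "pderivs is G differentiable (at y)" by (rule differentiableI)
  have "(\<lambda>k. D k i y) sums (\<Sum>k. D k i y)"
    using tendsto_uniform_limitI[OF ul By] unfolding sums_def .
  then show "(\<lambda>k. pderivs (i # is) (E k) y) sums pderivs (i # is) G y"
    unfolding pderivs_Cons_pd[of i "is" G] pd_eqI[OF dG] unfolding D_def .
qed

text \<open>Differentiating \<open>K\<close> times costs \<open>N ^ K\<close> and the Hoelder
  seminorm of order \<open>a\<close> costs \<open>N powr a\<close>; together this is
  \<open>N powr g\<close>, exactly the weight in \<open>summ\<close>. Lower orders are dominated by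
  the same weight because \<open>N \<ge> 1\<close>.\<close>

lemma sphere_holder_series:
  fixes f :: "nat \<Rightarrow> real^'n \<Rightarrow> real" and F :: "real^'n \<Rightarrow> real" and N :: "nat \<Rightarrow> nat"
  assumes g: "g > 0"
    and f: "\<And>k. poly_deg (N k) (f k)" and N: "\<And>k. N k \<ge> 1"
    and bd: "\<And>k x. norm x = 1 \<Longrightarrow> \<bar>f k x\<bar> \<le> M k"
    and summ: "summable (\<lambda>k. real (N k) powr g * M k)"
    and F: "\<And>x. norm x = 1 \<Longrightarrow> (\<lambda>k. f k x) sums F x"
  shows "sphere_holder g F"
proof -
  define K where "K = nat (\<lceil>g\<rceil> - 1)"
  define a where "a = g - real K"
  have "\<lceil>g\<rceil> \<ge> 1" using g by simp
  then have K: "real K = of_int \<lceil>g\<rceil> - 1" unfolding K_def by simp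
  then have a: "0 < a" "a \<le> 1" and Kg: "real K < g"
    unfolding a_def by linarith+
  define E where "E = (\<lambda>k x. f k (x /\<^sub>R norm x))"
  define G where "G = (\<lambda>x. F (x /\<^sub>R norm x))"
  have E_eq: "(\<lambda>x. f k (x /\<^sub>R norm x)) = E k" for k by (simp add: E_def)
  note step = sphere_series_pderivs_step[where F = F, OF f N bd, folded G_def, unfolded E_eq]
  have Mk: "M k \<ge> 0" for k
    using bd[of "axis undefined 1" k] by (simp add: norm_axis_1)
  have summj: "summable (\<lambda>k. real (N k) ^ j * M k)" if "j \<le> K" for j
  proof (rule summable_comparison_test'[OF summ])
    fix k
    have "real (N k) ^ j = real (N k) powr real j"
      using N[of k] by (subst powr_realpow) auto
    also have "\<dots> \<le> real (N k) powr g" using N[of k] that Kg by (intro powr_mono) auto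
    finally show "norm (real (N k) ^ j * M k) \<le> real (N k) powr g * M k"
      using Mk[of k] by (simp add: mult_right_mono)
  qed
  have sums: "length is \<le> K \<Longrightarrow> x \<noteq> 0 \<Longrightarrow> (\<lambda>k. pderivs is (E k) x) sums pderivs is G x" for "is" x
  proof (induction "is" arbitrary: x)
    case Nil
    then show ?case using F[of "x /\<^sub>R norm x"] by (simp add: E_def G_def)
  next
    case (Cons i "is")
    show ?case
      by (rule step(2)) (use summj[of "Suc (length is)"] Cons in auto)
  qed
  have diff: "pderivs is G differentiable (at y)" if "length is < K" "y \<noteq> 0" for "is" y
    by (rule step(1)) (use summj[of "Suc (length is)"] sums[of "is"] that in auto)
  have hold: "holder_wrt geo_dist a (sphere 0 1) (pderivs is G)" if len: "length is = K" for "is"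
  proof -
    obtain C where C: "C \<ge> 0" and Cb: "\<And>N (f :: real^'n \<Rightarrow> real) is. length is = K \<Longrightarrow> N \<ge> 1 \<Longrightarrow> poly_deg N f \<Longrightarrow>
       \<exists>Q. poly_deg (N + 2 * K) Q \<and>
       (\<forall>x. x \<noteq> 0 \<longrightarrow> pderivs is (\<lambda>x. f (x /\<^sub>R norm x)) x = Q (x /\<^sub>R norm x) / norm x ^ K) \<and>
       (\<forall>M. (\<forall>x. norm x = 1 \<longrightarrow> \<bar>f x\<bar> \<le> M) \<longrightarrow> (\<forall>x. norm x = 1 \<longrightarrow> \<bar>Q x\<bar> \<le> C * real N ^ K * M))"
      using pderivs_radial[of K, where 'n='n] by blast
    define c where "c = 14 * C * (1 + 2 * real K) powr a"
    have c0: "c \<ge> 0" unfolding c_def using C by simp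
    have one: "\<bar>pderivs is (E k) x - pderivs is (E k) y\<bar> \<le> c * (real (N k) powr g * M k) * geo_dist x y powr a"
      if xy: "norm x = 1" "norm y = 1" for k x y
    proof -
      obtain Q where Q: "poly_deg (N k + 2 * K) Q" 
        "\<And>x. x \<noteq> 0 \<Longrightarrow> pderivs is (E k) x = Q (x /\<^sub>R norm x) / norm x ^ K"
        "\<And>x. norm x = 1 \<Longrightarrow> \<bar>Q x\<bar> \<le> C * real (N k) ^ K * M k"
        using Cb[OF len N f, of k] bd unfolding E_def by blast
      have "x \<noteq> 0" "y \<noteq> 0" using xy by auto
      then have "\<bar>pderivs is (E k) x - pderivs is (E k) y\<bar> = \<bar>Q x - Q y\<bar>"
        using Q(2)[of x] Q(2)[of y] xy by simp
      also have "\<dots> \<le> 14 * (C * real (N k) ^ K * M k) * real (N k + 2 * K) powr a * geo_dist x y powr a"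
        using N[of k] by (intro poly_deg_sphere_holder[OF Q(1) _ Q(3) xy a]) auto
      also have "\<dots> \<le> 14 * (C * real (N k) ^ K * M k) * ((1 + 2 * real K) powr a * real (N k) powr a) * geo_dist x y powr a"
      proof (intro mult_right_mono mult_left_mono)
        have "real (N k + 2 * K) \<le> (1 + 2 * real K) * real (N k)"
          using N[of k] mult_left_mono[of 1 "real (N k)" "2 * real K"] by (simp add: algebra_simps)
        then have "real (N k + 2 * K) powr a \<le> ((1 + 2 * real K) * real (N k)) powr a"
          using a by (intro powr_mono2) auto
        then show "real (N k + 2 * K) powr a \<le> (1 + 2 * real K) powr a * real (N k) powr a"
          by (simp add: powr_mult)
      qed (use C Mk in auto)
      also have "real (N k) ^ K = real (N k) powr real K"
        using N[of k] by (subst powr_realpow) auto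
      finally have "\<bar>pderivs is (E k) x - pderivs is (E k) y\<bar> \<le>
          c * ((real (N k) powr real K * real (N k) powr a) * M k) * geo_dist x y powr a"
        unfolding c_def by (simp only: mult_ac)
      also have "real (N k) powr real K * real (N k) powr a = real (N k) powr g"
        unfolding powr_add[symmetric] a_def by simp
      finally show ?thesis .
    qed
    show ?thesis unfolding holder_wrt_def
    proof (intro exI ballI)
      fix x y :: "real^'n" assume "x \<in> sphere 0 1" "y \<in> sphere 0 1"
      then have xy: "norm x = 1" "norm y = 1" by auto
      then have "x \<noteq> 0" "y \<noteq> 0" by auto
      then have d: "(\<lambda>k. pderivs is (E k) x - pderivs is (E k) y) sums (pderivs is G x - pderivs is G y)"
        using len by (intro sums_diff sums) auto
      have s: "summable (\<lambda>k. c * (real (N k) powr g * M k) * geo_dist x y powr a)"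
        by (intro summable_mult summable_mult2 summ)
      have "\<bar>\<Sum>k. pderivs is (E k) x - pderivs is (E k) y\<bar> \<le> (\<Sum>k. c * (real (N k) powr g * M k) * geo_dist x y powr a)"
        using norm_suminf_le[OF _ s, of "\<lambda>k. pderivs is (E k) x - pderivs is (E k) y"] one[OF xy]
        by simp
      also have "\<dots> = (\<Sum>k. c * (real (N k) powr g * M k)) * geo_dist x y powr a"
        by (intro suminf_mult2[symmetric] summable_mult summ)
      finally show "\<bar>pderivs is G x - pderivs is G y\<bar> \<le> (\<Sum>k. c * (real (N k) powr g * M k)) * geo_dist x y powr a"
        using sums_unique[OF d] by simp
    qed
  qed
  show ?thesis
    unfolding sphere_holder_def Let_def
    using diff hold unfolding G_def a_def K_def by blast
qed

section \<open>Harmonic homogeneous polynomials\<close>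

text \<open>Connects \<open>pd\<close> with the one-variable \<open>deriv\<close> used in
  \<open>laplacian\<close>, and with restrictions to coordinate lines.\<close>

lemma poly_deg_line_derivative:
  assumes "poly_deg N f"
  shows "((\<lambda>r. f (x + r *\<^sub>R axis i 1)) has_real_derivative pd i f (x + s *\<^sub>R axis i 1)) (at s)"
proof -
  have "((\<lambda>r. x + r *\<^sub>R axis i 1) has_derivative (\<lambda>h. h *\<^sub>R axis i 1)) (at s)"
    by (auto intro!: derivative_eq_intros)
  then have "((\<lambda>r. f (x + r *\<^sub>R axis i 1)) has_derivative
     (\<lambda>h. \<Sum>j\<in>UNIV. (h *\<^sub>R axis i 1) $ j * pd j f (x + s *\<^sub>R axis i 1))) (at s)"
    by (rule has_derivative_compose) (rule poly_deg_has_derivative[OF assms])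
  moreover have "(\<Sum>j\<in>UNIV. (h *\<^sub>R axis i 1) $ j * pd j f (x + s *\<^sub>R axis i 1))
      = pd i f (x + s *\<^sub>R axis i 1) * h" for h
  proof -
    have "(\<Sum>j\<in>UNIV. (h *\<^sub>R axis i 1) $ j * pd j f (x + s *\<^sub>R axis i 1))
      = (\<Sum>j\<in>UNIV. if j = i then h * pd i f (x + s *\<^sub>R axis i 1) else 0)"
      by (intro sum.cong) (auto simp: axis_def)
    then show ?thesis by simp
  qed
  ultimately show ?thesis unfolding has_field_derivative_def by simp
qed

lemma pd_sum:
  assumes "\<And>k. k \<in> I \<Longrightarrow> poly_deg N (f k)"
  shows "pd i (\<lambda>x. \<Sum>k\<in>I. c k * f k x) x = (\<Sum>k\<in>I. c k * pd i (f k) x)"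
proof (rule pd_eqI)
  have "((\<lambda>x. \<Sum>k\<in>I. c k * f k x) has_derivative (\<lambda>h. \<Sum>k\<in>I. c k * (\<Sum>i\<in>UNIV. h $ i * pd i (f k) x))) (at x)"
    by (intro has_derivative_sum has_derivative_mult_right poly_deg_has_derivative) (rule assms)
  moreover have "(\<Sum>k\<in>I. c k * (\<Sum>i\<in>UNIV. h $ i * pd i (f k) x)) = (\<Sum>i\<in>UNIV. h $ i * (\<Sum>k\<in>I. c k * pd i (f k) x))" for h
    unfolding sum_distrib_left by (subst sum.swap) (simp add: mult_ac)
  ultimately show "((\<lambda>x. \<Sum>k\<in>I. c k * f k x) has_derivative (\<lambda>h. \<Sum>i\<in>UNIV. h $ i * (\<Sum>k\<in>I. c k * pd i (f k) x))) (at x)"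
    by simp
qed

lemma pd_add:
  assumes "poly_deg N f" "poly_deg N g"
  shows "pd i (\<lambda>x. f x + g x) x = pd i f x + pd i g x"
  by (rule pd_eqI[where g = "\<lambda>i. pd i f x + pd i g x"])
    (use has_derivative_add[OF poly_deg_has_derivative[OF assms(1)] poly_deg_has_derivative[OF assms(2)], of x]
      in \<open>simp add: distrib_left sum.distrib\<close>)

lemma pd_cmult:
  assumes "poly_deg N f"
  shows "pd i (\<lambda>x. c * f x) x = c * pd i f x"
  using pd_sum[of "{()}" N "\<lambda>_. f" i "\<lambda>_. c" x] assms by simp

lemma pd_const: "pd i (\<lambda>x. c) x = 0"
  by (rule pd_eqI[where g = "\<lambda>i. 0"]) simp

lemma pd_coord:
  assumes "poly_deg N f"
  shows "pd i (\<lambda>x. x $ k * f x) x = (if i = k then 1 else 0) * f x + x $ k * pd i f x"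
proof (rule pd_eqI[where g = "\<lambda>i. (if i = k then 1 else 0) * f x + x $ k * pd i f x"])
  have "((\<lambda>x. x $ k * f x) has_derivative (\<lambda>h. x $ k * (\<Sum>i\<in>UNIV. h $ i * pd i f x) + h $ k * f x)) (at x)"
    by (intro has_derivative_mult poly_deg_has_derivative[OF assms] bounded_linear_imp_has_derivative bounded_linear_vec_nth)
  moreover have "x $ k * (\<Sum>i\<in>UNIV. h $ i * pd i f x) + h $ k * f x =
      (\<Sum>i\<in>UNIV. h $ i * ((if i = k then 1 else 0) * f x + x $ k * pd i f x))" for h
  proof -
    have "h $ i * ((if i = k then 1 else 0) * f x + x $ k * pd i f x) =
        x $ k * (h $ i * pd i f x) + (if i = k then h $ k * f x else 0)" for i
      by (simp add: algebra_simps)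
    then show ?thesis by (simp add: sum.distrib sum_distrib_left)
  qed
  ultimately show "((\<lambda>x. x $ k * f x) has_derivative
      (\<lambda>h. \<Sum>i\<in>UNIV. h $ i * ((if i = k then 1 else 0) * f x + x $ k * pd i f x))) (at x)"
    by simp
qed

text \<open>Induction over the polynomial: in the coordinate case the second derivative of
  \<open>x $ k * f x\<close> has a formula whose only part not visibly symmetric in \<open>i\<close>
  and \<open>j\<close> is the second derivative of \<open>f\<close>.\<close>

lemma pd_commute: "poly_deg N f \<Longrightarrow> pd i (pd j f) x = pd j (pd i f) x"
proof (induction arbitrary: x rule: poly_deg.induct)
  case (poly_deg_const N c)
  have "pd i (\<lambda>x. c) = (\<lambda>x. 0)" for i :: 'a by (rule ext) (rule pd_const)
  then show ?case by (simp add: pd_const)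
next
  case (poly_deg_coord N f k)
  have "pd i (pd j (\<lambda>x. x $ k * f x)) x =
      (if j = k then 1 else 0) * pd i f x + (if i = k then 1 else 0) * pd j f x + x $ k * pd i (pd j f) x" for i j
  proof -
    have "pd j (\<lambda>x. x $ k * f x) = (\<lambda>x. (if j = k then 1 else 0) * f x + x $ k * pd j f x)"
      by (rule ext) (rule pd_coord[OF poly_deg_coord.hyps])
    moreover have "pd i (\<lambda>x. (if j = k then 1 else 0) * f x + x $ k * pd j f x) x =
      pd i (\<lambda>x. (if j = k then 1 else 0) * f x) x + pd i (\<lambda>x. x $ k * pd j f x) x"
      by (rule pd_add[OF poly_deg_cmult[OF poly_deg_mono[OF poly_deg_coord.hyps le_SucI[OF order_refl]]]
            poly_deg.poly_deg_coord[OF poly_deg_pd[OF poly_deg_coord.hyps]]])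
    ultimately show ?thesis
      by (simp only: pd_cmult[OF poly_deg_coord.hyps] pd_coord[OF poly_deg_pd[OF poly_deg_coord.hyps]])
  qed
  then show ?case using poly_deg_coord.IH by (simp add: add_ac)
next
  case (poly_deg_add N f g)
  have "pd i (pd j (\<lambda>x. f x + g x)) x = pd i (pd j f) x + pd i (pd j g) x" for i j
  proof -
    have "pd j (\<lambda>x. f x + g x) = (\<lambda>x. pd j f x + pd j g x)"
      by (rule ext) (rule pd_add[OF poly_deg_add.hyps])
    then show ?thesis
      using pd_add[OF poly_deg_pd[OF poly_deg_add.hyps(1)] poly_deg_pd[OF poly_deg_add.hyps(2)]] by simp
  qed
  then show ?case using poly_deg_add.IH by simp
qed

section \<open>Homogeneous and harmonic polynomials under rotations\<close>

text \<open>Generating rules replace the multi-index sum of \<open>homog_poly\<close> and supply an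
  induction principle. Constants live in degree 0 only, so the zero function has its own rule in
  every degree; empty sums rest on it.\<close>

inductive hom_poly :: "nat \<Rightarrow> (real^'n \<Rightarrow> real) \<Rightarrow> bool" where
  hom_poly_const: "hom_poly 0 (\<lambda>x. c)"
| hom_poly_zero: "hom_poly l (\<lambda>x. 0)"
| hom_poly_coord: "hom_poly l f \<Longrightarrow> hom_poly (Suc l) (\<lambda>x. x $ i * f x)"
| hom_poly_add: "hom_poly l f \<Longrightarrow> hom_poly l g \<Longrightarrow> hom_poly l (\<lambda>x. f x + g x)"

lemma hom_poly_imp_poly_deg: "hom_poly l f \<Longrightarrow> poly_deg l f"
  by (induction rule: hom_poly.induct) (auto intro: poly_deg.intros)

lemma hom_poly_cmult: "hom_poly l f \<Longrightarrow> hom_poly l (\<lambda>x. c * f x)"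
proof (induction rule: hom_poly.induct)
  case (hom_poly_coord l f i)
  have "(\<lambda>x. c * (x $ i * f x)) = (\<lambda>x. x $ i * (c * f x))"
    by (simp add: algebra_simps)
  then show ?case using hom_poly.hom_poly_coord[OF hom_poly_coord.IH] by simp
qed (auto simp: distrib_left intro: hom_poly.intros)

lemma hom_poly_sum: "(\<And>i. i \<in> I \<Longrightarrow> hom_poly l (f i)) \<Longrightarrow> hom_poly l (\<lambda>x. \<Sum>i\<in>I. f i x)"
  by (induction I rule: infinite_finite_induct) (auto intro: hom_poly.intros)

lemma linear_component_axis:
  assumes "linear (R :: real^'m \<Rightarrow> real^'n)"
  shows "R x $ j = (\<Sum>i\<in>UNIV. x $ i * R (axis i 1) $ j)"
proof -
  have "((*s) :: real \<Rightarrow> real^'m \<Rightarrow> _) = (*\<^sub>R)" "((*s) :: real \<Rightarrow> real^'n \<Rightarrow> _) = (*\<^sub>R)"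
    by (intro ext, simp add: scalar_mult_eq_scaleR)+
  then show ?thesis using linear_componentwise[of R x j] assms by (simp add: linear_def)
qed

lemma hom_poly_linear_compose:
  assumes R: "linear (R :: real^'n \<Rightarrow> real^'n)"
  shows "hom_poly l f \<Longrightarrow> hom_poly l (\<lambda>x. f (R x))"
proof (induction rule: hom_poly.induct)
  case (hom_poly_coord l f i)
  have "(\<lambda>x. R x $ i * f (R x)) = (\<lambda>x. \<Sum>j\<in>UNIV. R (axis j 1) $ i * (x $ j * f (R x)))"
  proof
    fix x
    show "R x $ i * f (R x) = (\<Sum>j\<in>UNIV. R (axis j 1) $ i * (x $ j * f (R x)))"
      unfolding linear_component_axis[OF R, of x i] by (simp add: sum_distrib_left mult_ac)
  qed
  then show ?case
    using hom_poly_coord.IH by (auto intro!: hom_poly_sum hom_poly_cmult hom_poly.hom_poly_coord)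
qed (auto intro: hom_poly.intros)

lemma homog_poly_imp_hom_poly:
  assumes "homog_poly l p" shows "hom_poly l p"
proof -
  have pow: "hom_poly l f \<Longrightarrow> hom_poly (a + l) (\<lambda>x. x $ i ^ a * f x)" for i a l and f :: "real^'a \<Rightarrow> real"
  proof (induction a)
    case (Suc a)
    then show ?case using hom_poly_coord[of "a + l" "\<lambda>x. x $ i ^ a * f x" i] by (simp add: mult.assoc)
  qed simp
  have mono: "hom_poly (\<Sum>i\<in>I. \<alpha> i) (\<lambda>x. \<Prod>i\<in>I. x $ i ^ \<alpha> i)" if "finite I" for I and \<alpha> :: "'a \<Rightarrow> nat"
    using that by (induction I rule: finite_induct) (auto intro: hom_poly.intros pow)
  obtain c where c: "\<And>x. p x = (\<Sum>\<alpha>\<in>{\<alpha>. (\<Sum>i\<in>UNIV. \<alpha> i) = l}. c \<alpha> * (\<Prod>i\<in>UNIV. (x $ i) ^ \<alpha> i))"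
    using assms unfolding homog_poly_def by blast
  have "hom_poly l (\<lambda>x. \<Sum>\<alpha>\<in>{\<alpha>. (\<Sum>i\<in>UNIV. \<alpha> i) = l}. c \<alpha> * (\<Prod>i\<in>UNIV. (x $ i) ^ \<alpha> i))"
    using mono[of UNIV] by (intro hom_poly_sum hom_poly_cmult) auto
  then show ?thesis unfolding c[symmetric] .
qed

text \<open>A sum over an infinite set is 0 by convention; finiteness is what gives the expansion in
  \<open>homog_poly\<close> its content.\<close>

lemma finite_multi_index: "finite {\<alpha> :: 'n::finite \<Rightarrow> nat. (\<Sum>i\<in>UNIV. \<alpha> i) = l}"
proof (rule finite_subset)
  show "{\<alpha> :: 'n \<Rightarrow> nat. (\<Sum>i\<in>UNIV. \<alpha> i) = l} \<subseteq> (\<Pi>\<^sub>E i\<in>UNIV. {..l})"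
    by (auto intro: member_le_sum)
qed (auto intro: finite_PiE)

text \<open>Returns to explicit coefficients, which the dimension count below uses as linear
  unknowns.\<close>

lemma hom_poly_imp_homog_poly: "hom_poly l p \<Longrightarrow> homog_poly l p"
proof (induction rule: hom_poly.induct)
  case (hom_poly_const c)
  have "{\<alpha> :: 'a \<Rightarrow> nat. (\<Sum>i\<in>UNIV. \<alpha> i) = 0} = {\<lambda>_. 0}" by auto
  then show ?case unfolding homog_poly_def by (intro exI[of _ "\<lambda>_. c"]) simp
next
  case (hom_poly_zero l)
  show ?case unfolding homog_poly_def by (intro exI[of _ "\<lambda>_. 0"]) simp
next
  case (hom_poly_add l f g)
  from hom_poly_add.IH(1) obtain c where "\<forall>x. f x = (\<Sum>\<alpha>\<in>{\<alpha>. (\<Sum>i\<in>UNIV. \<alpha> i) = l}. c \<alpha> * (\<Prod>i\<in>UNIV. (x $ i) ^ \<alpha> i))"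
    unfolding homog_poly_def ..
  moreover from hom_poly_add.IH(2) obtain d where
    "\<forall>x. g x = (\<Sum>\<alpha>\<in>{\<alpha>. (\<Sum>i\<in>UNIV. \<alpha> i) = l}. d \<alpha> * (\<Prod>i\<in>UNIV. (x $ i) ^ \<alpha> i))"
    unfolding homog_poly_def ..
  ultimately show ?case unfolding homog_poly_def
    by (intro exI[of _ "\<lambda>\<alpha>. c \<alpha> + d \<alpha>"]) (simp add: distrib_right sum.distrib)
next
  case (hom_poly_coord l f k)
  from hom_poly_coord.IH obtain c where "\<forall>x. f x = (\<Sum>\<alpha>\<in>{\<alpha>. (\<Sum>i\<in>UNIV. \<alpha> i) = l}. c \<alpha> * (\<Prod>i\<in>UNIV. (x $ i) ^ \<alpha> i))"
    unfolding homog_poly_def ..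
  then have c: "f x = (\<Sum>\<alpha>\<in>{\<alpha>. (\<Sum>i\<in>UNIV. \<alpha> i) = l}. c \<alpha> * (\<Prod>i\<in>UNIV. (x $ i) ^ \<alpha> i))" for x
    by (rule spec)
  define up where "up \<alpha> = \<alpha>(k := Suc (\<alpha> k))" for \<alpha> :: "'a \<Rightarrow> nat"
  \<comment> \<open>Multiplication by \<open>x $ k\<close> shifts exponents by \<open>up\<close>;
    exponents outside the image of \<open>up\<close> are those with \<open>\<beta> k = 0\<close>,
    and they receive coefficient 0.\<close>
  define c' where "c' \<beta> = (if \<beta> k = 0 then 0 else c (\<beta>(k := \<beta> k - 1)))" for \<beta>
  have sum_up: "(\<Sum>i\<in>UNIV. up \<alpha> i) = Suc (\<Sum>i\<in>UNIV. \<alpha> i)" for \<alpha>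
    unfolding up_def by (simp add: sum.remove[of UNIV k])
  have "x $ k * f x = (\<Sum>\<beta>\<in>{\<beta>. (\<Sum>i\<in>UNIV. \<beta> i) = Suc l}. c' \<beta> * (\<Prod>i\<in>UNIV. (x $ i) ^ \<beta> i))" for x
  proof -
    have "x $ k * f x = (\<Sum>\<alpha>\<in>{\<alpha>. (\<Sum>i\<in>UNIV. \<alpha> i) = l}. c' (up \<alpha>) * (\<Prod>i\<in>UNIV. (x $ i) ^ up \<alpha> i))"
      unfolding c sum_distrib_left
    proof (intro sum.cong refl)
      fix \<alpha>
      have "(\<Prod>i\<in>UNIV. (x $ i) ^ up \<alpha> i) = x $ k * (\<Prod>i\<in>UNIV. (x $ i) ^ \<alpha> i)"
        unfolding up_def by (simp add: prod.remove[of UNIV k] mult_ac)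
      moreover have "c' (up \<alpha>) = c \<alpha>" unfolding c'_def up_def by simp
      ultimately show "x $ k * (c \<alpha> * (\<Prod>i\<in>UNIV. x $ i ^ \<alpha> i)) = c' (up \<alpha>) * (\<Prod>i\<in>UNIV. x $ i ^ up \<alpha> i)"
        by simp
    qed
    also have "\<dots> = (\<Sum>\<beta>\<in>up ` {\<alpha>. (\<Sum>i\<in>UNIV. \<alpha> i) = l}. c' \<beta> * (\<Prod>i\<in>UNIV. (x $ i) ^ \<beta> i))"
    proof (subst sum.reindex)
      show "inj_on up {\<alpha>. sum \<alpha> UNIV = l}"
        unfolding up_def inj_on_def fun_eq_iff by (metis fun_upd_apply nat.inject)
    qed simp
    also have "\<dots> = (\<Sum>\<beta>\<in>{\<beta>. (\<Sum>i\<in>UNIV. \<beta> i) = Suc l}. c' \<beta> * (\<Prod>i\<in>UNIV. (x $ i) ^ \<beta> i))"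
    proof (rule sum.mono_neutral_left[OF finite_multi_index])
      show "up ` {\<alpha>. sum \<alpha> UNIV = l} \<subseteq> {\<beta>. sum \<beta> UNIV = Suc l}" using sum_up by auto
      show "\<forall>\<beta>\<in>{\<beta>. sum \<beta> UNIV = Suc l} - up ` {\<alpha>. sum \<alpha> UNIV = l}. c' \<beta> * (\<Prod>i\<in>UNIV. x $ i ^ \<beta> i) = 0"
      proof
        fix \<beta> assume b: "\<beta> \<in> {\<beta>. sum \<beta> UNIV = Suc l} - up ` {\<alpha>. sum \<alpha> UNIV = l}"
        have "\<beta> k = 0"
        proof (rule ccontr)
          assume "\<beta> k \<noteq> 0"
          then have "\<beta> = up (\<beta>(k := \<beta> k - 1))" unfolding up_def by auto
          then show False using b sum_up[of "\<beta>(k := \<beta> k - 1)"] by auto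
        qed
        then show "c' \<beta> * (\<Prod>i\<in>UNIV. x $ i ^ \<beta> i) = 0" unfolding c'_def by simp
      qed
    qed
    finally show ?thesis .
  qed
  then show ?case unfolding homog_poly_def by blast
qed

definition harmonic_poly :: "nat \<Rightarrow> (real^'n \<Rightarrow> real) \<Rightarrow> bool" where
  "harmonic_poly l f \<longleftrightarrow> hom_poly l f \<and> (\<forall>x. (\<Sum>i\<in>UNIV. pd i (pd i f) x) = 0)"

lemma harmonic_homog_poly_imp_harmonic_poly:
  assumes "harmonic_homog_poly l p" shows "harmonic_poly l p"
proof -
  have h: "hom_poly l p" using assms homog_poly_imp_hom_poly unfolding harmonic_homog_poly_def by blast
  note d = hom_poly_imp_poly_deg[OF h]
  have "deriv (\<lambda>r. p (x + r *\<^sub>R axis i 1)) = (\<lambda>s. pd i p (x + s *\<^sub>R axis i 1))" for x i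
    by (intro ext DERIV_imp_deriv) (rule poly_deg_line_derivative[OF d])
  moreover have "deriv (\<lambda>s. pd i p (x + s *\<^sub>R axis i 1)) 0 = pd i (pd i p) x" for x i
    using DERIV_imp_deriv[OF poly_deg_line_derivative[OF poly_deg_pd[OF d], where x = x and s = 0 and i = i]] by simp
  ultimately have "laplacian p x = (\<Sum>i\<in>UNIV. pd i (pd i p) x)" for x
    unfolding laplacian_def by simp
  then show ?thesis
    using h assms unfolding harmonic_poly_def harmonic_homog_poly_def by auto
qed

lemma harmonic_poly_sum:
  assumes "\<And>k. k \<in> I \<Longrightarrow> harmonic_poly l (f k)"
  shows "harmonic_poly l (\<lambda>x. \<Sum>k\<in>I. c k * f k x)"
proof -
  have h: "hom_poly l (f k)" if "k \<in> I" for k using assms[OF that] unfolding harmonic_poly_def by blast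
  note d = hom_poly_imp_poly_deg[OF h]
  have "pd i (\<lambda>x. \<Sum>k\<in>I. c k * f k x) = (\<lambda>x. \<Sum>k\<in>I. c k * pd i (f k) x)" for i
    by (rule ext) (rule pd_sum[OF d])
  then have "pd i (pd i (\<lambda>x. \<Sum>k\<in>I. c k * f k x)) x = (\<Sum>k\<in>I. c k * pd i (pd i (f k)) x)" for i x
    using pd_sum[OF poly_deg_pd[OF d]] by simp
  then have "(\<Sum>i\<in>UNIV. pd i (pd i (\<lambda>x. \<Sum>k\<in>I. c k * f k x)) x) = (\<Sum>k\<in>I. c k * (\<Sum>i\<in>UNIV. pd i (pd i (f k)) x))" for x
    unfolding sum_distrib_left by (simp add: sum.swap[of _ I])
  moreover have "(\<Sum>k\<in>I. c k * (\<Sum>i\<in>UNIV. pd i (pd i (f k)) x)) = 0" for x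
    using assms unfolding harmonic_poly_def by (intro sum.neutral) auto
  ultimately show ?thesis unfolding harmonic_poly_def using h by (auto intro!: hom_poly_sum hom_poly_cmult)
qed

lemma pd_compose_linear:
  assumes R: "linear (R :: real^'n \<Rightarrow> real^'n)" and f: "poly_deg N f"
  shows "pd i (\<lambda>x. f (R x)) x = (\<Sum>j\<in>UNIV. R (axis i 1) $ j * pd j f (R x))"
proof (rule pd_eqI[where g = "\<lambda>i. \<Sum>j\<in>UNIV. R (axis i 1) $ j * pd j f (R x)"])
  have "((\<lambda>x. f (R x)) has_derivative (\<lambda>h. \<Sum>j\<in>UNIV. R h $ j * pd j f (R x))) (at x)"
    using linear_imp_has_derivative[OF R] poly_deg_has_derivative[OF f]
    by (rule has_derivative_compose)
  moreover have "(\<lambda>h. \<Sum>j\<in>UNIV. R h $ j * pd j f (R x)) =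
      (\<lambda>h. \<Sum>i\<in>UNIV. h $ i * (\<Sum>j\<in>UNIV. R (axis i 1) $ j * pd j f (R x)))"
  proof
    fix h
    show "(\<Sum>j\<in>UNIV. R h $ j * pd j f (R x)) =
      (\<Sum>i\<in>UNIV. h $ i * (\<Sum>j\<in>UNIV. R (axis i 1) $ j * pd j f (R x)))"
      unfolding linear_component_axis[OF R, of h] sum_distrib_left sum_distrib_right mult.assoc
      by (rule sum.swap)
  qed
  ultimately show "((\<lambda>x. f (R x)) has_derivative
      (\<lambda>h. \<Sum>i\<in>UNIV. h $ i * (\<Sum>j\<in>UNIV. R (axis i 1) $ j * pd j f (R x)))) (at x)" by (simp only:)
qed

text \<open>Preservation of inner products directly yields orthonormal columns. The rows follow
  because the entries of \<open>R\<close> are the transposed entries of its inverse, which is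
  orthogonal too.\<close>

lemma orthogonal_transformation_rows:
  assumes R: "orthogonal_transformation (R :: real^'n \<Rightarrow> real^'n)"
  shows "(\<Sum>i\<in>UNIV. R (axis i 1) $ j * R (axis i 1) $ k) = (if j = k then 1 else 0)"
proof -
  define R' where "R' = inv R"
  have R': "orthogonal_transformation R'" unfolding R'_def using R by (rule orthogonal_transformation_inv)
  have RR': "R (R' v) = v" for v
    unfolding R'_def using orthogonal_transformation_surj[OF R] by (rule surj_f_inv_f)
  have e: "R (axis i 1) $ j = R' (axis j 1) $ i" for i j
  proof -
    have "R (axis i 1) $ j = R (axis i 1) \<bullet> R (R' (axis j 1))"
      by (simp add: RR' inner_axis)
    also have "\<dots> = axis i 1 \<bullet> R' (axis j 1)"
      using R by (simp add: orthogonal_transformation_def)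
    also have "\<dots> = R' (axis j 1) $ i" by (simp add: inner_axis inner_commute[of "axis i 1"])
    finally show ?thesis .
  qed
  have "(\<Sum>i\<in>UNIV. R (axis i 1) $ j * R (axis i 1) $ k) = R' (axis j 1) \<bullet> R' (axis k 1)"
    unfolding e by (simp add: inner_vec_def)
  also have "\<dots> = axis j 1 \<bullet> axis k (1::real)"
    using R' by (simp add: orthogonal_transformation_def)
  also have "\<dots> = (if j = k then 1 else 0)" by (simp add: inner_axis_axis)
  finally show ?thesis .
qed

text \<open>The Laplacian is the trace of the Hessian; after the chain rule the coefficients of the
  second derivatives are inner products of rows of \<open>R\<close>, and orthonormality reduces them
  to the trace at \<open>R x\<close>.\<close>

lemma harmonic_poly_compose_orthogonal:
  fixes R :: "real^'n \<Rightarrow> real^'n"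
  assumes R: "orthogonal_transformation R" and f: "harmonic_poly l f"
  shows "harmonic_poly l (\<lambda>x. f (R x))"
proof -
  have lin: "linear R" using R by (rule orthogonal_transformation_linear)
  have h: "hom_poly l f" using f unfolding harmonic_poly_def by blast
  note d = hom_poly_imp_poly_deg[OF h]
  have d': "poly_deg l (\<lambda>x. pd j f (R x))" for j
  proof -
    have "poly_deg N g \<Longrightarrow> poly_deg N (\<lambda>x. g (R x))" for N g
    proof (induction rule: poly_deg.induct)
      case (poly_deg_coord N g i)
      have "(\<lambda>x. R x $ i * g (R x)) = (\<lambda>x. \<Sum>j\<in>UNIV. R (axis j 1) $ i * (x $ j * g (R x)))"
      proof
        fix x
        show "R x $ i * g (R x) = (\<Sum>j\<in>UNIV. R (axis j 1) $ i * (x $ j * g (R x)))"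
          unfolding linear_component_axis[OF lin, of x i] by (simp add: sum_distrib_left mult_ac)
      qed
      then show ?case
        using poly_deg_coord.IH by (auto intro!: poly_deg_sum poly_deg_cmult poly_deg.poly_deg_coord)
    qed (auto intro: poly_deg.intros)
    then show ?thesis using poly_deg_pd[OF d] by blast
  qed
  have pd1: "pd i (\<lambda>x. f (R x)) = (\<lambda>x. \<Sum>j\<in>UNIV. R (axis i 1) $ j * pd j f (R x))" for i
    by (rule ext) (rule pd_compose_linear[OF lin d])
  have pd2: "pd i (pd i (\<lambda>x. f (R x))) x =
     (\<Sum>j\<in>UNIV. \<Sum>k\<in>UNIV. (R (axis i 1) $ j * R (axis i 1) $ k) * pd k (pd j f) (R x))" for i x
    unfolding pd1 pd_sum[OF d'] pd_compose_linear[OF lin poly_deg_pd[OF d]]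
    by (simp add: sum_distrib_left mult.assoc)
  have "(\<Sum>i\<in>UNIV. pd i (pd i (\<lambda>x. f (R x))) x) =
      (\<Sum>j\<in>UNIV. \<Sum>k\<in>UNIV. (\<Sum>i\<in>UNIV. R (axis i 1) $ j * R (axis i 1) $ k) * pd k (pd j f) (R x))" for x
  proof -
    have "(\<Sum>i\<in>UNIV. pd i (pd i (\<lambda>x. f (R x))) x) =
      (\<Sum>j\<in>UNIV. \<Sum>i\<in>UNIV. \<Sum>k\<in>UNIV. (R (axis i 1) $ j * R (axis i 1) $ k) * pd k (pd j f) (R x))"
      unfolding pd2 by (rule sum.swap)
    also have "\<dots> = (\<Sum>j\<in>UNIV. \<Sum>k\<in>UNIV. \<Sum>i\<in>UNIV. (R (axis i 1) $ j * R (axis i 1) $ k) * pd k (pd j f) (R x))"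
      by (intro sum.cong refl sum.swap)
    finally show ?thesis by (simp add: sum_distrib_right)
  qed
  then have "(\<Sum>i\<in>UNIV. pd i (pd i (\<lambda>x. f (R x))) x) = (\<Sum>j\<in>UNIV. pd j (pd j f) (R x))" for x
    unfolding orthogonal_transformation_rows[OF R]
    by (simp add: if_distrib[where f = "\<lambda>c. c * _"] cong: if_cong)
  then show ?thesis
    using f hom_poly_linear_compose[OF lin h] unfolding harmonic_poly_def by simp
qed

section \<open>Dimension bound for harmonics from Cauchy data on a hyperplane\<close>

lemma poly_deg_line_poly:
  fixes x :: "real^'n"
  assumes "poly_deg N f"
  shows "\<exists>q. \<forall>r. f (x + r *\<^sub>R axis n 1) = poly q r"
  using assms
proof (induction rule: poly_deg.induct)
  case (poly_deg_const N c)
  show ?case by (rule exI[of _ "[:c:]"]) simp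
next
  case (poly_deg_coord N f i)
  then obtain q where "\<forall>r. f (x + r *\<^sub>R axis n 1) = poly q r" by blast
  then show ?case by (intro exI[of _ "[:x $ i, axis n 1 $ i:] * q"]) (simp add: distrib_right mult.assoc)
next
  case (poly_deg_add N f g)
  then obtain q1 q2 where "\<forall>r. f (x + r *\<^sub>R axis n 1) = poly q1 r" "\<forall>r. g (x + r *\<^sub>R axis n 1) = poly q2 r"
    by blast
  then show ?case by (intro exI[of _ "q1 + q2"]) simp
qed

lemma poly_eq_0_if_higher_pderiv_0:
  fixes q :: "real poly"
  assumes "\<And>j. poly ((pderiv ^^ j) q) 0 = 0"
  shows "q = 0"
  using assms
proof (induction "degree q" arbitrary: q rule: less_induct)
  case less
  show ?case
  proof (cases "degree q = 0")
    case True
    then obtain c where "q = [:c:]" by (rule degree_eq_zeroE)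
    with less.prems[of 0] show ?thesis by simp
  next
    case False
    have "pderiv q = 0"
    proof (rule less.hyps)
      show "degree (pderiv q) < degree q" using False by (simp add: degree_pderiv)
      show "poly ((pderiv ^^ j) (pderiv q)) 0 = 0" for j
        using less.prems[of "Suc j"] by (simp add: funpow_swap1)
    qed
    with False show ?thesis by (simp add: pderiv_eq_0_iff)
  qed
qed

text \<open>Lines in a direction \<open>i\<close> other than \<open>n\<close> stay inside the
  hyperplane, so \<open>g\<close> is constantly 0 along them.\<close>

lemma pd_zero_on_hyperplane:
  assumes g: "poly_deg N g" "\<And>x. x $ n = 0 \<Longrightarrow> g x = 0" and i: "i \<noteq> n" and x: "x $ n = 0"
  shows "pd i g x = 0"
proof -
  have "g (x + r *\<^sub>R axis i 1) = 0" for r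
    by (rule g(2)) (use i x in \<open>simp add: axis_def\<close>)
  then have "((\<lambda>r. 0) has_real_derivative pd i g x) (at 0)"
    using poly_deg_line_derivative[OF g(1), of x i 0] by simp
  then show ?thesis by (rule DERIV_unique) simp
qed

text \<open>On the hyperplane all normal derivatives of \<open>f\<close> vanish, because the Laplace equation expresses
  the second normal derivative through tangential ones.\<close>
lemma harmonic_cauchy_uniqueness:
  fixes f :: "real^'n \<Rightarrow> real"
  assumes f: "poly_deg N f" and harm: "\<And>x. (\<Sum>i\<in>UNIV. pd i (pd i f) x) = 0"
    and zero: "\<And>x. x $ n = 0 \<Longrightarrow> f x = 0" "\<And>x. x $ n = 0 \<Longrightarrow> pd n f x = 0"
  shows "f x = 0"
proof -
  define G where "G j = (pd n ^^ j) f" for j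
  have G_Suc: "G (Suc j) = pd n (G j)" for j unfolding G_def by simp
  have dG: "poly_deg N (G j)" for j
    by (induction j) (use f poly_deg_pd in \<open>auto simp: G_def\<close>)
  have hG: "(\<Sum>i\<in>UNIV. pd i (pd i (G j)) x) = 0" for j x
  proof (induction j arbitrary: x)
    case 0
    then show ?case using harm by (simp add: G_def)
  next
    case (Suc j)
    have c: "pd i (pd n (G j)) = pd n (pd i (G j))" for i
      by (rule ext) (rule pd_commute[OF dG])
    have "pd i (pd i (G (Suc j))) x = pd n (pd i (pd i (G j))) x" for i
      unfolding G_Suc c by (rule pd_commute[OF poly_deg_pd[OF dG]])
    then have "(\<Sum>i\<in>UNIV. pd i (pd i (G (Suc j))) x) = (\<Sum>i\<in>UNIV. 1 * pd n (pd i (pd i (G j))) x)" by simp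
    also have "\<dots> = pd n (\<lambda>x. \<Sum>i\<in>UNIV. 1 * pd i (pd i (G j)) x) x"
      by (rule pd_sum[symmetric]) (rule poly_deg_pd[OF poly_deg_pd[OF dG]])
    also have "\<dots> = pd n (\<lambda>x. 0) x" using Suc by simp
    finally show ?case by (simp add: pd_const)
  qed
  have zG: "x $ n = 0 \<Longrightarrow> G j x = 0 \<and> G (Suc j) x = 0" for j x
  proof (induction j arbitrary: x)
    case 0
    then show ?case using zero by (simp add: G_def)
  next
    case (Suc j)
    have "0 = pd n (pd n (G j)) x + (\<Sum>i\<in>UNIV - {n}. pd i (pd i (G j)) x)"
      using hG[of j x] by (simp add: sum.remove[of UNIV n])
    also have "(\<Sum>i\<in>UNIV - {n}. pd i (pd i (G j)) x) = 0"
    proof (rule sum.neutral, rule ballI)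
      fix i assume i: "i \<in> UNIV - {n}"
      show "pd i (pd i (G j)) x = 0"
      proof (rule pd_zero_on_hyperplane[OF poly_deg_pd[OF dG]])
        show "pd i (G j) y = 0" if "y $ n = 0" for y
          by (rule pd_zero_on_hyperplane[OF dG]) (use Suc.IH i that in auto)
      qed (use i Suc.prems in auto)
    qed
    finally show ?case using Suc by (simp add: G_Suc)
  qed
  \<comment> \<open>\<open>y\<close> is the foot of the perpendicular from \<open>x\<close>. Along
    the normal line through \<open>y\<close> the function is a one-variable polynomial whose
    derivatives at 0 are the values \<open>G j y\<close>.\<close>
  define y where "y = x - (x $ n) *\<^sub>R axis n 1"
  have y: "y $ n = 0" unfolding y_def by simp
  obtain q where q: "\<And>r. f (y + r *\<^sub>R axis n 1) = poly q r"
    using poly_deg_line_poly[OF f, of y n] by blast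
  have "G j (y + r *\<^sub>R axis n 1) = poly ((pderiv ^^ j) q) r" for j r
  proof (induction j arbitrary: r)
    case 0
    show ?case using q by (simp add: G_def)
  next
    case (Suc j)
    have "((\<lambda>r. G j (y + r *\<^sub>R axis n 1)) has_real_derivative G (Suc j) (y + r *\<^sub>R axis n 1)) (at r)"
      unfolding G_Suc by (rule poly_deg_line_derivative[OF dG])
    then have "(poly ((pderiv ^^ j) q) has_real_derivative G (Suc j) (y + r *\<^sub>R axis n 1)) (at r)"
      unfolding Suc .
    from DERIV_unique[OF this poly_DERIV] show ?case by simp
  qed
  from this[of _ 0] have "poly ((pderiv ^^ j) q) 0 = 0" for j
    using zG[OF y, of j] by simp
  then have "q = 0" by (rule poly_eq_0_if_higher_pderiv_0)
  then show ?thesis using q[of "x $ n"] unfolding y_def by simp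
qed

text \<open>Gaussian elimination by induction on the equations: a pivot \<open>k\<close> in row
  \<open>i0\<close> removes one equation and one unknown, preserving the strict inequality of the
  cardinalities.\<close>

lemma homogeneous_system_nontrivial_solution:
  fixes A :: "'a \<Rightarrow> 'b \<Rightarrow> real"
  assumes "finite I" "finite J" "card I < card J"
  shows "\<exists>c. (\<exists>j\<in>J. c j \<noteq> 0) \<and> (\<forall>i\<in>I. (\<Sum>j\<in>J. c j * A i j) = 0)"
  using assms
proof (induction I arbitrary: A J rule: finite_induct)
  case empty
  then obtain j where "j \<in> J" by fastforce
  then show ?case by (intro exI[of _ "\<lambda>_. 1"]) auto
next
  case (insert i0 I)
  show ?case
  proof (cases "\<forall>j\<in>J. A i0 j = 0")
    case True
    have "card I < card J" using insert by simp
    from insert.IH[OF insert.prems(1) this, of A] True show ?thesis by auto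
  next
    case False
    then obtain k where k: "k \<in> J" "A i0 k \<noteq> 0" by blast
    define J' where "J' = J - {k}"
    \<comment> \<open>The rows after elimination of the pivot unknown; \<open>d\<close> below
      recovers the value of that unknown by solving row \<open>i0\<close>.\<close>
    define B where "B i j = A i j - A i k * A i0 j / A i0 k" for i j
    have "card I < card J'" using insert k unfolding J'_def by simp
    from insert.IH[OF _ this, of B] insert.prems(1) obtain c where
      c: "\<exists>j\<in>J'. c j \<noteq> 0" "\<And>i. i \<in> I \<Longrightarrow> (\<Sum>j\<in>J'. c j * B i j) = 0"
      unfolding J'_def by blast
    define S where "S = (\<Sum>j\<in>J'. c j * A i0 j)"
    define d where "d j = (if j = k then - S / A i0 k else c j)" for j
    have sum: "(\<Sum>j\<in>J. d j * A i j) = - S / A i0 k * A i k + (\<Sum>j\<in>J'. c j * A i j)" for i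
    proof -
      have "(\<Sum>j\<in>J. d j * A i j) = d k * A i k + (\<Sum>j\<in>J'. d j * A i j)"
        unfolding J'_def using insert.prems(1) k(1) by (rule sum.remove)
      also have "(\<Sum>j\<in>J'. d j * A i j) = (\<Sum>j\<in>J'. c j * A i j)"
        by (intro sum.cong) (auto simp: d_def J'_def)
      finally show ?thesis by (simp add: d_def)
    qed
    have "(\<Sum>j\<in>J. d j * A i j) = 0" if i: "i \<in> insert i0 I" for i
    proof (cases "i = i0")
      case True
      then show ?thesis using k unfolding sum S_def by simp
    next
      case False
      then have "0 = (\<Sum>j\<in>J'. c j * B i j)" using c(2) i by auto
      also have "\<dots> = (\<Sum>j\<in>J'. c j * A i j) - A i k / A i0 k * S"
        unfolding B_def S_def by (simp add: right_diff_distrib sum_subtractf sum_distrib_left mult_ac)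
      finally show ?thesis unfolding sum by simp
    qed
    moreover have "\<exists>j\<in>J. d j \<noteq> 0" using c(1) unfolding d_def J'_def by auto
    ultimately show ?thesis by blast
  qed
qed

text \<open>The exponent at \<open>m\<close> is determined by the total degree, the exponent at
  \<open>n\<close> takes two values, and each of the remaining \<open>CARD('n) - 2\<close> exponents
  takes at most \<open>l + 1\<close> values.\<close>

lemma card_multi_index_le:
  fixes m n :: "'n::finite"
  assumes mn: "m \<noteq> n"
  shows "card {\<alpha> :: 'n \<Rightarrow> nat. (\<Sum>i\<in>UNIV. \<alpha> i) = l \<and> \<alpha> n \<le> 1} \<le> 2 * (l + 1) ^ (CARD('n) - 2)"
proof -
  define I where "I = {\<alpha> :: 'n \<Rightarrow> nat. (\<Sum>i\<in>UNIV. \<alpha> i) = l \<and> \<alpha> n \<le> 1}"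
  define P where "P = (\<Pi>\<^sub>E i\<in>UNIV - {m}. if i = n then {..1::nat} else {..l})"
  have finP: "finite P" unfolding P_def by (intro finite_PiE) auto
  have "inj_on (\<lambda>\<alpha>. restrict \<alpha> (UNIV - {m})) I"
  proof (rule inj_onI)
    fix \<alpha> \<beta> assume a: "\<alpha> \<in> I" "\<beta> \<in> I" and eq: "restrict \<alpha> (UNIV - {m}) = restrict \<beta> (UNIV - {m})"
    have ne: "\<alpha> i = \<beta> i" if "i \<noteq> m" for i
      using fun_cong[OF eq, of i] that by simp
    have "\<alpha> m + (\<Sum>i\<in>UNIV - {m}. \<alpha> i) = \<beta> m + (\<Sum>i\<in>UNIV - {m}. \<beta> i)"
      using a unfolding I_def by (simp add: sum.remove[of UNIV m])
    moreover have "(\<Sum>i\<in>UNIV - {m}. \<alpha> i) = (\<Sum>i\<in>UNIV - {m}. \<beta> i)"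
      by (intro sum.cong) (auto simp: ne)
    ultimately have "\<alpha> m = \<beta> m" by simp
    with ne have "\<alpha> i = \<beta> i" for i by (cases "i = m") auto
    then show "\<alpha> = \<beta>" by (rule ext)
  qed
  moreover have "(\<lambda>\<alpha>. restrict \<alpha> (UNIV - {m})) ` I \<subseteq> P"
  proof safe
    fix \<alpha> assume "\<alpha> \<in> I"
    then have "\<alpha> i \<le> l" "\<alpha> n \<le> 1" for i
      using member_le_sum[of i UNIV \<alpha>] unfolding I_def by auto
    then show "restrict \<alpha> (UNIV - {m}) \<in> P"
      unfolding P_def by (auto simp: PiE_iff)
  qed
  ultimately have "card I \<le> card P" by (rule card_inj_on_le) (rule finP)
  also have "card P = (\<Prod>i\<in>UNIV - {m}. if i = n then 2 else l + 1)"
    unfolding P_def by (subst card_PiE, simp, rule prod.cong) auto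
  also have "\<dots> = 2 * (\<Prod>i\<in>UNIV - {m} - {n}. l + 1)"
    by (subst prod.remove[of _ n]) (use mn in \<open>auto intro!: prod.cong\<close>)
  also have "\<dots> = 2 * (l + 1) ^ (CARD('n) - 2)"
    using mn by (simp add: card_Diff_singleton_if numeral_2_eq_2)
  finally show ?thesis unfolding I_def .
qed

text \<open>The monomials with \<open>\<alpha> n \<le> 1\<close> carry the value and the normal
  derivative on the hyperplane \<open>x $ n = 0\<close>. More polynomials than such monomials admit
  a nontrivial combination with vanishing Cauchy data, which is then 0 by uniqueness. The exponent
  \<open>CARD('n) - 2\<close> of the final theorem originates here.\<close>

lemma harmonic_poly_dependent:
  fixes f :: "'b \<Rightarrow> real^'n \<Rightarrow> real"
  assumes card: "CARD('n) \<ge> 2" and J: "finite J" "2 * (l + 1) ^ (CARD('n) - 2) < card J"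
    and f: "\<And>j. j \<in> J \<Longrightarrow> harmonic_poly l (f j)"
  shows "\<exists>c. (\<exists>j\<in>J. c j \<noteq> 0) \<and> (\<forall>x. (\<Sum>j\<in>J. c j * f j x) = 0)"
proof -
  obtain m n :: 'n where mn: "m \<noteq> n"
  proof -
    fix n :: 'n
    have "UNIV \<noteq> {n}"
    proof
      assume *: "UNIV = {n}"
      have "CARD('n) = 1" unfolding * by simp
      with card show False by simp
    qed
    then show thesis using that by blast
  qed
  define S where "S = {\<alpha> :: 'n \<Rightarrow> nat. (\<Sum>i\<in>UNIV. \<alpha> i) = l}"
  define I where "I = {\<alpha> \<in> S. \<alpha> n \<le> 1}"
  have finS: "finite S" unfolding S_def by (rule finite_multi_index)
  have "card I \<le> 2 * (l + 1) ^ (CARD('n) - 2)"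
    using card_multi_index_le[OF mn, of l] unfolding I_def S_def by simp
  then have cI: "card I < card J" using J by simp
  have "\<forall>j\<in>J. \<exists>a. \<forall>x. f j x = (\<Sum>\<alpha>\<in>S. a \<alpha> * (\<Prod>i\<in>UNIV. (x $ i) ^ \<alpha> i))"
    using f hom_poly_imp_homog_poly unfolding harmonic_poly_def homog_poly_def S_def by blast
  then obtain a where a: "\<And>j x. j \<in> J \<Longrightarrow> f j x = (\<Sum>\<alpha>\<in>S. a j \<alpha> * (\<Prod>i\<in>UNIV. (x $ i) ^ \<alpha> i))"
    unfolding bchoice_iff by blast
  obtain c where c: "\<exists>j\<in>J. c j \<noteq> 0" "\<And>\<alpha>. \<alpha> \<in> I \<Longrightarrow> (\<Sum>j\<in>J. c j * a j \<alpha>) = 0"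
    using homogeneous_system_nontrivial_solution[OF _ J(1) cI, of "\<lambda>\<alpha> j. a j \<alpha>"] finS
    unfolding I_def by auto
  define g where "g x = (\<Sum>j\<in>J. c j * f j x)" for x
  define b where "b \<alpha> = (\<Sum>j\<in>J. c j * a j \<alpha>)" for \<alpha>
  have g: "g x = (\<Sum>\<alpha>\<in>S. b \<alpha> * (\<Prod>i\<in>UNIV. (x $ i) ^ \<alpha> i))" for x
  proof -
    have "g x = (\<Sum>j\<in>J. \<Sum>\<alpha>\<in>S. c j * a j \<alpha> * (\<Prod>i\<in>UNIV. (x $ i) ^ \<alpha> i))"
      unfolding g_def by (intro sum.cong) (auto simp: a sum_distrib_left mult.assoc)
    also have "\<dots> = (\<Sum>\<alpha>\<in>S. b \<alpha> * (\<Prod>i\<in>UNIV. (x $ i) ^ \<alpha> i))"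
      unfolding b_def sum_distrib_right by (rule sum.swap)
    finally show ?thesis .
  qed
  have harm: "harmonic_poly l g" unfolding g_def[abs_def] by (rule harmonic_poly_sum[OF f])
  then have dg: "poly_deg l g" unfolding harmonic_poly_def using hom_poly_imp_poly_deg by blast
  have "g x = 0" for x
  proof (rule harmonic_cauchy_uniqueness[OF dg, of n])
    show "(\<Sum>i\<in>UNIV. pd i (pd i g) x) = 0" for x using harm unfolding harmonic_poly_def by blast
    \<comment> \<open>Expansion in powers of the normal coordinate \<open>r\<close>: its value at
      \<open>r = 0\<close> sees only \<open>\<alpha> n = 0\<close>, its derivative there only
      \<open>\<alpha> n = 1\<close>, and \<open>b\<close> vanishes for both.\<close>
    have line: "g (x + r *\<^sub>R axis n 1) = (\<Sum>\<alpha>\<in>S. b \<alpha> * (r ^ \<alpha> n * (\<Prod>i\<in>UNIV - {n}. (x $ i) ^ \<alpha> i)))"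
      if x: "x $ n = 0" for x r
      unfolding g
    proof (intro sum.cong refl arg_cong2[where f = "(*)"])
      fix \<alpha> :: "'n \<Rightarrow> nat"
      have "(\<Prod>i\<in>UNIV. ((x + r *\<^sub>R axis n 1) $ i) ^ \<alpha> i) =
         ((x + r *\<^sub>R axis n 1) $ n) ^ \<alpha> n * (\<Prod>i\<in>UNIV - {n}. ((x + r *\<^sub>R axis n 1) $ i) ^ \<alpha> i)"
        by (rule prod.remove) auto
      also have "(\<Prod>i\<in>UNIV - {n}. ((x + r *\<^sub>R axis n 1) $ i) ^ \<alpha> i) = (\<Prod>i\<in>UNIV - {n}. (x $ i) ^ \<alpha> i)"
        by (intro prod.cong) (auto simp: axis_def)
      finally show "(\<Prod>i\<in>UNIV. ((x + r *\<^sub>R axis n 1) $ i) ^ \<alpha> i) = r ^ \<alpha> n * (\<Prod>i\<in>UNIV - {n}. (x $ i) ^ \<alpha> i)"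
        using x by simp
    qed
    show "g x = 0" if x: "x $ n = 0" for x
    proof -
      have "g x = (\<Sum>\<alpha>\<in>S. b \<alpha> * (0 ^ \<alpha> n * (\<Prod>i\<in>UNIV - {n}. (x $ i) ^ \<alpha> i)))"
        using line[OF x, of 0] by simp
      also have "\<dots> = 0"
      proof (rule sum.neutral, rule ballI)
        fix \<alpha> assume "\<alpha> \<in> S"
        then show "b \<alpha> * (0 ^ \<alpha> n * (\<Prod>i\<in>UNIV - {n}. (x $ i) ^ \<alpha> i)) = 0"
          using c(2)[of \<alpha>] unfolding I_def b_def by (cases "\<alpha> n \<le> 1") auto
      qed
      finally show ?thesis .
    qed
    show "pd n g x = 0" if x: "x $ n = 0" for x
    proof -
      have "((\<lambda>r. g (x + r *\<^sub>R axis n 1)) has_real_derivative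
        (\<Sum>\<alpha>\<in>S. b \<alpha> * (real (\<alpha> n) * 0 ^ (\<alpha> n - 1) * (\<Prod>i\<in>UNIV - {n}. (x $ i) ^ \<alpha> i)))) (at 0)"
        unfolding line[OF x] by (auto intro!: derivative_eq_intros sum.cong)
      also have "(\<Sum>\<alpha>\<in>S. b \<alpha> * (real (\<alpha> n) * 0 ^ (\<alpha> n - 1) * (\<Prod>i\<in>UNIV - {n}. (x $ i) ^ \<alpha> i))) = 0"
      proof (rule sum.neutral, rule ballI)
        fix \<alpha> assume "\<alpha> \<in> S"
        then show "b \<alpha> * (real (\<alpha> n) * 0 ^ (\<alpha> n - 1) * (\<Prod>i\<in>UNIV - {n}. (x $ i) ^ \<alpha> i)) = 0"
          using c(2)[of \<alpha>] unfolding I_def b_def by (cases "\<alpha> n \<le> 1") auto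
      qed
      finally have "((\<lambda>r. g (x + r *\<^sub>R axis n 1)) has_real_derivative 0) (at 0)" .
      from DERIV_unique[OF poly_deg_line_derivative[OF dg, of x n 0] this] show ?thesis by simp
    qed
  qed
  then show ?thesis using c(1) unfolding g_def by blast
qed

section \<open>Integration over the sphere\<close>

text \<open>Uniqueness of Haar measure, specialised: integrate \<open>1\<^sub>B(Rx) 1\<^sub>A(Rx + y)\<close>, with \<open>B\<close> the unit ball,
  over \<open>x\<close> and \<open>y\<close> in both orders.\<close>
lemma lborel_distr_orthogonal:
  fixes R :: "'a::euclidean_space \<Rightarrow> 'a"
  assumes R: "orthogonal_transformation R"
  shows "distr lborel borel R = lborel"
proof (rule measure_eqI)
  show "sets (distr lborel borel R) = sets lborel" by simp
  have lin: "linear R" using R by (rule orthogonal_transformation_linear)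
  have R_meas[measurable]: "R \<in> borel_measurable borel"
    using lin by (intro borel_measurable_continuous_onI linear_continuous_on) (simp add: linear_conv_bounded_linear)
  have trans: "(\<integral>\<^sup>+y. h (c + y) \<partial>lborel) = (\<integral>\<^sup>+y. h y \<partial>lborel)"
    if [measurable]: "h \<in> borel_measurable borel" for h :: "'a \<Rightarrow> ennreal" and c
    by (subst (2) lborel_distr_plus[of c, symmetric]) (simp add: nn_integral_distr)
  define f :: "'a \<Rightarrow> ennreal" where "f = indicator (cball 0 1)"
  have [measurable]: "f \<in> borel_measurable borel" unfolding f_def
    by (intro borel_measurable_indicator borel_closed) simp
  have f_diff: "f (x - y) = f (y - x)" for x y unfolding f_def by (simp add: indicator_def norm_minus_commute)
  have fR: "f (R x) = f x" for x
    unfolding f_def using orthogonal_transformation_norm[OF R] by (simp add: indicator_def)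
  define b where "b = (\<integral>\<^sup>+x. f x \<partial>lborel)"
  have b: "b = emeasure lborel (cball (0::'a) 1)" unfolding b_def f_def by simp
  \<comment> \<open>The volume of the unit ball is positive and finite, so it can be cancelled at
    the end.\<close>
  have b0: "b \<noteq> 0" "b \<noteq> \<top>"
    unfolding b using emeasure_bounded_finite[of "cball (0::'a) 1"] content_cball_pos[of 1 "0::'a"]
    by (auto simp: measure_def)
  fix A assume "A \<in> sets (distr lborel borel R)"
  then have A[measurable]: "A \<in> sets borel" by simp
  define g :: "'a \<Rightarrow> ennreal" where "g = indicator A"
  have [measurable]: "g \<in> borel_measurable borel" unfolding g_def by measurable
  have gA: "(\<integral>\<^sup>+y. g y \<partial>lborel) = emeasure lborel A" unfolding g_def by simp
  have gR: "(\<integral>\<^sup>+x. g (R x) \<partial>lborel) = emeasure (distr lborel borel R) A"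
    using nn_integral_distr[of R lborel borel g] by (simp add: g_def)
  have "b * emeasure lborel A = (\<integral>\<^sup>+x. f (R x) * emeasure lborel A \<partial>lborel)"
    by (simp add: nn_integral_multc fR b_def)
  also have "\<dots> = (\<integral>\<^sup>+x. \<integral>\<^sup>+y. f (R x) * g (R x + y) \<partial>lborel \<partial>lborel)"
    by (subst nn_integral_cmult) (simp_all add: trans gA)
  also have "\<dots> = (\<integral>\<^sup>+y. \<integral>\<^sup>+x. f (R x) * g (R x + y) \<partial>lborel \<partial>lborel)"
    by (rule lborel_pair.Fubini'[symmetric]) measurable
  also have "\<dots> = (\<integral>\<^sup>+y. \<integral>\<^sup>+x. f (R x - y) * g (R x) \<partial>lborel \<partial>lborel)"
  proof (rule nn_integral_cong)
    fix y
    \<comment> \<open>Translating \<open>x\<close> by a preimage \<open>z\<close> of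
      \<open>y\<close> moves the shift from \<open>g\<close> to \<open>f\<close>; linearity of
      \<open>R\<close> and translation invariance of Lebesgue measure are all that enters.\<close>
    obtain z where z: "R z = y" using orthogonal_transformation_surj[OF R] by (metis surjD)
    have "(\<integral>\<^sup>+x. f (R x - y) * g (R x) \<partial>lborel) = (\<integral>\<^sup>+x. f (R (z + x) - y) * g (R (z + x)) \<partial>lborel)"
      by (rule trans[symmetric]) measurable
    also have "\<dots> = (\<integral>\<^sup>+x. f (R x) * g (R x + y) \<partial>lborel)"
      using lin by (simp add: linear_add z add.commute)
    finally show "(\<integral>\<^sup>+x. f (R x) * g (R x + y) \<partial>lborel) = (\<integral>\<^sup>+x. f (R x - y) * g (R x) \<partial>lborel)" ..
  qed
  also have "\<dots> = (\<integral>\<^sup>+x. \<integral>\<^sup>+y. f (R x - y) * g (R x) \<partial>lborel \<partial>lborel)"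
    by (rule lborel_pair.Fubini') measurable
  also have "\<dots> = (\<integral>\<^sup>+x. b * g (R x) \<partial>lborel)"
  proof (rule nn_integral_cong)
    fix x
    have "(\<integral>\<^sup>+y. f (R x - y) \<partial>lborel) = (\<integral>\<^sup>+y. f (- R x + y) \<partial>lborel)" by (simp add: f_diff[of "R x"])
    also have "\<dots> = b" unfolding b_def by (rule trans) simp
    finally show "(\<integral>\<^sup>+y. f (R x - y) * g (R x) \<partial>lborel) = b * g (R x)"
      by (subst nn_integral_multc) auto
  qed
  also have "\<dots> = b * emeasure (distr lborel borel R) A"
    by (subst nn_integral_cmult) (auto simp: gR)
  finally show "emeasure (distr lborel borel R) A = emeasure lborel A"
    using b0 by (simp add: ennreal_mult_cancel_left)
qed

lemma borel_measurable_radial: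
  fixes h :: "real^'n \<Rightarrow> real"
  assumes "continuous_on UNIV h"
  shows "(\<lambda>x. h (x /\<^sub>R norm x)) \<in> borel_measurable borel"
  by (rule measurable_compose[where N = borel]) (use assms in \<open>auto intro!: borel_measurable_continuous_onI\<close>)

lemma sphere_integrable_continuous:
  fixes h :: "real^'n \<Rightarrow> real"
  assumes h: "continuous_on UNIV h"
  shows "sphere_integrable h"
proof -
  \<comment> \<open>The closed ball rather than the sphere, because
    \<open>x /\<^sub>R norm x\<close> is 0 at the origin.\<close>
  have "compact (h ` cball 0 1)"
    by (intro compact_continuous_image continuous_on_subset[OF h]) auto
  then obtain B where "\<forall>y\<in>h ` cball 0 1. norm y \<le> B"
    using compact_imp_bounded[of "h ` cball 0 1"] unfolding bounded_iff by blast
  then have B: "norm (h x) \<le> B" if "norm x \<le> 1" for x using that by auto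
  have n: "norm (x /\<^sub>R norm x) \<le> 1" for x :: "real^'n" by (cases "x = 0") auto
  show ?thesis
    unfolding sphere_integrable_def set_integrable_def
  proof (rule integrableI_bounded_set_indicator)
    show "emeasure lborel (cball (0::real^'n) 1) < \<infinity>"
      by (rule emeasure_bounded_finite) simp
    show "AE x in lborel. x \<in> cball 0 1 \<longrightarrow> norm (h (x /\<^sub>R norm x)) \<le> B" using B[OF n] by simp
  qed (use borel_measurable_radial[OF h] in auto)
qed

lemma sphere_integral_sum:
  assumes "\<And>i. i \<in> I \<Longrightarrow> sphere_integrable (f i)"
  shows "sphere_integral (\<lambda>x. \<Sum>i\<in>I. c i * f i x) = (\<Sum>i\<in>I. c i * sphere_integral (f i))"
proof -
  have "(LINT x : cball 0 1 | lborel. (\<Sum>i\<in>I. c i * f i (x /\<^sub>R norm x))) =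
      (LINT x | lborel. (\<Sum>i\<in>I. c i * (indicator (cball 0 1) x *\<^sub>R f i (x /\<^sub>R norm x))))"
    unfolding set_lebesgue_integral_def by (simp add: sum_distrib_left mult_ac)
  also have "\<dots> = (\<Sum>i\<in>I. LINT x | lborel. c i * (indicator (cball 0 1) x *\<^sub>R f i (x /\<^sub>R norm x)))"
    using assms unfolding sphere_integrable_def set_integrable_def
    by (intro Bochner_Integration.integral_sum integrable_mult_right) auto
  finally show ?thesis
    unfolding sphere_integral_def set_lebesgue_integral_def
    by (simp add: sum_distrib_left mult_ac)
qed

lemma sphere_integral_cong:
  fixes f g :: "real^'n \<Rightarrow> real"
  assumes "\<And>x. norm x = 1 \<Longrightarrow> f x = g x" "sphere_integrable f" "sphere_integrable g"
  shows "sphere_integral f = sphere_integral g"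
proof -
  have "(LINT x : cball 0 1 | lborel. f (x /\<^sub>R norm x)) = (LINT x : cball 0 1 | lborel. g (x /\<^sub>R norm x))"
    unfolding set_lebesgue_integral_def
  proof (rule integral_cong_AE)
    \<comment> \<open>The origin is normalised to 0, which is off the sphere; it is a null
      set.\<close>
    have "AE x in lborel. x \<noteq> (0::real^'n)" by (rule AE_lborel_singleton)
    then show "AE x in lborel. indicator (cball 0 1) x *\<^sub>R f (x /\<^sub>R norm x) = indicator (cball 0 1) x *\<^sub>R g (x /\<^sub>R norm x)"
      by eventually_elim (use assms(1) in simp)
  qed (use assms in \<open>auto simp: sphere_integrable_def set_integrable_def\<close>)
  then show ?thesis unfolding sphere_integral_def by simp
qed

lemma sphere_integral_nonneg:
  assumes "\<And>x. 0 \<le> f x" shows "0 \<le> sphere_integral f"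
  unfolding sphere_integral_def set_lebesgue_integral_def using assms
  by (intro mult_nonneg_nonneg Bochner_Integration.integral_nonneg) auto

text \<open>If \<open>h u > 0\<close>, the directions where \<open>h\<close> is positive sweep out
  an open subset of the ball containing \<open>u / 2\<close>, and a nonempty open set is not
  negligible.\<close>

lemma sphere_integral_eq_0_imp:
  fixes h :: "real^'n \<Rightarrow> real"
  assumes h: "continuous_on UNIV h" "\<And>x. 0 \<le> h x" and int: "sphere_integral h = 0" and u: "norm u = 1"
  shows "h u = 0"
proof (rule ccontr)
  assume "h u \<noteq> 0"
  then have hu: "h u > 0" using h(2)[of u] by simp
  define U :: "(real^'n) set" where "U = (- {0}) \<inter> (\<lambda>x. h (x /\<^sub>R norm x)) -` {0<..}"
  have "continuous_on (- {0}) (\<lambda>x. h (x /\<^sub>R norm x))"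
    by (rule continuous_on_compose2[OF h(1)]) (auto intro!: continuous_intros)
  then have "open U" unfolding U_def
    by (rule continuous_open_preimage) auto
  then have oV: "open (U \<inter> ball 0 1)" by blast
  have "(1/2) *\<^sub>R u \<in> U \<inter> ball 0 1"
    using u hu unfolding U_def by auto
  then have ne: "U \<inter> ball 0 1 \<noteq> {}" by blast
  have "AE x in lborel. indicator (cball 0 1) x *\<^sub>R h (x /\<^sub>R norm x) = 0"
  proof (subst integral_nonneg_eq_0_iff_AE[symmetric])
    show "integrable lborel (\<lambda>x. indicator (cball 0 1) x *\<^sub>R h (x /\<^sub>R norm x))"
      using sphere_integrable_continuous[OF h(1)] unfolding sphere_integrable_def set_integrable_def .
    show "(LINT x|lborel. indicator (cball 0 1) x *\<^sub>R h (x /\<^sub>R norm x)) = 0"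
      using int unfolding sphere_integral_def set_lebesgue_integral_def by simp
  qed (use h(2) in auto)
  then have "AE x in lborel. x \<notin> U \<inter> ball 0 1"
    by eventually_elim (auto simp: U_def)
  then have "negligible (U \<inter> ball 0 1)"
    using oV AE_iff_null_sets[of "U \<inter> ball 0 1" lborel]
    by (auto simp: negligible_iff_null_sets intro: null_sets_completionI)
  then show False using open_not_negligible[OF oV ne] by blast
qed

lemma sphere_integral_one_pos: "sphere_integral (\<lambda>x :: real^'n. 1) > 0"
proof -
  have "0 \<le> sphere_integral (\<lambda>x :: real^'n. 1)" by (rule sphere_integral_nonneg) simp
  moreover have "sphere_integral (\<lambda>x :: real^'n. 1) \<noteq> 0"
    using sphere_integral_eq_0_imp[of "\<lambda>x :: real^'n. 1" "axis undefined 1"] by (auto simp: norm_axis_1)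
  ultimately show ?thesis by simp
qed

lemma sphere_integral_orthogonal:
  fixes h :: "real^'n \<Rightarrow> real" and R :: "real^'n \<Rightarrow> real^'n"
  assumes R: "orthogonal_transformation R" and h: "continuous_on UNIV h"
  shows "sphere_integral (\<lambda>x. h (R x)) = sphere_integral h"
proof -
  have lin: "linear R" using R by (rule orthogonal_transformation_linear)
  have R_meas[measurable]: "R \<in> borel_measurable borel"
    using lin by (intro borel_measurable_continuous_onI linear_continuous_on) (simp add: linear_conv_bounded_linear)
  have [measurable]: "(\<lambda>x. h (x /\<^sub>R norm x)) \<in> borel_measurable borel" using h by (rule borel_measurable_radial)
  have [measurable]: "cball (0::real^'n) 1 \<in> sets borel" by (intro borel_closed) simp
  have "(LINT x|lborel. indicator (cball 0 1) x *\<^sub>R h (x /\<^sub>R norm x)) =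
    (LINT x|distr lborel borel R. indicator (cball 0 1) x *\<^sub>R h (x /\<^sub>R norm x))"
    unfolding lborel_distr_orthogonal[OF R] ..
  also have "\<dots> = (LINT x|lborel. indicator (cball 0 1) (R x) *\<^sub>R h (R x /\<^sub>R norm (R x)))"
    by (rule integral_distr) auto
  also have "\<dots> = (LINT x|lborel. indicator (cball 0 1) x *\<^sub>R h (R (x /\<^sub>R norm x)))"
    using lin orthogonal_transformation_norm[OF R] by (simp add: linear_scale indicator_def)
  finally show ?thesis unfolding sphere_integral_def set_lebesgue_integral_def by simp
qed

section \<open>Orthonormal systems of harmonics and their reproducing kernel\<close>

definition sphere_inner :: "(real^'n \<Rightarrow> real) \<Rightarrow> (real^'n \<Rightarrow> real) \<Rightarrow> real" where
  "sphere_inner f g = sphere_integral (\<lambda>x. f x * g x)"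

definition harmonic_orthonormal :: "nat \<Rightarrow> 'b set \<Rightarrow> ('b \<Rightarrow> real^'n \<Rightarrow> real) \<Rightarrow> bool" where
  "harmonic_orthonormal l J e \<longleftrightarrow> (\<forall>j\<in>J. harmonic_poly l (e j)) \<and>
     (\<forall>i\<in>J. \<forall>j\<in>J. sphere_inner (e i) (e j) = (if i = j then 1 else 0))"

lemma harmonic_poly_continuous: "harmonic_poly l f \<Longrightarrow> continuous_on UNIV f"
  unfolding harmonic_poly_def using hom_poly_imp_poly_deg poly_deg_continuous_on by blast

lemma sphere_integrable_harmonic_mult:
  assumes "harmonic_poly l f" "harmonic_poly l g"
  shows "sphere_integrable (\<lambda>x. f x * g x)"
  using assms by (intro sphere_integrable_continuous continuous_on_mult harmonic_poly_continuous)

lemma sphere_inner_commute: "sphere_inner f g = sphere_inner g f"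
  unfolding sphere_inner_def by (simp add: mult.commute)

lemma sphere_inner_sum_left:
  assumes "\<forall>i\<in>I. harmonic_poly l (f i)" "harmonic_poly l g"
  shows "sphere_inner (\<lambda>x. \<Sum>i\<in>I. c i * f i x) g = (\<Sum>i\<in>I. c i * sphere_inner (f i) g)"
proof -
  have "sphere_inner (\<lambda>x. \<Sum>i\<in>I. c i * f i x) g = sphere_integral (\<lambda>x. \<Sum>i\<in>I. c i * (f i x * g x))"
    unfolding sphere_inner_def by (simp add: sum_distrib_right mult.assoc)
  also have "\<dots> = (\<Sum>i\<in>I. c i * sphere_inner (f i) g)"
    unfolding sphere_inner_def using assms
    by (intro sphere_integral_sum sphere_integrable_harmonic_mult[where l = l]) auto
  finally show ?thesis .
qed

lemma sphere_inner_orthonormal_sums: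
  assumes e: "harmonic_orthonormal l J e" "finite J"
  shows "sphere_inner (\<lambda>x. \<Sum>j\<in>J. a j * e j x) (\<lambda>x. \<Sum>j\<in>J. b j * e j x) = (\<Sum>j\<in>J. a j * b j)"
proof -
  have h: "\<forall>j\<in>J. harmonic_poly l (e j)"
    and on: "\<And>i j. i \<in> J \<Longrightarrow> j \<in> J \<Longrightarrow> sphere_inner (e i) (e j) = (if i = j then 1 else 0)"
    using e unfolding harmonic_orthonormal_def by auto
  have "sphere_inner (e i) (\<lambda>x. \<Sum>j\<in>J. b j * e j x) = b i" if "i \<in> J" for i
    unfolding sphere_inner_commute[of "e i"] sphere_inner_sum_left[OF h bspec[OF h that]]
    using that e(2) by (simp add: on if_distrib[where f = "\<lambda>c. _ * c"] cong: if_cong)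
  then show ?thesis
    using sphere_inner_sum_left[OF h harmonic_poly_sum[where f = e and I = J and c = b]] h by simp
qed

text \<open>The squared distance from \<open>w\<close> to its orthogonal projection \<open>p\<close>
  is nonnegative.\<close>

lemma bessel_sphere:
  assumes e: "harmonic_orthonormal l J e" "finite J" and w: "harmonic_poly l w"
  shows "(\<Sum>j\<in>J. (sphere_inner (e j) w)\<^sup>2) \<le> sphere_inner w w"
proof -
  define a where "a j = sphere_inner (e j) w" for j
  define p where "p x = (\<Sum>j\<in>J. a j * e j x)" for x
  have h: "\<forall>j\<in>J. harmonic_poly l (e j)" using e unfolding harmonic_orthonormal_def by auto
  have p: "harmonic_poly l p" unfolding p_def[abs_def] using h by (intro harmonic_poly_sum) auto
  have pp: "sphere_inner p p = (\<Sum>j\<in>J. (a j)\<^sup>2)"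
    unfolding p_def[abs_def] sphere_inner_orthonormal_sums[OF e] by (simp add: power2_eq_square)
  have pw: "sphere_inner p w = (\<Sum>j\<in>J. (a j)\<^sup>2)"
    unfolding p_def[abs_def] sphere_inner_sum_left[OF h w] by (simp add: a_def power2_eq_square)
  have "0 \<le> sphere_integral (\<lambda>x. (w x - p x)\<^sup>2)"
    by (rule sphere_integral_nonneg) simp
  \<comment> \<open>The square is written as a three-term linear combination so that linearity in
    the form \<open>sphere_integral_sum\<close> applies.\<close>
  also have "(\<lambda>x. (w x - p x)\<^sup>2) = (\<lambda>x. \<Sum>i\<in>{0,1,2::nat}. (if i = 0 then 1 else if i = 1 then - 2 else 1) *
      (if i = 0 then w x * w x else if i = 1 then p x * w x else p x * p x))"
    by (simp add: power2_eq_square algebra_simps)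
  also have "sphere_integral \<dots> = sphere_inner w w - 2 * sphere_inner p w + sphere_inner p p"
    by (subst sphere_integral_sum)
      (use sphere_integrable_harmonic_mult[OF w w] sphere_integrable_harmonic_mult[OF p w] sphere_integrable_harmonic_mult[OF p p]
        in \<open>auto simp: sphere_inner_def\<close>)
  finally show ?thesis unfolding pp pw a_def by simp
qed

text \<open>Orthonormality excludes the linear dependence that a larger system would have by
  \<open>harmonic_poly_dependent\<close>: the squared norm of the combination is the sum of its
  squared coefficients.\<close>

lemma harmonic_orthonormal_card:
  fixes e :: "'b \<Rightarrow> real^'n \<Rightarrow> real"
  assumes card: "CARD('n) \<ge> 2" and e: "harmonic_orthonormal l J e" "finite J"
  shows "card J \<le> 2 * (l + 1) ^ (CARD('n) - 2)"
proof (rule ccontr)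
  assume "\<not> ?thesis"
  then have "2 * (l + 1) ^ (CARD('n) - 2) < card J" by simp
  from harmonic_poly_dependent[OF card e(2) this, of e] e(1)
  obtain c where c: "\<exists>j\<in>J. c j \<noteq> 0" "\<And>x. (\<Sum>j\<in>J. c j * e j x) = 0"
    unfolding harmonic_orthonormal_def by blast
  have "(\<Sum>j\<in>J. c j * c j) = sphere_inner (\<lambda>x::real^'n. 0) (\<lambda>x. 0)"
    using sphere_inner_orthonormal_sums[OF e, of c c] unfolding c(2) by (rule sym)
  also have "\<dots> = 0" unfolding sphere_inner_def sphere_integral_def by simp
  finally have "\<forall>j\<in>J. c j * c j = 0" using e(2) by (simp add: sum_nonneg_eq_0_iff)
  with c(1) show False by auto
qed

text \<open>An orthonormal system of maximal size exists by the cardinality bound. The residual of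
  \<open>p\<close> is orthogonal to it; a nonzero residual could be normalised and appended, so its
  norm is 0, and continuity makes it vanish on the sphere.\<close>

lemma harmonic_orthonormal_basis_ex:
  assumes card: "CARD('n) \<ge> 2"
  obtains D and e :: "nat \<Rightarrow> real^'n \<Rightarrow> real" where "harmonic_orthonormal l {..<D} e"
    "\<And>p x. harmonic_poly l p \<Longrightarrow> norm x = 1 \<Longrightarrow> p x = (\<Sum>i<D. sphere_inner p (e i) * e i x)"
proof -
  define Q where "Q D \<longleftrightarrow> (\<exists>e :: nat \<Rightarrow> real^'n \<Rightarrow> real. harmonic_orthonormal l {..<D} e)" for D
  have Q0: "Q 0" unfolding Q_def harmonic_orthonormal_def by simp
  have bound: "D \<le> 2 * (l + 1) ^ (CARD('n) - 2)" if "Q D" for D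
    using that harmonic_orthonormal_card[OF card, of l "{..<D}"] unfolding Q_def by auto
  define D where "D = Greatest Q"
  have D: "D' \<le> D" if "Q D'" for D'
    unfolding D_def using that bound by (rule Greatest_le_nat)
  have "Q D" unfolding D_def using Q0 bound by (rule GreatestI_nat)
  then obtain e :: "nat \<Rightarrow> real^'n \<Rightarrow> real" where e: "harmonic_orthonormal l {..<D} e" unfolding Q_def by blast
  have h: "\<And>j. j \<in> {..<D} \<Longrightarrow> harmonic_poly l (e j)"
    and on: "\<And>i j. i \<in> {..<D} \<Longrightarrow> j \<in> {..<D} \<Longrightarrow> sphere_inner (e i) (e j) = (if i = j then 1 else 0)"
    using e unfolding harmonic_orthonormal_def by auto
  have "p x = (\<Sum>i<D. sphere_inner p (e i) * e i x)" if p: "harmonic_poly l p" and x: "norm x = 1" for p x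
  proof -
    \<comment> \<open>\<open>p\<close> is stored at the fresh index \<open>D\<close>, so that the
      residual is one linear combination of harmonic polynomials.\<close>
    define f where "f j = (if j = D then p else e j)" for j
    define r where "r x = (\<Sum>j\<in>{..D}. (if j = D then 1 else - sphere_inner p (e j)) * f j x)" for x
    have hf: "harmonic_poly l (f j)" if "j \<in> {..D}" for j using that h p unfolding f_def by auto
    then have hf': "\<forall>j\<in>{..D}. harmonic_poly l (f j)" by blast
    have r: "harmonic_poly l r" unfolding r_def[abs_def] by (rule harmonic_poly_sum[OF hf])
    have r_eq: "r x = p x - (\<Sum>i<D. sphere_inner p (e i) * e i x)" for x
      unfolding r_def f_def lessThan_Suc_atMost[symmetric] by (simp add: sum_negf)
    have re: "sphere_inner r (e k) = 0" if k: "k \<in> {..<D}" for k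
    proof -
      have "sphere_inner r (e k) = sphere_inner p (e k) - (\<Sum>i<D. sphere_inner p (e i) * sphere_inner (e i) (e k))"
        unfolding r_def[abs_def] sphere_inner_sum_left[OF hf'  h[OF k]]
        unfolding f_def lessThan_Suc_atMost[symmetric] by (simp add: sum_negf)
      also have "(\<Sum>i<D. sphere_inner p (e i) * sphere_inner (e i) (e k)) = (\<Sum>i<D. if i = k then sphere_inner p (e k) else 0)"
        using k by (intro sum.cong) (auto simp: on)
      finally show ?thesis using k by simp
    qed
    define c where "c = sphere_inner r r"
    have c0: "c \<ge> 0" unfolding c_def sphere_inner_def by (rule sphere_integral_nonneg) simp
    have "c = 0"
    proof (rule ccontr)
      assume "c \<noteq> 0"
      with c0 have cp: "c > 0" by simp
      define s where "s = 1 / sqrt c"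
      define q where "q x = s * r x" for x
      define e' where "e' j = (if j = D then q else e j)" for j
      have he: "harmonic_poly l q"
        using harmonic_poly_sum[of "{()}" l "\<lambda>_. r" "\<lambda>_. s"] r by (simp add: q_def[abs_def])
      have i1: "sphere_inner q g = s * sphere_inner r g" if "harmonic_poly l g" for g
        using sphere_inner_sum_left[of "{()}" l "\<lambda>_. r" g "\<lambda>_. s"] r that by (simp add: q_def[abs_def])
      have "s * (s * c) = 1" using cp unfolding s_def by (simp add: field_simps)
      then have i2: "sphere_inner q q = 1"
        using i1[OF he] i1[OF r] sphere_inner_commute[of r q] c_def by simp
      have i3: "sphere_inner q (e k) = 0" if "k \<in> {..<D}" for k
        using i1[OF h[OF that]] re[OF that] by simp
      have "harmonic_orthonormal l {..<Suc D} e'"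
        unfolding harmonic_orthonormal_def
      proof (intro conjI ballI)
        show "harmonic_poly l (e' j)" if "j \<in> {..<Suc D}" for j
          using that he h unfolding e'_def by auto
        show "sphere_inner (e' i) (e' j) = (if i = j then 1 else 0)" if ij: "i \<in> {..<Suc D}" "j \<in> {..<Suc D}" for i j
        proof -
          consider "i = D" "j = D" | "i = D" "j < D" | "i < D" "j = D" | "i < D" "j < D"
            using ij by force
          then show ?thesis
          proof cases
            case 3
            then show ?thesis using i3[of i] sphere_inner_commute[of "e i"] unfolding e'_def by auto
          qed (use i2 i3 on in \<open>auto simp: e'_def\<close>)
        qed
      qed
      then have "Q (Suc D)" unfolding Q_def by blast
      from D[OF this] show False by simp
    qed
    have "r x * r x = 0"
    proof (rule sphere_integral_eq_0_imp[of "\<lambda>x. r x * r x", OF _ _ _ x])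
      show "continuous_on UNIV (\<lambda>x. r x * r x)"
        using harmonic_poly_continuous[OF r] by (intro continuous_on_mult)
      show "sphere_integral (\<lambda>x. r x * r x) = 0" using \<open>c = 0\<close> unfolding c_def sphere_inner_def .
    qed simp
    then show ?thesis unfolding r_eq by simp
  qed
  with e that show thesis by blast
qed

lemma harmonic_orthonormal_compose:
  fixes R :: "real^'n \<Rightarrow> real^'n"
  assumes R: "orthogonal_transformation R" and e: "harmonic_orthonormal l J e"
  shows "harmonic_orthonormal l J (\<lambda>j x. e j (R x))"
  unfolding harmonic_orthonormal_def
proof (intro conjI ballI)
  have h: "\<And>j. j \<in> J \<Longrightarrow> harmonic_poly l (e j)" using e unfolding harmonic_orthonormal_def by auto
  show "harmonic_poly l (\<lambda>x. e j (R x))" if "j \<in> J" for j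
    by (rule harmonic_poly_compose_orthogonal[OF R h[OF that]])
  show "sphere_inner (\<lambda>x. e i (R x)) (\<lambda>x. e j (R x)) = (if i = j then 1 else 0)" if ij: "i \<in> J" "j \<in> J" for i j
  proof -
    have "sphere_inner (\<lambda>x. e i (R x)) (\<lambda>x. e j (R x)) = sphere_inner (e i) (e j)"
      unfolding sphere_inner_def
      by (rule sphere_integral_orthogonal[OF R, of "\<lambda>x. e i x * e j x"])
        (intro continuous_on_mult harmonic_poly_continuous[OF h[OF ij(1)]] harmonic_poly_continuous[OF h[OF ij(2)]])
    then show ?thesis using e ij unfolding harmonic_orthonormal_def by simp
  qed
qed

text \<open>The reproducing kernel of the degree-\<open>l\<close> harmonics is rotation invariant, hence constant on the
  diagonal, and its integral is the dimension.\<close>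
lemma harmonic_orthonormal_pointwise_bound:
  fixes f :: "'b \<Rightarrow> real^'n \<Rightarrow> real"
  assumes card: "CARD('n) \<ge> 2" and f: "harmonic_orthonormal l J f" "finite J" and x: "norm x = 1"
  shows "(\<Sum>j\<in>J. (f j x)\<^sup>2) \<le> 2 * (real l + 1) ^ (CARD('n) - 2) / sphere_integral (\<lambda>x :: real^'n. 1)"
proof -
  obtain D and e :: "nat \<Rightarrow> real^'n \<Rightarrow> real" where e: "harmonic_orthonormal l {..<D} e"
    and rep: "\<And>p x. harmonic_poly l p \<Longrightarrow> norm x = 1 \<Longrightarrow> p x = (\<Sum>i<D. sphere_inner p (e i) * e i x)"
    using harmonic_orthonormal_basis_ex[OF card] by blast
  have h: "\<And>j. j \<in> {..<D} \<Longrightarrow> harmonic_poly l (e j)" using e unfolding harmonic_orthonormal_def by auto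
  define K where "K x = (\<Sum>i<D. (e i x)\<^sup>2)" for x
  define \<omega> where "\<omega> = sphere_integral (\<lambda>x :: real^'n. 1)"
  have \<omega>: "\<omega> > 0" unfolding \<omega>_def by (rule sphere_integral_one_pos)
  \<comment> \<open>For any orthonormal system; used for the rotated basis, which makes
    \<open>K\<close> constant on the sphere, and finally for \<open>f\<close> itself.\<close>
  have le_K: "(\<Sum>j\<in>J'. (g j x)\<^sup>2) \<le> K x"
    if g: "harmonic_orthonormal l J' g" "finite J'" and x: "norm x = 1" for J' :: "'c set" and g and x :: "real^'n"
  proof -
    \<comment> \<open>The zonal function centred at \<open>x\<close>: its inner product with a
      harmonic \<open>g j\<close> is \<open>g j x\<close>, so Bessel's inequality bounds point
      values.\<close>
    define w where "w y = (\<Sum>i<D. e i x * e i y)" for y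
    have w: "harmonic_poly l w" unfolding w_def[abs_def] by (rule harmonic_poly_sum[OF h])
    have ww: "sphere_inner w w = K x"
      unfolding w_def[abs_def] sphere_inner_orthonormal_sums[OF e finite_lessThan]
      by (simp add: K_def power2_eq_square)
    have "g j x = sphere_inner (g j) w" if j: "j \<in> J'" for j
    proof -
      have gj: "harmonic_poly l (g j)" using g j unfolding harmonic_orthonormal_def by auto
      have "sphere_inner (g j) w = (\<Sum>i<D. e i x * sphere_inner (e i) (g j))"
        unfolding sphere_inner_commute[of "g j" w] unfolding w_def[abs_def]
        using h by (intro sphere_inner_sum_left[OF _ gj]) auto
      also have "\<dots> = g j x"
        unfolding rep[OF gj x] by (intro sum.cong) (auto simp: mult.commute sphere_inner_commute[of "g j" "e _"])
      finally show ?thesis ..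
    qed
    then have "(\<Sum>j\<in>J'. (g j x)\<^sup>2) = (\<Sum>j\<in>J'. (sphere_inner (g j) w)\<^sup>2)" by simp
    also have "\<dots> \<le> sphere_inner w w" by (rule bessel_sphere[OF g w])
    finally show ?thesis unfolding ww .
  qed
  have K_le: "K y \<le> K x" if xy: "norm x = 1" "norm y = 1" for x y
  proof -
    obtain R where R: "orthogonal_transformation R" "R x = y"
      using orthogonal_transformation_exists_1[OF xy] by blast
    show ?thesis
      using le_K[OF harmonic_orthonormal_compose[OF R(1) e] finite_lessThan xy(1)]
      unfolding R(2) K_def[symmetric] .
  qed
  have Kint: "sphere_integrable (\<lambda>y. (e i y)\<^sup>2)" if "i \<in> {..<D}" for i
    using sphere_integrable_harmonic_mult[OF h[OF that] h[OF that]] by (simp add: power2_eq_square)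
  have "K x * \<omega> = sphere_integral (\<lambda>y :: real^'n. K x * 1)"
    unfolding \<omega>_def sphere_integral_def by (subst set_integral_mult_right) simp
  also have "\<dots> = sphere_integral K"
  proof (rule sphere_integral_cong)
    show "K x * 1 = K y" if "norm y = 1" for y
      using K_le[OF x that] K_le[OF that x] by simp
    show "sphere_integrable (\<lambda>y :: real^'n. K x * 1)" by (intro sphere_integrable_continuous continuous_intros)
    show "sphere_integrable K" unfolding K_def
      using h by (intro sphere_integrable_continuous continuous_intros harmonic_poly_continuous[of l]) auto
  qed
  also have "sphere_integral K = (\<Sum>i<D. 1 * sphere_integral (\<lambda>y. (e i y)\<^sup>2))"
    unfolding K_def[abs_def] 
    using sphere_integral_sum[where I = "{..<D}" and f = "\<lambda>i y. (e i y)\<^sup>2" and c = "\<lambda>_. 1"] Kint by simp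
  also have "\<dots> = (\<Sum>i<D. 1)"
    using e by (intro sum.cong refl) (simp add: harmonic_orthonormal_def sphere_inner_def power2_eq_square)
  finally have "K x * \<omega> = real D" by simp
  moreover have "real D \<le> 2 * (real l + 1) ^ (CARD('n) - 2)"
  proof -
    have "D \<le> 2 * (l + 1) ^ (CARD('n) - 2)"
      using harmonic_orthonormal_card[OF card e finite_lessThan] by simp
    then have "real D \<le> real (2 * (l + 1) ^ (CARD('n) - 2))" by (rule of_nat_mono)
    then show ?thesis by (simp add: add.commute)
  qed
  ultimately have "K x \<le> 2 * (real l + 1) ^ (CARD('n) - 2) / \<omega>"
    using \<omega> by (simp add: field_simps)
  with le_K[OF f x] show ?thesis unfolding \<omega>_def by linarith
qed

text \<open>\<open>S\<close> is prescribed on the sphere only, whereas degree bounds and derivatives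
  refer to a polynomial on the whole space; one representative is fixed for each index.\<close>

lemma spherical_harmonics_poly:
  fixes S :: "nat \<Rightarrow> nat \<Rightarrow> real^'n \<Rightarrow> real"
  assumes S: "spherical_harmonics S"
  obtains p where "\<And>l m. 1 \<le> m \<Longrightarrow> m \<le> harm_dim l CARD('n) \<Longrightarrow> harmonic_poly l (p l m :: real^'n \<Rightarrow> real)"
    "\<And>l m x. 1 \<le> m \<Longrightarrow> m \<le> harm_dim l CARD('n) \<Longrightarrow> norm x = 1 \<Longrightarrow> S l m x = p l m x"
proof -
  define P where "P l m p \<longleftrightarrow> harmonic_poly l p \<and> (\<forall>x. norm x = 1 \<longrightarrow> S l m x = p x)" for l m p
  have ex: "\<exists>p. P l m p" if m: "1 \<le> m" "m \<le> harm_dim l CARD('n)" for l m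
  proof -
    obtain p where p: "harmonic_homog_poly l p" "\<forall>x\<in>sphere 0 1. S l m x = p x"
      using S m unfolding spherical_harmonics_def by blast
    then have "P l m p"
      using harmonic_homog_poly_imp_harmonic_poly[OF p(1)] unfolding P_def by simp
    then show ?thesis by blast
  qed
  define p where "p l m = (SOME p. P l m p)" for l m
  have "P l m (p l m)" if "1 \<le> m" "m \<le> harm_dim l CARD('n)" for l m
    unfolding p_def using ex[OF that] by (rule someI_ex)
  then show thesis unfolding P_def by (intro that[of p]) auto
qed

lemma spherical_harmonics_pointwise_bound:
  fixes S :: "nat \<Rightarrow> nat \<Rightarrow> real^'n \<Rightarrow> real"
  assumes card: "CARD('n) \<ge> 2" and S: "spherical_harmonics S" and x: "norm x = 1"
  shows "(\<Sum>m=1..harm_dim l CARD('n). (S l m x)\<^sup>2)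
      \<le> 2 * (real l + 1) ^ (CARD('n) - 2) / sphere_integral (\<lambda>x :: real^'n. 1)"
proof -
  obtain p where p: "\<And>l m. 1 \<le> m \<Longrightarrow> m \<le> harm_dim l CARD('n) \<Longrightarrow> harmonic_poly l (p l m :: real^'n \<Rightarrow> real)"
    and Sp: "\<And>l m x. 1 \<le> m \<Longrightarrow> m \<le> harm_dim l CARD('n) \<Longrightarrow> norm x = 1 \<Longrightarrow> S l m x = p l m x"
    using spherical_harmonics_poly[OF S] by blast
  have "harmonic_orthonormal l {1..harm_dim l CARD('n)} (p l)"
    unfolding harmonic_orthonormal_def
  proof (intro conjI ballI)
    fix i j assume ij: "i \<in> {1..harm_dim l CARD('n)}" "j \<in> {1..harm_dim l CARD('n)}"
    have "sphere_integrable (\<lambda>x. S l i x * S l j x)"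
      and *: "sphere_integral (\<lambda>x. S l i x * S l j x) = (if i = j then 1 else 0)"
      using S ij unfolding spherical_harmonics_def by auto
    then have "sphere_integral (\<lambda>x. S l i x * S l j x) = sphere_integral (\<lambda>x. p l i x * p l j x)"
      using ij by (intro sphere_integral_cong sphere_integrable_harmonic_mult[of l "p l i"]) (auto simp: Sp p)
    with * show "sphere_inner (p l i) (p l j) = (if i = j then 1 else 0)" unfolding sphere_inner_def by simp
  qed (use p in auto)
  from harmonic_orthonormal_pointwise_bound[OF card this _ x]
  have "(\<Sum>m=1..harm_dim l CARD('n). (p l m x)\<^sup>2)
      \<le> 2 * (real l + 1) ^ (CARD('n) - 2) / sphere_integral (\<lambda>x :: real^'n. 1)" by simp
  moreover have "(\<Sum>m=1..harm_dim l CARD('n). (p l m x)\<^sup>2) = (\<Sum>m=1..harm_dim l CARD('n). (S l m x)\<^sup>2)"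
    using x by (intro sum.cong) (auto simp: Sp)
  ultimately show ?thesis by simp
qed

section \<open>Gaussian moments\<close>

text \<open>The double factorial (2k - 1)!!, which is the moment of order \<open>2 * k\<close> of a
  standard normal variable.\<close>

definition gauss_moment :: "nat \<Rightarrow> real" where
  "gauss_moment k = fact (2 * k) / (2 ^ k * fact k)"

lemma (in prob_space) normal_distributed_moment:
  assumes X: "distributed M lborel X (\<lambda>x. ennreal (normal_density 0 \<sigma> x))" and s: "\<sigma> > 0"
  shows "integrable M (\<lambda>\<omega>. X \<omega> ^ (2 * k))"
    and "expectation (\<lambda>\<omega>. X \<omega> ^ (2 * k)) = gauss_moment k * \<sigma> ^ (2 * k)"
proof -
  have m: "has_bochner_integral lborel (\<lambda>x. normal_density 0 \<sigma> x * x ^ (2 * k)) (fact (2 * k) / ((2 / \<sigma>\<^sup>2) ^ k * fact k))"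
    using normal_moment_even[OF s, of 0 k] by simp
  show "integrable M (\<lambda>\<omega>. X \<omega> ^ (2 * k))"
    using distributed_integrable[OF X, of "\<lambda>x. x ^ (2 * k)"] m by (auto simp: has_bochner_integral_iff)
  have "expectation (\<lambda>\<omega>. X \<omega> ^ (2 * k)) = fact (2 * k) / ((2 / \<sigma>\<^sup>2) ^ k * fact k)"
    using distributed_integral[OF X, of "\<lambda>x. x ^ (2 * k)"] m by (auto simp: has_bochner_integral_iff)
  then show "expectation (\<lambda>\<omega>. X \<omega> ^ (2 * k)) = gauss_moment k * \<sigma> ^ (2 * k)"
    using s by (simp add: gauss_moment_def power_divide power_mult[symmetric] field_simps)
qed

lemma (in prob_space) centered_gaussian_rv_second_moment:
  assumes "centered_gaussian_rv M Y"
  shows "integrable M (\<lambda>\<omega>. Y \<omega> ^ 2)"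
  using assms unfolding centered_gaussian_rv_def
proof (elim disjE exE conjE)
  fix \<sigma> :: real assume "\<sigma> > 0" "distributed M lborel Y (\<lambda>x. ennreal (normal_density 0 \<sigma> x))"
  then show ?thesis using normal_distributed_moment(1)[of Y \<sigma> 1] by simp
next
  assume "Y \<in> borel_measurable M" "AE \<omega> in M. Y \<omega> = 0"
  then show ?thesis
    by (subst integrable_cong_AE[where g = "\<lambda>_. 0"]) auto
qed

text \<open>The increment is a linear combination of two values, hence centred Gaussian; its
  variance \<open>\<bar>t - s\<bar> powr (2 * H)\<close> from the covariance is positive, which
  excludes the degenerate case and determines \<open>\<sigma>\<close>.\<close>

lemma (in prob_space) fbm_increment_distributed:
  assumes X: "fbm M H X" and H: "0 < H" and st: "0 \<le> s" "0 \<le> t" "s \<noteq> t"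
  shows "distributed M lborel (\<lambda>\<omega>. X t \<omega> - X s \<omega>) (\<lambda>x. ennreal (normal_density 0 (\<bar>t - s\<bar> powr H) x))"
proof -
  have meas[measurable]: "X u \<in> borel_measurable M" if "u \<ge> 0" for u using X that unfolding fbm_def by blast
  have gauss: "centered_gaussian_rv M (\<lambda>\<omega>. \<Sum>u\<in>F. c u * X u \<omega>)" if "finite F" "F \<subseteq> {0..}" for F c
    using X that unfolding fbm_def by blast
  have cov: "expectation (\<lambda>\<omega>. X u \<omega> * X v \<omega>) = (v powr (2*H) + u powr (2*H) - \<bar>v - u\<bar> powr (2*H)) / 2"
    if "u \<ge> 0" "v \<ge> 0" for u v using X that unfolding fbm_def by blast
  have sq: "integrable M (\<lambda>\<omega>. X u \<omega> ^ 2)" if "u \<ge> 0" for u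
    using centered_gaussian_rv_second_moment[OF gauss[of "{u}" "\<lambda>_. 1"]] that by simp
  have prod: "integrable M (\<lambda>\<omega>. X t \<omega> * X s \<omega>)"
  proof (rule Bochner_Integration.integrable_bound)
    show "integrable M (\<lambda>\<omega>. X t \<omega> ^ 2 + X s \<omega> ^ 2)" using sq st by auto
    have "\<bar>X t \<omega> * X s \<omega>\<bar> \<le> X t \<omega> ^ 2 + X s \<omega> ^ 2" for \<omega>
      using sum_squares_bound[of "\<bar>X t \<omega>\<bar>" "\<bar>X s \<omega>\<bar>"] mult_nonneg_nonneg[of "\<bar>X t \<omega>\<bar>" "\<bar>X s \<omega>\<bar>"]
      unfolding abs_mult power2_abs mult.assoc by linarith
    then show "AE \<omega> in M. norm (X t \<omega> * X s \<omega>) \<le> norm (X t \<omega> ^ 2 + X s \<omega> ^ 2)" by simp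
  qed (use st in measurable)
  define D where "D \<omega> = X t \<omega> - X s \<omega>" for \<omega>
  have "centered_gaussian_rv M (\<lambda>\<omega>. \<Sum>u\<in>{s, t}. (if u = t then 1 else - 1) * X u \<omega>)"
    by (rule gauss) (use st in auto)
  moreover have "(\<lambda>\<omega>. \<Sum>u\<in>{s, t}. (if u = t then 1 else - 1) * X u \<omega>) = D"
    using st by (auto simp: D_def)
  ultimately have DG: "centered_gaussian_rv M D" by simp
  have "expectation (\<lambda>\<omega>. D \<omega> ^ 2) = expectation (\<lambda>\<omega>. X t \<omega> ^ 2 + X s \<omega> ^ 2 - 2 * (X t \<omega> * X s \<omega>))"
    unfolding D_def by (simp add: power2_diff algebra_simps)
  also have "\<dots> = expectation (\<lambda>\<omega>. X t \<omega> ^ 2) + expectation (\<lambda>\<omega>. X s \<omega> ^ 2) - 2 * expectation (\<lambda>\<omega>. X t \<omega> * X s \<omega>)"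
    using sq st prod by simp
  also have "\<dots> = \<bar>t - s\<bar> powr (2 * H)"
    using cov[of t t] cov[of s s] cov[of t s] st by (simp add: power2_eq_square abs_minus_commute)
  finally have ED: "expectation (\<lambda>\<omega>. D \<omega> ^ 2) = (\<bar>t - s\<bar> powr H) ^ 2"
    by (simp add: power2_eq_square powr_add[symmetric])
  have pos: "\<bar>t - s\<bar> powr H > 0" using st by simp
  from DG show ?thesis
    unfolding centered_gaussian_rv_def
  proof (elim disjE exE conjE)
    fix \<sigma> :: real assume s: "\<sigma> > 0" and d: "distributed M lborel D (\<lambda>x. ennreal (normal_density 0 \<sigma> x))"
    have "\<sigma> ^ 2 = (\<bar>t - s\<bar> powr H) ^ 2"
      using normal_distributed_moment(2)[OF d s, of 1] ED by (simp add: gauss_moment_def fact_numeral)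
    then have "\<sigma> = \<bar>t - s\<bar> powr H" using s pos by (simp add: power2_eq_iff_nonneg)
    then show ?thesis using d unfolding D_def by simp
  next
    assume "D \<in> borel_measurable M" "AE \<omega> in M. D \<omega> = 0"
    then have "expectation (\<lambda>\<omega>. D \<omega> ^ 2) = expectation (\<lambda>\<omega>. 0)"
      by (intro integral_cong_AE) auto
    with ED pos show ?thesis by simp
  qed
qed

text \<open>A sum of independent normals is normal and variances add, so the moment depends on the
  coefficients through the sum of their squares alone.\<close>

lemma (in prob_space) fbm_sum_moment:
  assumes H: "0 < H" and \<beta>: "\<And>i. i \<in> I \<Longrightarrow> fbm M H (\<beta> i)"
    and indep: "indep_vars (\<lambda>_. PiM {0..} (\<lambda>_. borel)) (\<lambda>i \<omega>. restrict (\<lambda>t. \<beta> i t \<omega>) {0..}) I"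
    and J: "finite J" "J \<subseteq> I" and st: "0 \<le> s" "0 \<le> t" and k: "k \<ge> 1"
  shows "(\<integral>\<^sup>+\<omega>. ennreal ((\<Sum>i\<in>J. c i * (\<beta> i t \<omega> - \<beta> i s \<omega>)) ^ (2 * k)) \<partial>M) =
     ennreal (gauss_moment k * (\<Sum>i\<in>J. (c i)\<^sup>2) ^ k * \<bar>t - s\<bar> powr (2 * real k * H))"
proof -
  \<comment> \<open>\<open>sum_indep_normal\<close> asks for positive standard deviations and a
    nonempty index set. Zero coefficients are dropped, and the degenerate cases are treated apart,
    where \<open>k \<ge> 1\<close> makes both sides 0.\<close>
  define J' where "J' = {i \<in> J. c i \<noteq> 0}"
  have J': "finite J'" "J' \<subseteq> I" using J unfolding J'_def by auto
  have sum1: "(\<Sum>i\<in>J. c i * (\<beta> i t \<omega> - \<beta> i s \<omega>)) = (\<Sum>i\<in>J'. c i * (\<beta> i t \<omega> - \<beta> i s \<omega>))" for \<omega>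
    unfolding J'_def using J by (intro sum.mono_neutral_right) auto
  have sum2: "(\<Sum>i\<in>J. (c i)\<^sup>2) = (\<Sum>i\<in>J'. (c i)\<^sup>2)"
    unfolding J'_def using J by (intro sum.mono_neutral_right) auto
  show ?thesis
  proof (cases "s = t \<or> J' = {}")
    case True
    then show ?thesis using k unfolding sum1 sum2 by (auto simp: power_0_left)
  next
    case False
    then have ne: "s \<noteq> t" "J' \<noteq> {}" by auto
    define \<tau> where "\<tau> = \<bar>t - s\<bar> powr H"
    have \<tau>: "\<tau> > 0" unfolding \<tau>_def using ne by simp
    define \<sigma> where "\<sigma> = sqrt (\<Sum>i\<in>J'. (\<bar>c i\<bar> * \<tau>)\<^sup>2)"
    have ind: "indep_vars (\<lambda>_. borel) (\<lambda>i \<omega>. c i * (\<beta> i t \<omega> - \<beta> i s \<omega>)) J'"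
    proof -
      \<comment> \<open>Independence is given for whole paths; evaluation at two times is a
        measurable map of the path.\<close>
      have "indep_vars (\<lambda>_. borel) (\<lambda>i \<omega>. (\<lambda>i g. c i * (g t - g s)) i (restrict (\<lambda>t. \<beta> i t \<omega>) {0..})) I"
        by (rule indep_vars_compose2[OF indep])
          (use st in \<open>auto intro!: borel_measurable_times borel_measurable_diff measurable_component_singleton\<close>)
      then show ?thesis using st J'(2) by (auto intro: indep_vars_subset)
    qed
    have d: "distributed M lborel (\<lambda>\<omega>. \<Sum>i\<in>J'. c i * (\<beta> i t \<omega> - \<beta> i s \<omega>)) (normal_density (\<Sum>i\<in>J'. 0) \<sigma>)"
      unfolding \<sigma>_def
    proof (rule sum_indep_normal[OF J'(1) ne(2) ind])
      fix i assume i: "i \<in> J'"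
      then have ci: "c i \<noteq> 0" unfolding J'_def by simp
      then show "0 < \<bar>c i\<bar> * \<tau>" using \<tau> by simp
      have "distributed M lborel (\<lambda>\<omega>. \<beta> i t \<omega> - \<beta> i s \<omega>) (normal_density 0 \<tau>)"
        unfolding \<tau>_def using fbm_increment_distributed[OF \<beta> H st ne(1)] i J' by blast
      from normal_density_affine[OF this \<tau> ci, of 0]
      show "distributed M lborel (\<lambda>\<omega>. c i * (\<beta> i t \<omega> - \<beta> i s \<omega>)) (normal_density 0 (\<bar>c i\<bar> * \<tau>))" by simp
    qed
    have "(\<Sum>i\<in>J'. (\<bar>c i\<bar> * \<tau>)\<^sup>2) > 0"
      using ne(2) J'(1) \<tau> by (intro sum_pos) (auto simp: J'_def)
    then have \<sigma>0: "\<sigma> > 0" unfolding \<sigma>_def by simp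
    have \<sigma>2: "\<sigma> ^ 2 = (\<Sum>i\<in>J'. (c i)\<^sup>2) * \<tau> ^ 2"
      unfolding \<sigma>_def by (simp add: sum_nonneg power_mult_distrib sum_distrib_right)
    have "\<sigma> ^ (2 * k) = (\<Sum>i\<in>J'. (c i)\<^sup>2) ^ k * \<tau> ^ (2 * k)"
      unfolding power_mult \<sigma>2 by (simp add: power_mult_distrib)
    also have "\<tau> ^ (2 * k) = \<bar>t - s\<bar> powr (2 * real k * H)"
      unfolding \<tau>_def using ne(1) by (simp add: powr_powr powr_realpow[symmetric] mult_ac)
    finally have \<sigma>k: "\<sigma> ^ (2 * k) = (\<Sum>i\<in>J'. (c i)\<^sup>2) ^ k * \<bar>t - s\<bar> powr (2 * real k * H)" .
    have d0: "distributed M lborel (\<lambda>\<omega>. \<Sum>i\<in>J'. c i * (\<beta> i t \<omega> - \<beta> i s \<omega>)) (\<lambda>x. ennreal (normal_density 0 \<sigma> x))"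
      using d by simp
    show ?thesis
      unfolding sum1 sum2
      by (subst nn_integral_eq_integral[OF normal_distributed_moment(1)[OF d0 \<sigma>0]])
        (simp_all add: normal_distributed_moment(2)[OF d0 \<sigma>0] \<sigma>k mult.assoc zero_le_even_power)
  qed
qed

section \<open>Chaining over dyadic times\<close>

text \<open>The dyadic floors \<open>d m\<close> increase to \<open>u\<close>, and each refinement
  moves by at most one interval of the next level; the increments beyond level \<open>n\<close> sum
  to a geometric series with value \<open>q ^ n * (q / (1 - q))\<close>.\<close>

lemma dyadic_chaining:
  fixes g :: "real \<Rightarrow> real"
  assumes cont: "continuous_on {0..1} g" and q: "0 < q" "q < 1" and K: "K \<ge> 0"
    and inc: "\<And>n j. j < 2 ^ n \<Longrightarrow> \<bar>g (real (Suc j) / 2 ^ n) - g (real j / 2 ^ n)\<bar> \<le> K * q ^ n"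
    and u: "0 \<le> u" "u \<le> 1"
  shows "\<bar>g u - g (real (nat \<lfloor>2 ^ n * u\<rfloor>) / 2 ^ n)\<bar> \<le> K * q ^ n * (q / (1 - q))"
proof -
  define a where "a m = nat \<lfloor>2 ^ m * u\<rfloor>" for m
  define d where "d m = real (a m) / 2 ^ m" for m
  have a_real: "real (a m) = of_int \<lfloor>2 ^ m * u\<rfloor>" for m unfolding a_def using u by simp
  have a1: "real (a m) \<le> 2 ^ m * u" "2 ^ m * u < real (a m) + 1" for m
    unfolding a_real by linarith+
  have d01: "d m \<in> {0..1}" for m
  proof -
    have "real (a m) \<le> 2 ^ m" using a1(1)[of m] u by (meson mult_left_le order_trans zero_le_numeral zero_le_power)
    then show ?thesis unfolding d_def by simp
  qed
  have d_lim: "d \<longlonglongrightarrow> u"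
  proof (rule tendsto_sandwich[of "\<lambda>m. u - (1/2) ^ m" d sequentially "\<lambda>m. u"])
    show "\<forall>\<^sub>F m in sequentially. u - (1/2) ^ m \<le> d m"
    proof (intro always_eventually allI)
      fix m
      have "(2 ^ m * u - 1) / 2 ^ m \<le> d m"
        unfolding d_def using a1(2)[of m] by (intro divide_right_mono) auto
      then show "u - (1/2) ^ m \<le> d m" by (simp add: diff_divide_distrib power_divide)
    qed
    show "\<forall>\<^sub>F m in sequentially. d m \<le> u"
      using a1(1) by (intro always_eventually allI) (simp add: d_def field_simps)
    have "(\<lambda>m. u - (1/2) ^ m) \<longlonglongrightarrow> u - 0" by (intro tendsto_intros LIMSEQ_realpow_zero) auto
    then show "(\<lambda>m. u - (1/2) ^ m) \<longlonglongrightarrow> u" by simp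
  qed simp
  have step: "\<bar>g (d (Suc m)) - g (d m)\<bar> \<le> K * q ^ Suc m" for m
  proof -
    have "2 * real (a m) < real (a (Suc m)) + 1" "real (a (Suc m)) < 2 * real (a m) + 2"
      using a1[of m] a1[of "Suc m"] by auto
    \<comment> \<open>The next binary digit of \<open>u\<close> is 0 or 1: either nothing moves or
      exactly one increment is used.\<close>
    then have "a (Suc m) = 2 * a m \<or> a (Suc m) = Suc (2 * a m)" by linarith
    then show ?thesis
    proof
      assume "a (Suc m) = 2 * a m"
      then have "d (Suc m) = d m" unfolding d_def by simp
      then show ?thesis using K q by simp
    next
      assume e: "a (Suc m) = Suc (2 * a m)"
      have "real (a (Suc m)) \<le> 2 ^ Suc m" using d01[of "Suc m"] unfolding d_def by (simp add: field_simps)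
      then have "a (Suc m) \<le> 2 ^ Suc m" by (metis of_nat_le_iff of_nat_numeral of_nat_power)
      then have "2 * a m < 2 ^ Suc m" using e by simp
      moreover have "d m = real (2 * a m) / 2 ^ Suc m" unfolding d_def by simp
      ultimately show ?thesis
        using inc[of "2 * a m" "Suc m"] unfolding d_def[of "Suc m"] e by simp
    qed
  qed
  have fin: "\<bar>g (d (n + p)) - g (d n)\<bar> \<le> K * q ^ n * (q / (1 - q))" for p
  proof -
    have "\<bar>g (d (n + p)) - g (d n)\<bar> \<le> (\<Sum>i<p. K * q ^ Suc (n + i))"
    proof (induction p)
      case (Suc p)
      then show ?case using step[of "n + p"] by simp
    qed simp
    also have "\<dots> = K * q ^ n * (q * (\<Sum>i<p. q ^ i))"
      by (simp add: sum_distrib_left power_add mult_ac)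
    also have "\<dots> \<le> K * q ^ n * (q / (1 - q))"
    proof (intro mult_left_mono)
      have "(\<Sum>i<p. q ^ i) \<le> (\<Sum>i. q ^ i)" using q by (intro sum_le_suminf summable_geometric) auto
      also have "\<dots> = 1 / (1 - q)" using q by (intro suminf_geometric) auto
      finally have "q * (\<Sum>i<p. q ^ i) \<le> q * (1 / (1 - q))" using q by (intro mult_left_mono) auto
      then show "q * (\<Sum>i<p. q ^ i) \<le> q / (1 - q)" by simp
    qed (use K q in auto)
    finally show ?thesis .
  qed
  have "(\<lambda>m. g (d m)) \<longlonglongrightarrow> g u"
    by (rule continuous_on_tendsto_compose[OF cont d_lim]) (use u d01 in auto)
  then have "(\<lambda>p. \<bar>g (d (n + p)) - g (d n)\<bar>) \<longlonglongrightarrow> \<bar>g u - g (d n)\<bar>"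
    using LIMSEQ_ignore_initial_segment[of "\<lambda>m. g (d m)" "g u" n]
    by (intro tendsto_intros) (simp add: add.commute)
  then have "\<bar>g u - g (d n)\<bar> \<le> K * q ^ n * (q / (1 - q))"
    by (rule LIMSEQ_le_const2) (use fin in auto)
  then show ?thesis unfolding d_def a_def .
qed

text \<open>At the level \<open>n\<close> of the scale of \<open>t - s\<close>, the dyadic floors of
  \<open>s\<close> and \<open>t\<close> coincide or are neighbours. One increment joins them and two
  chains lead to the points, whence the factor \<open>1 + 2 * (q / (1 - q))\<close>; the remaining
  \<open>2 powr a\<close> is the loss in rounding the scale.\<close>

lemma holder_of_dyadic_increments_unit:
  fixes g :: "real \<Rightarrow> real"
  assumes cont: "continuous_on {0..1} g" and a: "a > 0" and K: "K \<ge> 0"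
    and inc: "\<And>n j. j < 2 ^ n \<Longrightarrow> \<bar>g (real (Suc j) / 2 ^ n) - g (real j / 2 ^ n)\<bar> \<le> K * (2 powr - a) ^ n"
    and st: "0 \<le> s" "s < t" "t \<le> 1"
  shows "\<bar>g t - g s\<bar> \<le> (1 + 2 * (2 powr - a / (1 - 2 powr - a))) * 2 powr a * K * (t - s) powr a"
proof -
  define q :: real where "q = 2 powr - a"
  have q: "0 < q" "q < 1" unfolding q_def using a by (auto simp: powr_less_one)
  \<comment> \<open>This choice gives
    \<open>1 / 2 ^ (n + 1) < t - s \<le> 1 / 2 ^ n\<close>.\<close>
  define n where "n = nat \<lfloor>log 2 (1 / (t - s))\<rfloor>"
  have l0: "0 \<le> log 2 (1 / (t - s))" using st by simp
  have n1: "real n \<le> log 2 (1 / (t - s))" "log 2 (1 / (t - s)) < real n + 1"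
    unfolding n_def using l0 by linarith+
  have "2 powr real n \<le> 1 / (t - s)" "1 / (t - s) < 2 powr (real n + 1)"
    using n1 st by (auto simp: le_log_iff log_less_iff)
  then have n2: "2 ^ n * (t - s) \<le> 1" "1 < 2 * 2 ^ n * (t - s)"
    using st by (auto simp: powr_realpow powr_add field_simps)
  define i j where "i = nat \<lfloor>2 ^ n * s\<rfloor>" and "j = nat \<lfloor>2 ^ n * t\<rfloor>"
  have ij: "real i \<le> 2 ^ n * s" "2 ^ n * s < real i + 1" "real j \<le> 2 ^ n * t" "2 ^ n * t < real j + 1"
    unfolding i_def j_def using st by auto
  have "2 ^ n * s \<le> 2 ^ n * t" using st by (intro mult_left_mono) auto
  moreover have "2 ^ n * t - 2 ^ n * s \<le> 1" using n2(1) by (simp add: right_diff_distrib)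
  ultimately have "j = i \<or> j = Suc i" using ij by linarith
  moreover have "j \<le> 2 ^ n"
  proof -
    have "2 ^ n * t \<le> 2 ^ n * (1::real)" using st by (intro mult_left_mono) auto
    then have "real j \<le> 2 ^ n" using ij(3) by linarith
    then show ?thesis by (metis of_nat_le_iff of_nat_numeral of_nat_power)
  qed
  ultimately have mid: "\<bar>g (real j / 2 ^ n) - g (real i / 2 ^ n)\<bar> \<le> K * q ^ n"
    using inc[of i n] K q unfolding q_def by auto
  note inc' = inc[folded q_def]
  have 1: "\<bar>g t - g (real j / 2 ^ n)\<bar> \<le> K * q ^ n * (q / (1 - q))"
    unfolding j_def by (rule dyadic_chaining[OF cont q K inc']) (use st in auto)
  have 2: "\<bar>g s - g (real i / 2 ^ n)\<bar> \<le> K * q ^ n * (q / (1 - q))"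
    unfolding i_def by (rule dyadic_chaining[OF cont q K inc']) (use st in auto)
  have "\<bar>g t - g s\<bar> \<le> K * q ^ n + 2 * (K * q ^ n * (q / (1 - q)))"
    using mid 1 2 by linarith
  also have "\<dots> = (1 + 2 * (q / (1 - q))) * K * q ^ n" by (simp add: algebra_simps)
  also have "\<dots> \<le> (1 + 2 * (q / (1 - q))) * K * (2 powr a * (t - s) powr a)"
  proof (intro mult_left_mono)
    have "(1 / 2 ^ n :: real) = 2 powr (- real n)"
      by (simp add: powr_minus powr_realpow divide_inverse)
    then have "q ^ n = (1 / 2 ^ n) powr a"
      unfolding q_def by (simp only: powr_power powr_powr) (simp add: powr_power mult.commute)
    also have "\<dots> \<le> (2 * (t - s)) powr a"
      using n2(2) a by (intro powr_mono2) (auto simp: field_simps)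
    finally show "q ^ n \<le> 2 powr a * (t - s) powr a" unfolding powr_mult .
  qed (use K q in auto)
  finally show ?thesis unfolding q_def by (simp add: mult_ac)
qed

text \<open>\<open>C\<close> precedes the quantifiers over \<open>f\<close> and \<open>K\<close>,
  because it must serve all blocks and all points of the sphere at once.\<close>

lemma holder_of_dyadic_increments:
  assumes T: "T > 0" and a: "a > 0"
  shows "\<exists>C\<ge>0. \<forall>(f :: real \<Rightarrow> real) K. continuous_on {0..T} f \<longrightarrow> K \<ge> 0 \<longrightarrow>
    (\<forall>n j. j < 2 ^ n \<longrightarrow> \<bar>f (T * (real (Suc j) / 2 ^ n)) - f (T * (real j / 2 ^ n))\<bar> \<le> K * (2 powr - a) ^ n) \<longrightarrow>
    (\<forall>s\<in>{0..T}. \<forall>t\<in>{0..T}. \<bar>f t - f s\<bar> \<le> C * K * \<bar>t - s\<bar> powr a)"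
proof (intro exI conjI allI impI ballI)
  define C0 :: real where "C0 = (1 + 2 * (2 powr - a / (1 - 2 powr - a))) * 2 powr a"
  have "(2::real) powr - a < 1" using a by (simp add: powr_less_one)
  then have C0: "C0 \<ge> 0" unfolding C0_def by simp
  then show "0 \<le> C0 / T powr a" by simp
  fix f :: "real \<Rightarrow> real" and K s t
  assume f: "continuous_on {0..T} f" and K: "K \<ge> 0"
    and inc: "\<forall>n j. j < 2 ^ n \<longrightarrow> \<bar>f (T * (real (Suc j) / 2 ^ n)) - f (T * (real j / 2 ^ n))\<bar> \<le> K * (2 powr - a) ^ n"
    and st: "s \<in> {0..T}" "t \<in> {0..T}"
  define g where "g u = f (T * u)" for u
  have g: "continuous_on {0..1} g" unfolding g_def
    by (rule continuous_on_compose2[OF f]) (use T in \<open>auto intro!: continuous_intros simp: mult_left_le\<close>)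
  have lt: "\<bar>f t - f s\<bar> \<le> C0 / T powr a * K * \<bar>t - s\<bar> powr a" if "s \<in> {0..T}" "t \<in> {0..T}" "s < t" for s t
  proof -
    have "\<bar>g (t / T) - g (s / T)\<bar> \<le> C0 * K * (t / T - s / T) powr a"
      unfolding C0_def
      by (rule holder_of_dyadic_increments_unit[OF g a K]) (use inc that T in \<open>auto simp: g_def divide_strict_right_mono\<close>)
    also have "(t / T - s / T) powr a = \<bar>t - s\<bar> powr a / T powr a"
      using that T by (simp add: diff_divide_distrib[symmetric] powr_divide)
    finally show ?thesis using T unfolding g_def by simp
  qed
  show "\<bar>f t - f s\<bar> \<le> C0 / T powr a * K * \<bar>t - s\<bar> powr a"
  proof (cases s t rule: linorder_cases)
    case less
    then show ?thesis using lt st by blast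
  next
    case greater
    then show ?thesis using lt[OF st(2,1)] by (simp add: abs_minus_commute)
  qed simp
qed

section \<open>Regularity of the dyadic block series\<close>

lemma sum_powr_le:
  fixes u v :: real
  assumes "0 \<le> u" "0 \<le> v" "0 < g"
  shows "u powr g + v powr g \<le> 2 * (u + v) powr g"
  using assms powr_mono2[of g u "u + v"] powr_mono2[of g v "u + v"] by simp

text \<open>The pathwise half of the argument, free of probability: from one path with block bounds
  for every admissible pair of exponents to joint, temporal and spatial regularity.\<close>

lemma space_time_regularity:
  fixes y :: "nat \<Rightarrow> real \<Rightarrow> real^'n \<Rightarrow> real"
  assumes T: "T > 0" and H: "H > 0" "H < 1" and b: "b > 0"
    and poly: "\<And>k t. \<exists>f. poly_deg (2 ^ Suc k) f \<and> (\<forall>x. norm x = 1 \<longrightarrow> y k t x = f x)"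
    and zero: "\<And>k x. norm x = 1 \<Longrightarrow> y k 0 x = 0"
    and hold: "\<And>a \<delta>. 0 < a \<Longrightarrow> a < H \<Longrightarrow> 0 < \<delta> \<Longrightarrow> \<delta> < b \<Longrightarrow>
      \<exists>C\<ge>0. \<forall>k. \<forall>s\<in>{0..T}. \<forall>t\<in>{0..T}. \<forall>x. norm x = 1 \<longrightarrow>
        \<bar>y k t x - y k s x\<bar> \<le> C * 2 powr (- real k * \<delta>) * \<bar>t - s\<bar> powr a"
  defines "F \<equiv> \<lambda>t x. \<Sum>k. y k t x"
  shows "\<And>t x. t \<in> {0..T} \<Longrightarrow> norm x = 1 \<Longrightarrow> (\<lambda>k. y k t x) sums F t x"
    and "continuous_on ({0..T} \<times> sphere 0 1) (\<lambda>(t, x). F t x)"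
    and "space_time_holder_minus T H b F"
proof -
  have b2: "0 < b / 2" "b / 2 < b" and H2: "0 < H / 2" "H / 2 < H" using b H by auto
  have geo: "summable (\<lambda>k. 2 powr (- real k * \<delta>))" if "\<delta> > 0" for \<delta> :: real
  proof -
    have "(2::real) powr (- real k * \<delta>) = (2 powr - \<delta>) ^ k" for k
      by (simp add: powr_power mult.commute)
    moreover have "summable (\<lambda>k. (2 powr - \<delta>) ^ k)"
      using that by (intro summable_geometric) (simp add: powr_less_one)
    ultimately show ?thesis by simp
  qed
  \<comment> \<open>Comparison with time 0, where the blocks vanish, turns the time modulus into a
    sup bound; any time exponent below \<open>H\<close> would do, here \<open>H / 2\<close>.\<close>
  have bd: "\<exists>C\<ge>0. \<forall>k. \<forall>t\<in>{0..T}. \<forall>x. norm x = 1 \<longrightarrow> \<bar>y k t x\<bar> \<le> C * 2 powr (- real k * \<delta>)" if d: "0 < \<delta>" "\<delta> < b" for \<delta>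
  proof -
    obtain C where C: "C \<ge> 0" "\<And>k s t x. s \<in> {0..T} \<Longrightarrow> t \<in> {0..T} \<Longrightarrow> norm x = 1 \<Longrightarrow>
        \<bar>y k t x - y k s x\<bar> \<le> C * 2 powr (- real k * \<delta>) * \<bar>t - s\<bar> powr (H / 2)"
      using hold[OF H2 d] by blast
    have "\<bar>y k t x\<bar> \<le> (C * T powr (H / 2)) * 2 powr (- real k * \<delta>)" if t: "t \<in> {0..T}" and x: "norm x = 1" for k t x
    proof -
      have "\<bar>y k t x\<bar> \<le> C * 2 powr (- real k * \<delta>) * \<bar>t - 0\<bar> powr (H / 2)"
        using C(2)[of 0 t x k] zero[OF x] T t x by simp
      also have "\<dots> \<le> C * 2 powr (- real k * \<delta>) * T powr (H / 2)"
        using t H C(1) by (intro mult_left_mono powr_mono2) auto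
      finally show ?thesis by (simp add: mult_ac)
    qed
    then show ?thesis using C(1) by (intro exI[of _ "C * T powr (H / 2)"]) auto
  qed
  have sums: "(\<lambda>k. y k t x) sums F t x" if t: "t \<in> {0..T}" and x: "norm x = 1" for t x
  proof -
    obtain C where "\<And>k t x. t \<in> {0..T} \<Longrightarrow> norm x = 1 \<Longrightarrow> \<bar>y k t x\<bar> \<le> C * 2 powr (- real k * (b / 2))"
      using bd[OF b2] by blast
    from this[OF t x] have C: "\<bar>y k t x\<bar> \<le> C * 2 powr (- real k * (b / 2))" for k .
    have "summable (\<lambda>k. y k t x)"
      by (rule summable_comparison_test'[of "\<lambda>k. C * 2 powr (- real k * (b / 2))" 0])
        (use C geo[of "b / 2"] b in \<open>auto intro: summable_mult\<close>)
    then show ?thesis unfolding F_def by (rule summable_sums)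
  qed
  then show "\<And>t x. t \<in> {0..T} \<Longrightarrow> norm x = 1 \<Longrightarrow> (\<lambda>k. y k t x) sums F t x" .
  have diff_bound: "\<bar>F t x - F s z\<bar> \<le> (\<Sum>k. c k)"
    if "t \<in> {0..T}" "s \<in> {0..T}" "norm x = 1" "norm z = 1" "summable c"
      "\<And>k. \<bar>y k t x - y k s z\<bar> \<le> c k" for t s x z c
  proof -
    have d: "(\<lambda>k. y k t x - y k s z) sums (F t x - F s z)"
      using that by (intro sums_diff sums)
    have "\<bar>\<Sum>k. y k t x - y k s z\<bar> \<le> (\<Sum>k. c k)"
      using norm_suminf_le[of "\<lambda>k. y k t x - y k s z" c] that by simp
    then show ?thesis using sums_unique[OF d] by simp
  qed
  have time: "\<exists>C\<ge>0. \<forall>s\<in>{0..T}. \<forall>t\<in>{0..T}. \<forall>x. norm x = 1 \<longrightarrow> \<bar>F t x - F s x\<bar> \<le> C * \<bar>t - s\<bar> powr g"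
    if g: "0 < g" "g < H" for g
  proof -
    obtain C where C: "C \<ge> 0" "\<And>k s t x. s \<in> {0..T} \<Longrightarrow> t \<in> {0..T} \<Longrightarrow> norm x = 1 \<Longrightarrow>
        \<bar>y k t x - y k s x\<bar> \<le> C * 2 powr (- real k * (b / 2)) * \<bar>t - s\<bar> powr g"
      using hold[OF g b2] by blast
    have sm: "summable (\<lambda>k. C * 2 powr (- real k * (b / 2)))" by (intro summable_mult geo) (use b in auto)
    have "\<bar>F t x - F s x\<bar> \<le> (\<Sum>k. C * 2 powr (- real k * (b / 2))) * \<bar>t - s\<bar> powr g"
      if "s \<in> {0..T}" "t \<in> {0..T}" "norm x = 1" for s t x
      unfolding suminf_mult2[OF sm]
      by (rule diff_bound) (use that C sm in \<open>auto intro: summable_mult2\<close>)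
    moreover have "(\<Sum>k. C * 2 powr (- real k * (b / 2))) \<ge> 0"
      using sm C(1) by (intro suminf_nonneg) auto
    ultimately show ?thesis by blast
  qed
  have powk: "real (2 ^ Suc k) powr g * (C * 2 powr (- real k * \<delta>)) = C * 2 powr g * 2 powr (- real k * (\<delta> - g))"
    for k g C \<delta>
  proof -
    have "real (2 ^ Suc k) = 2 powr (1 + real k)" by (simp add: powr_add powr_realpow)
    then have "real (2 ^ Suc k) powr g = 2 powr g * 2 powr (real k * g)"
      by (simp only: powr_powr) (simp add: distrib_right powr_add)
    moreover have "2 powr (real k * g) * 2 powr (- real k * \<delta>) = 2 powr (- real k * (\<delta> - g))"
      unfolding powr_add[symmetric] by (simp add: algebra_simps)
    ultimately show ?thesis by (simp add: mult_ac)
  qed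
  have space: "\<exists>C\<ge>0. \<forall>t\<in>{0..T}. \<forall>x z. norm x = 1 \<longrightarrow> norm z = 1 \<longrightarrow> \<bar>F t x - F t z\<bar> \<le> C * geo_dist x z powr g"
    if g: "0 < g" "g < b" "g \<le> 1" for g
  proof -
    \<comment> \<open>A decay rate strictly between \<open>g\<close> and \<open>b\<close>: Bernstein
      costs \<open>2 powr (k * g)\<close>, and the surplus \<open>\<delta> - g\<close> keeps the
      series geometric.\<close>
    define \<delta> where "\<delta> = (g + b) / 2"
    have \<delta>: "g < \<delta>" "\<delta> < b" "0 < \<delta>" unfolding \<delta>_def using g by auto
    obtain C where C: "C \<ge> 0" "\<And>k t x. t \<in> {0..T} \<Longrightarrow> norm x = 1 \<Longrightarrow> \<bar>y k t x\<bar> \<le> C * 2 powr (- real k * \<delta>)"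
      using bd[OF \<delta>(3,2)] by blast
    define c where "c k = 14 * (C * 2 powr g * 2 powr (- real k * (\<delta> - g)))" for k
    have c: "summable c" unfolding c_def by (intro summable_mult geo) (use \<delta> in auto)
    have one: "\<bar>y k t x - y k t z\<bar> \<le> c k * geo_dist x z powr g"
      if t: "t \<in> {0..T}" and xz: "norm x = 1" "norm z = 1" for k t x z
    proof -
      obtain f where f: "poly_deg (2 ^ Suc k) f" "\<And>x. norm x = 1 \<Longrightarrow> y k t x = f x" using poly by blast
      have "\<bar>f x - f z\<bar> \<le> 14 * (C * 2 powr (- real k * \<delta>)) * real (2 ^ Suc k) powr g * geo_dist x z powr g"
      proof (rule poly_deg_sphere_holder[OF f(1) _ _ xz g(1,3)])
        show "\<bar>f x\<bar> \<le> C * 2 powr (- real k * \<delta>)" if "norm x = 1" for x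
          using C(2)[OF t that, of k] f(2)[OF that] by simp
      qed simp
      also have "\<dots> = 14 * (real (2 ^ Suc k) powr g * (C * 2 powr (- real k * \<delta>))) * geo_dist x z powr g"
        by (simp only: mult_ac)
      also have "\<dots> = c k * geo_dist x z powr g" unfolding c_def powk ..
      finally show ?thesis using f(2) xz by simp
    qed
    have "\<bar>F t x - F t z\<bar> \<le> (\<Sum>k. c k) * geo_dist x z powr g"
      if "t \<in> {0..T}" "norm x = 1" "norm z = 1" for t x z
      unfolding suminf_mult2[OF c]
      by (rule diff_bound) (use that one c in \<open>auto intro: summable_mult2\<close>)
    moreover have "0 \<le> c k" for k using C(1) by (simp add: c_def)
    then have "(\<Sum>k. c k) \<ge> 0" by (rule suminf_nonneg[OF c])
    ultimately show ?thesis by blast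
  qed
  have geo0: "geo_dist x z \<ge> 0" if "norm x = 1" "norm z = 1" for x z :: "real^'n"
    unfolding geo_dist_def using Cauchy_Schwarz_ineq2[of x z] that by (intro arccos_lbound) auto
  have joint: "\<exists>C\<ge>0. \<forall>s\<in>{0..T}. \<forall>t\<in>{0..T}. \<forall>x z. norm x = 1 \<longrightarrow> norm z = 1 \<longrightarrow>
      \<bar>F t x - F s z\<bar> \<le> C * (\<bar>t - s\<bar> + geo_dist x z) powr g"
    if g: "0 < g" "g < H" "g < b" "g \<le> 1" for g
  proof -
    obtain C1 where C1: "C1 \<ge> 0" "\<And>s t x. s \<in> {0..T} \<Longrightarrow> t \<in> {0..T} \<Longrightarrow> norm x = 1 \<Longrightarrow> \<bar>F t x - F s x\<bar> \<le> C1 * \<bar>t - s\<bar> powr g"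
      using time[OF g(1,2)] by blast
    obtain C2 where C2: "C2 \<ge> 0" "\<And>t x z. t \<in> {0..T} \<Longrightarrow> norm x = 1 \<Longrightarrow> norm z = 1 \<Longrightarrow> \<bar>F t x - F t z\<bar> \<le> C2 * geo_dist x z powr g"
      using space[OF g(1,3,4)] by blast
    have "\<bar>F t x - F s z\<bar> \<le> (2 * max C1 C2) * (\<bar>t - s\<bar> + geo_dist x z) powr g"
      if "s \<in> {0..T}" "t \<in> {0..T}" "norm x = 1" "norm z = 1" for s t x z
    proof -
      have "\<bar>F t x - F s z\<bar> \<le> C1 * \<bar>t - s\<bar> powr g + C2 * geo_dist x z powr g"
        using C1(2)[OF that(1,2,3)] C2(2)[OF that(1,3,4)] by linarith
      also have "\<dots> \<le> max C1 C2 * \<bar>t - s\<bar> powr g + max C1 C2 * geo_dist x z powr g"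
        by (intro add_mono mult_right_mono) auto
      also have "\<dots> = max C1 C2 * (\<bar>t - s\<bar> powr g + geo_dist x z powr g)" by (simp add: distrib_left)
      also have "\<dots> \<le> max C1 C2 * (2 * (\<bar>t - s\<bar> + geo_dist x z) powr g)"
        using C1(1) g geo0[OF that(3,4)] by (intro mult_left_mono sum_powr_le) auto
      finally show ?thesis by (simp add: mult_ac)
    qed
    moreover have "0 \<le> 2 * max C1 C2" using C1(1) by auto
    ultimately show ?thesis by blast
  qed
  have spat: "sphere_holder g (F t)" if t: "t \<in> {0..T}" and g: "0 < g" "g < b" for t g
  proof -
    define \<delta> where "\<delta> = (g + b) / 2"
    have \<delta>: "g < \<delta>" "\<delta> < b" "0 < \<delta>" unfolding \<delta>_def using g by auto
    obtain C where C: "C \<ge> 0" "\<And>k t x. t \<in> {0..T} \<Longrightarrow> norm x = 1 \<Longrightarrow> \<bar>y k t x\<bar> \<le> C * 2 powr (- real k * \<delta>)"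
      using bd[OF \<delta>(3,2)] by blast
    obtain f where f: "\<And>k. poly_deg (2 ^ Suc k) (f k)" "\<And>k x. norm x = 1 \<Longrightarrow> y k t x = f k x"
      using poly[of _ t] by metis
    show ?thesis
    proof (rule sphere_holder_series[OF g(1), where f = f and N = "\<lambda>k. 2 ^ Suc k" and M = "\<lambda>k. C * 2 powr (- real k * \<delta>)"])
      show "summable (\<lambda>k. real (2 ^ Suc k) powr g * (C * 2 powr (- real k * \<delta>)))"
        unfolding powk by (intro summable_mult geo) (use \<delta> in auto)
      show "\<bar>f k x\<bar> \<le> C * 2 powr (- real k * \<delta>)" if "norm x = 1" for k x
        using C(2)[OF t that, of k] f(2)[OF that, of k] by simp
      show "(\<lambda>k. f k x) sums F t x" if "norm x = 1" for x
        using sums[OF t that] f(2)[OF that] by simp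
    qed (use f in auto)
  qed
  show "space_time_holder_minus T H b F"
    unfolding space_time_holder_minus_def holder_wrt_def sphere_holder_minus_def
  proof (intro conjI allI impI ballI)
    fix g assume g: "0 < g \<and> g < min H b"
    then have g': "0 < g" "g < H" "g < b" "g \<le> 1" using H by auto
    obtain C where "\<And>s t x z. s \<in> {0..T} \<Longrightarrow> t \<in> {0..T} \<Longrightarrow> norm x = 1 \<Longrightarrow> norm z = 1 \<Longrightarrow>
        \<bar>F t x - F s z\<bar> \<le> C * (\<bar>t - s\<bar> + geo_dist x z) powr g"
      using joint[OF g'] by blast
    then show "\<exists>C. \<forall>p\<in>{0..T} \<times> sphere 0 1. \<forall>q\<in>{0..T} \<times> sphere 0 1.
        \<bar>(case p of (t, x) \<Rightarrow> F t x) - (case q of (t, x) \<Rightarrow> F t x)\<bar>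
        \<le> C * (case p of (t, x) \<Rightarrow> \<lambda>(s, y). \<bar>t - s\<bar> + geo_dist x y) q powr g"
      by (intro exI[of _ C]) auto
  next
    fix x :: "real^'n" and g assume x: "x \<in> sphere 0 1" and g: "0 < g \<and> g < H"
    then show "\<exists>C. \<forall>t\<in>{0..T}. \<forall>s\<in>{0..T}. \<bar>F t x - F s x\<bar> \<le> C * \<bar>t - s\<bar> powr g"
      using time[of g] by auto
  next
    fix t g assume "t \<in> {0..T}" "0 < g \<and> g < b"
    then show "sphere_holder g (F t)" using spat by blast
  qed
  show "continuous_on ({0..T} \<times> sphere 0 1) (\<lambda>(t, x). F t x)"
    unfolding continuous_on_def
  proof
    define g where "g = min H b / 2"
    have g: "0 < g" "g < H" "g < b" "g \<le> 1" unfolding g_def using H b by auto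
    obtain C where C: "\<And>s t x z. s \<in> {0..T} \<Longrightarrow> t \<in> {0..T} \<Longrightarrow> norm x = 1 \<Longrightarrow> norm z = 1 \<Longrightarrow>
        \<bar>F t x - F s z\<bar> \<le> C * (\<bar>t - s\<bar> + geo_dist x z) powr g"
      using joint[OF g] by blast
    fix p :: "real \<times> (real^'n)" assume "p \<in> {0..T} \<times> sphere 0 1"
    then obtain s z where p: "p = (s, z)" and s: "s \<in> {0..T}" and z: "norm z = 1" by auto
    define D :: "(real \<times> (real^'n)) set" where "D = {0..T} \<times> sphere 0 1"
    \<comment> \<open>The joint Hoelder bound gives continuity once the distance to \<open>p\<close>
      tends to 0. As \<open>arccos\<close> is continuous on [-1, 1], the Cauchy-Schwarz bound
      \<open>Dq\<close> is what makes \<open>d\<close> continuous on \<open>D\<close>.\<close>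
    define d where "d q = \<bar>fst q - s\<bar> + arccos (snd q \<bullet> z)" for q :: "real \<times> (real^'n)"
    have zz: "z \<bullet> z = 1" using z by (simp add: norm_eq_1)
    have Dq: "snd q \<bullet> z \<in> {-1..1}" if "q \<in> D" for q
      using Cauchy_Schwarz_ineq2[of "snd q" z] z that unfolding D_def by (auto simp: abs_le_iff)
    have "continuous_on D d" unfolding d_def
      by (intro continuous_intros continuous_on_compose2[OF continuous_on_arccos']) (use Dq in auto)
    moreover have "p \<in> D" "d p = 0" unfolding D_def d_def p using s z zz by auto
    ultimately have "(d \<longlongrightarrow> 0) (at p within D)" unfolding continuous_on_def by metis
    moreover have "\<forall>\<^sub>F q in at p within D. d q \<ge> 0"
      unfolding eventually_at_filter d_def using Dq
      by (intro always_eventually) (auto intro!: add_nonneg_nonneg arccos_lbound)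
    ultimately have "((\<lambda>q. d q powr g) \<longlongrightarrow> 0 powr g) (at p within D)"
      using g by (intro tendsto_powr') auto
    then have "((\<lambda>q. C * d q powr g) \<longlongrightarrow> 0) (at p within D)"
      using tendsto_mult_right_zero by simp
    then have "((\<lambda>q. (case q of (t, x) \<Rightarrow> F t x) - F s z) \<longlongrightarrow> 0) (at p within D)"
    proof (rule Lim_null_comparison[rotated])
      show "\<forall>\<^sub>F q in at p within D. norm ((case q of (t, x) \<Rightarrow> F t x) - F s z) \<le> C * d q powr g"
        unfolding eventually_at_filter d_def D_def using C[OF s _ _ z]
        by (intro always_eventually) (auto simp: geo_dist_def)
    qed
    then show "((\<lambda>(t, x). F t x) \<longlongrightarrow> (case p of (t, x) \<Rightarrow> F t x)) (at p within {0..T} \<times> sphere 0 1)"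
      unfolding p D_def[symmetric] by (simp add: LIM_zero_iff)
  qed
qed

section \<open>The isotropic fractional Brownian motion\<close>

text \<open>The double series of the integrals is finite, so the double series of the nonnegative
  functions is finite almost surely, and its value bounds every term.\<close>

lemma AE_bounded_of_geometric_integrals:
  fixes f :: "nat \<Rightarrow> nat \<Rightarrow> 'a \<Rightarrow> ennreal"
  assumes meas[measurable]: "\<And>k n. f k n \<in> borel_measurable M"
    and bd: "\<And>k n. (\<integral>\<^sup>+\<omega>. f k n \<omega> \<partial>M) \<le> ennreal (C * r1 ^ k * r2 ^ n)"
    and C: "C \<ge> 0" and r: "0 \<le> r1" "r1 < 1" "0 \<le> r2" "r2 < 1"
  shows "AE \<omega> in M. \<exists>Z\<ge>0. \<forall>k n. f k n \<omega> \<le> ennreal Z"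
proof -
  define V where "V \<omega> = (\<Sum>k. \<Sum>n. f k n \<omega>)" for \<omega>
  have [measurable]: "V \<in> borel_measurable M" unfolding V_def by measurable
  have g2: "(\<lambda>n. C * r1 ^ k * r2 ^ n) sums (C * r1 ^ k * (1 / (1 - r2)))" for k
    using r by (intro sums_mult geometric_sums) auto
  have g1: "(\<lambda>k. C * (1 / (1 - r2)) * r1 ^ k) sums (C * (1 / (1 - r2)) * (1 / (1 - r1)))"
    using r by (intro sums_mult geometric_sums) auto
  have "(\<integral>\<^sup>+\<omega>. V \<omega> \<partial>M) = (\<Sum>k. \<Sum>n. \<integral>\<^sup>+\<omega>. f k n \<omega> \<partial>M)"
    unfolding V_def by (simp add: nn_integral_suminf)
  also have "\<dots> \<le> (\<Sum>k. \<Sum>n. ennreal (C * r1 ^ k * r2 ^ n))"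
    by (intro suminf_le summableI bd)
  also have "\<dots> = (\<Sum>k. ennreal (C * (1 / (1 - r2)) * r1 ^ k))"
  proof (rule suminf_cong)
    fix k
    have "(\<Sum>n. ennreal (C * r1 ^ k * r2 ^ n)) = ennreal (C * r1 ^ k * (1 / (1 - r2)))"
      by (rule suminf_ennreal_eq[OF _ g2]) (use C r in auto)
    then show "(\<Sum>n. ennreal (C * r1 ^ k * r2 ^ n)) = ennreal (C * (1 / (1 - r2)) * r1 ^ k)"
      by (simp only: mult_ac)
  qed
  also have "\<dots> = ennreal (C * (1 / (1 - r2)) * (1 / (1 - r1)))"
    using C r by (intro suminf_ennreal_eq g1) auto
  finally have "(\<integral>\<^sup>+\<omega>. V \<omega> \<partial>M) \<noteq> \<infinity>" by (auto simp: top_unique)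
  then have "AE \<omega> in M. V \<omega> \<noteq> \<infinity>" by (intro nn_integral_noteq_infinite) auto
  then show ?thesis
  proof eventually_elim
    case (elim \<omega>)
    then obtain Z where Z: "Z \<ge> 0" "V \<omega> = ennreal Z" by (cases "V \<omega>") auto
    have "f k n \<omega> \<le> ennreal Z" for k n
    proof -
      have "f k n \<omega> \<le> (\<Sum>n. f k n \<omega>)" using sum_le_suminf[OF summableI, of "{n}" "\<lambda>n. f k n \<omega>"] by simp
      also have "\<dots> \<le> V \<omega>" unfolding V_def
        using sum_le_suminf[OF summableI, of "{k}" "\<lambda>k. \<Sum>n. f k n \<omega>"] by simp
      finally show ?thesis unfolding Z .
    qed
    with Z show ?case by blast
  qed
qed

text \<open>A crude bound that avoids roots; only finiteness of the random constant matters.\<close>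

lemma abs_le_of_even_power_le:
  fixes u Z :: real
  assumes "u ^ (2 * p) \<le> Z" "p \<ge> 1" "Z \<ge> 0"
  shows "\<bar>u\<bar> \<le> 1 + Z"
proof (cases "\<bar>u\<bar> \<le> 1")
  case False
  then have "\<bar>u\<bar> ^ 1 \<le> \<bar>u\<bar> ^ (2 * p)" using assms by (intro power_increasing) auto
  also have "\<dots> = u ^ (2 * p)" by (simp add: power_even_abs)
  finally show ?thesis using assms by simp
qed (use assms in linarith)

locale isotropic_qfbm = prob_space M for M :: "'a measure" +
  fixes H T \<eta> :: real and A :: "nat \<Rightarrow> real"
    and \<beta> :: "nat \<times> nat \<Rightarrow> real \<Rightarrow> 'a \<Rightarrow> real"
    and S :: "nat \<Rightarrow> nat \<Rightarrow> real^'n \<Rightarrow> real"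
  assumes card_ge: "CARD('n) \<ge> 3"
    and H: "0 < H" "H < 1" and T: "0 < T"
    and A: "\<And>l. 0 \<le> A l"
    and \<eta>: "0 < \<eta>"
    and A_summable: "summable (\<lambda>l. A l * real l powr (real CARD('n) - 2 + \<eta>))"
    and S: "spherical_harmonics S"
    and fbm: "\<And>l m. 1 \<le> m \<Longrightarrow> m \<le> harm_dim l CARD('n) \<Longrightarrow> fbm M H (\<beta> (l, m))"
    and indep: "indep_vars (\<lambda>_. PiM {0..} (\<lambda>_. borel)) (\<lambda>i \<omega>. restrict (\<lambda>t. \<beta> i t \<omega>) {0..})
           {(l, m). 1 \<le> m \<and> m \<le> harm_dim l CARD('n)}"
begin

definition X :: "nat \<Rightarrow> real \<Rightarrow> real^'n \<Rightarrow> 'a \<Rightarrow> real" where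
  "X l t x \<omega> = (\<Sum>m=1..harm_dim l CARD('n). sqrt (A l) * \<beta> (l, m) t \<omega> * S l m x)"

text \<open>Arbitrary sets of degrees, so that full blocks, incomplete blocks and initial segments
  share the same estimates.\<close>

definition W :: "nat set \<Rightarrow> real \<Rightarrow> real^'n \<Rightarrow> 'a \<Rightarrow> real" where
  "W L t x \<omega> = (\<Sum>l\<in>L. X l t x \<omega>)"

text \<open>The shift by one places degree 0 in block 0.\<close>

definition block :: "nat \<Rightarrow> nat set" where
  "block k = {2 ^ k - 1..<2 ^ Suc k - 1}"

lemma beta_measurable: "1 \<le> m \<Longrightarrow> m \<le> harm_dim l CARD('n) \<Longrightarrow> 0 \<le> t \<Longrightarrow> \<beta> (l, m) t \<in> borel_measurable M"
  using fbm[of m l] unfolding fbm_def by blast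

lemma W_measurable: "0 \<le> t \<Longrightarrow> W L t x \<in> borel_measurable M"
  unfolding W_def[abs_def] X_def
  by (intro borel_measurable_sum borel_measurable_times borel_measurable_const beta_measurable) auto

lemma W_poly:
  assumes "\<And>l. l \<in> L \<Longrightarrow> l \<le> N"
  shows "\<exists>f. poly_deg N f \<and> (\<forall>x. norm x = 1 \<longrightarrow> W L t x \<omega> = f x)"
proof -
  obtain p where p: "\<And>l m. 1 \<le> m \<Longrightarrow> m \<le> harm_dim l CARD('n) \<Longrightarrow> harmonic_poly l (p l m :: real^'n \<Rightarrow> real)"
    and Sp: "\<And>l m x. 1 \<le> m \<Longrightarrow> m \<le> harm_dim l CARD('n) \<Longrightarrow> norm x = 1 \<Longrightarrow> S l m x = p l m x"
    using spherical_harmonics_poly[OF S] by blast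
  have d: "poly_deg N (p l m)" if "l \<in> L" "1 \<le> m" "m \<le> harm_dim l CARD('n)" for l m
    using p[OF that(2,3)] hom_poly_imp_poly_deg poly_deg_mono assms[OF that(1)] unfolding harmonic_poly_def by blast
  show ?thesis
  proof (intro exI[of _ "\<lambda>x. \<Sum>l\<in>L. \<Sum>m=1..harm_dim l CARD('n). (sqrt (A l) * \<beta> (l, m) t \<omega>) * p l m x"] conjI allI impI)
    show "poly_deg N (\<lambda>x. \<Sum>l\<in>L. \<Sum>m=1..harm_dim l CARD('n). (sqrt (A l) * \<beta> (l, m) t \<omega>) * p l m x)"
      by (intro poly_deg_sum poly_deg_cmult d) auto
    show "W L t x \<omega> = (\<Sum>l\<in>L. \<Sum>m=1..harm_dim l CARD('n). (sqrt (A l) * \<beta> (l, m) t \<omega>) * p l m x)" if "norm x = 1" for x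
      unfolding W_def X_def using that by (intro sum.cong) (auto simp: Sp)
  qed
qed

section \<open>Variances and moments of finite sums of degrees\<close>

definition B :: real where
  "B = (\<Sum>l. A l * (real l + 1) powr (real CARD('n) - 2 + \<eta>))"

definition C0 :: real where
  "C0 = 2 / sphere_integral (\<lambda>x :: real^'n. 1)"

text \<open>The assumed weight is 0 at \<open>l = 0\<close>, whereas \<open>B\<close> uses the
  weight 1 there; the comparison \<open>(l + 1) powr e \<le> 2 powr e * l powr e\<close> therefore
  starts at \<open>l = 1\<close>.\<close>

lemma B_summable: "summable (\<lambda>l. A l * (real l + 1) powr (real CARD('n) - 2 + \<eta>))"
proof -
  define e where "e = real CARD('n) - 2 + \<eta>"
  have e: "e > 0" unfolding e_def using card_ge \<eta> by linarith
  show ?thesis unfolding e_def[symmetric]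
  proof (rule summable_comparison_test'[of "\<lambda>l. 2 powr e * (A l * real l powr e)" 1])
    show "summable (\<lambda>l. 2 powr e * (A l * real l powr e))"
      using A_summable unfolding e_def by (rule summable_mult)
    fix l :: nat assume l: "l \<ge> 1"
    have "(real l + 1) powr e \<le> (2 * real l) powr e" using l e by (intro powr_mono2) auto
    also have "\<dots> = 2 powr e * real l powr e" by (rule powr_mult)
    finally have "A l * (real l + 1) powr e \<le> A l * (2 powr e * real l powr e)" using A by (intro mult_left_mono) auto
    then show "norm (A l * (real l + 1) powr e) \<le> 2 powr e * (A l * real l powr e)"
      using A[of l] by (simp add: mult_ac)
  qed
qed

lemma B_nonneg: "B \<ge> 0" unfolding B_def using B_summable A by (intro suminf_nonneg) auto

lemma C0_pos: "C0 > 0" unfolding C0_def using sphere_integral_one_pos[where 'n='n] by simp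

text \<open>The kernel bound has order \<open>(l + 1)\<close> to the power
  \<open>CARD('n) - 2\<close>. Of the available weight this leaves
  \<open>(l + 1) powr - \<eta>\<close>, at most \<open>N powr - \<eta>\<close> when all degrees are
  at least \<open>N - 1\<close>.\<close>

lemma variance_bound:
  assumes L: "finite L" "\<And>l. l \<in> L \<Longrightarrow> N \<le> real l + 1" and N: "N > 0" and x: "norm x = 1"
  shows "(\<Sum>l\<in>L. A l * (\<Sum>m=1..harm_dim l CARD('n). (S l m x)\<^sup>2)) \<le> C0 * B * N powr - \<eta>"
proof -
  have "(\<Sum>l\<in>L. A l * (\<Sum>m=1..harm_dim l CARD('n). (S l m x)\<^sup>2))
      \<le> (\<Sum>l\<in>L. C0 * N powr - \<eta> * (A l * (real l + 1) powr (real CARD('n) - 2 + \<eta>)))"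
  proof (rule sum_mono)
    fix l assume l: "l \<in> L"
    have "(\<Sum>m=1..harm_dim l CARD('n). (S l m x)\<^sup>2) \<le> C0 * (real l + 1) ^ (CARD('n) - 2)"
      using spherical_harmonics_pointwise_bound[OF _ S x, of l] card_ge unfolding C0_def by simp
    also have "(real l + 1) ^ (CARD('n) - 2) = (real l + 1) powr (real CARD('n) - 2)"
      using card_ge by (subst powr_realpow[symmetric]) (auto simp: of_nat_diff)
    also have "\<dots> = (real l + 1) powr (real CARD('n) - 2 + \<eta>) * (real l + 1) powr - \<eta>"
      unfolding powr_add[symmetric] by simp
    also have "C0 * \<dots> \<le> C0 * ((real l + 1) powr (real CARD('n) - 2 + \<eta>) * N powr - \<eta>)"
      using C0_pos L(2)[OF l] N \<eta> by (intro mult_left_mono powr_mono2') auto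
    finally have "A l * (\<Sum>m=1..harm_dim l CARD('n). (S l m x)\<^sup>2)
        \<le> A l * (C0 * ((real l + 1) powr (real CARD('n) - 2 + \<eta>) * N powr - \<eta>))"
      using A by (intro mult_left_mono) auto
    then show "A l * (\<Sum>m=1..harm_dim l CARD('n). (S l m x)\<^sup>2)
        \<le> C0 * N powr - \<eta> * (A l * (real l + 1) powr (real CARD('n) - 2 + \<eta>))"
      by (simp only: mult_ac)
  qed
  also have "\<dots> = C0 * N powr - \<eta> * (\<Sum>l\<in>L. A l * (real l + 1) powr (real CARD('n) - 2 + \<eta>))"
    by (simp add: sum_distrib_left)
  also have "\<dots> \<le> C0 * N powr - \<eta> * B"
    unfolding B_def using C0_pos A L by (intro mult_left_mono sum_le_suminf B_summable) auto
  finally show ?thesis by (simp only: mult_ac)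
qed

lemma W_moment:
  assumes L: "finite L" "\<And>l. l \<in> L \<Longrightarrow> N \<le> real l + 1" and N: "N > 0" and x: "norm x = 1"
    and st: "0 \<le> s" "0 \<le> t" and p: "p \<ge> 1"
  shows "(\<integral>\<^sup>+\<omega>. ennreal ((W L t x \<omega> - W L s x \<omega>) ^ (2 * p)) \<partial>M)
    \<le> ennreal (gauss_moment p * (C0 * B) ^ p * N powr (- \<eta> * real p) * \<bar>t - s\<bar> powr (2 * real p * H))"
proof -
  define J where "J = (SIGMA l:L. {1..harm_dim l CARD('n)})"
  define c where "c i = sqrt (A (fst i)) * S (fst i) (snd i) x" for i
  have J: "finite J" "J \<subseteq> {(l, m). 1 \<le> m \<and> m \<le> harm_dim l CARD('n)}" unfolding J_def using L by auto
  have W: "W L t x \<omega> - W L s x \<omega> = (\<Sum>i\<in>J. c i * (\<beta> i t \<omega> - \<beta> i s \<omega>))" for \<omega>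
  proof -
    have "(\<Sum>i\<in>J. c i * (\<beta> i t \<omega> - \<beta> i s \<omega>)) =
       (\<Sum>l\<in>L. \<Sum>m=1..harm_dim l CARD('n). c (l, m) * (\<beta> (l, m) t \<omega> - \<beta> (l, m) s \<omega>))"
      unfolding J_def using L by (subst sum.Sigma) (auto simp: case_prod_unfold)
    then show ?thesis unfolding W_def X_def c_def
      by (simp add: sum_subtractf[symmetric] algebra_simps)
  qed
  have c2: "(\<Sum>i\<in>J. (c i)\<^sup>2) = (\<Sum>l\<in>L. A l * (\<Sum>m=1..harm_dim l CARD('n). (S l m x)\<^sup>2))"
  proof -
    have "(\<Sum>i\<in>J. (c i)\<^sup>2) = (\<Sum>l\<in>L. \<Sum>m=1..harm_dim l CARD('n). (c (l, m))\<^sup>2)"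
      unfolding J_def using L by (subst sum.Sigma) (auto simp: case_prod_unfold)
    then show ?thesis unfolding c_def using A by (simp add: power_mult_distrib sum_distrib_left)
  qed
  have "(\<integral>\<^sup>+\<omega>. ennreal ((W L t x \<omega> - W L s x \<omega>) ^ (2 * p)) \<partial>M) =
      ennreal (gauss_moment p * (\<Sum>i\<in>J. (c i)\<^sup>2) ^ p * \<bar>t - s\<bar> powr (2 * real p * H))"
    unfolding W by (rule fbm_sum_moment[OF H(1) _ indep J st p]) (auto intro: fbm)
  also have "\<dots> \<le> ennreal (gauss_moment p * (C0 * B * N powr - \<eta>) ^ p * \<bar>t - s\<bar> powr (2 * real p * H))"
    unfolding c2 using variance_bound[OF L N x] A
    by (intro ennreal_leI mult_right_mono mult_left_mono power_mono sum_nonneg mult_nonneg_nonneg)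
      (auto simp: gauss_moment_def sum_nonneg)
  also have "(C0 * B * N powr - \<eta>) ^ p = (C0 * B) ^ p * N powr (- \<eta> * real p)"
    using N by (simp add: power_mult_distrib powr_power mult.commute)
  finally show ?thesis by (simp only: mult.assoc)
qed

lemma AE_beta_zero_continuous:
  "AE \<omega> in M. \<forall>l. \<forall>m\<in>{1..harm_dim l CARD('n)}. \<beta> (l, m) 0 \<omega> = 0 \<and> continuous_on {0..} (\<lambda>t. \<beta> (l, m) t \<omega>)"
proof -
  have "AE \<omega> in M. \<beta> (l, m) 0 \<omega> = 0 \<and> continuous_on {0..} (\<lambda>t. \<beta> (l, m) t \<omega>)"
    if m: "1 \<le> m" "m \<le> harm_dim l CARD('n)" for l m
  proof -
    have f: "fbm M H (\<beta> (l, m))" using fbm[OF m] .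
    have [measurable]: "\<beta> (l, m) 0 \<in> borel_measurable M" using beta_measurable[OF m] by simp
    have "centered_gaussian_rv M (\<lambda>\<omega>. \<Sum>t\<in>{0}. 1 * \<beta> (l, m) t \<omega>)"
      using f unfolding fbm_def by (elim conjE allE[of _ "{0}"] allE[of _ "\<lambda>_. 1"]) auto
    then have int: "integrable M (\<lambda>\<omega>. (\<beta> (l, m) 0 \<omega>)\<^sup>2)"
      using centered_gaussian_rv_second_moment by simp
    have "expectation (\<lambda>\<omega>. \<beta> (l, m) 0 \<omega> * \<beta> (l, m) 0 \<omega>) = (0 powr (2*H) + 0 powr (2*H) - \<bar>0 - 0\<bar> powr (2*H)) / 2"
      using f unfolding fbm_def by blast
    then have "expectation (\<lambda>\<omega>. (\<beta> (l, m) 0 \<omega>)\<^sup>2) = 0" by (simp add: power2_eq_square)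
    then have "AE \<omega> in M. (\<beta> (l, m) 0 \<omega>)\<^sup>2 = 0"
      using integral_nonneg_eq_0_iff_AE[OF int] by simp
    moreover have "AE \<omega> in M. continuous_on {0..} (\<lambda>t. \<beta> (l, m) t \<omega>)" using f unfolding fbm_def by blast
    ultimately show ?thesis by eventually_elim simp
  qed
  then have "AE \<omega> in M. \<forall>m\<in>{1..harm_dim l CARD('n)}. \<beta> (l, m) 0 \<omega> = 0 \<and> continuous_on {0..} (\<lambda>t. \<beta> (l, m) t \<omega>)" for l
    by (intro AE_ball_countable' countable_finite) auto
  then show ?thesis unfolding AE_all_countable by blast
qed

text \<open>One null set serves all \<open>L\<close> and \<open>x\<close>, because only the
  countably many processes \<open>\<beta> (l, m)\<close> are involved.\<close>

lemma AE_W_zero_continuous: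
  "AE \<omega> in M. \<forall>L x. finite L \<longrightarrow> W L 0 x \<omega> = 0 \<and> continuous_on {0..} (\<lambda>t. W L t x \<omega>)"
  using AE_beta_zero_continuous
proof eventually_elim
  case (elim \<omega>)
  then show ?case unfolding W_def X_def by (auto intro!: continuous_intros)
qed

section \<open>Almost sure bounds uniform over blocks and the sphere\<close>

lemma finite_block [simp]: "finite (block k)"
  unfolding block_def by simp

lemma block_bounds:
  assumes "l \<in> block k"
  shows "l \<le> 2 ^ Suc k" "2 ^ k \<le> real l + 1"
proof -
  show "l \<le> 2 ^ Suc k" using assms unfolding block_def by auto
  have "2 ^ k \<le> l + 1" using assms unfolding block_def by auto
  then have "real (2 ^ k) \<le> real (l + 1)" by (rule of_nat_mono)
  then show "2 ^ k \<le> real l + 1" by simp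
qed

text \<open>A union bound over block, level, dyadic interval and net point, made summable by a
  moment of high order; a polynomial in a block is then controlled on the whole sphere by its values
  on the net.\<close>

lemma AE_dyadic_increments:
  assumes a: "0 < a" "a < H" and \<delta>: "0 < \<delta>" "\<delta> < \<eta> / 2"
  shows "AE \<omega> in M. \<exists>Z\<ge>0. \<forall>k n j x. j < 2 ^ n \<longrightarrow> norm x = 1 \<longrightarrow>
     \<bar>W (block k) (T * (real (Suc j) / 2 ^ n)) x \<omega> - W (block k) (T * (real j / 2 ^ n)) x \<omega>\<bar>
       \<le> Z * 2 powr (- real k * \<delta>) * (2 powr - a) ^ n"
proof -
  define d where "d = CARD('n)"
  \<comment> \<open>The first threshold pays for the \<open>2 ^ n\<close> increments of level
    \<open>n\<close>, the second for the net, whose size grows like \<open>2 ^ (k * d)\<close>; they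
    yield \<open>r2 < 1\<close> and \<open>r1 < 1\<close> below.\<close>
  obtain p :: nat where p: "max (1 / (H - a)) (real d / (\<eta> / 2 - \<delta>)) < real p"
    using reals_Archimedean2 by blast
  have p1: "1 < real p * (H - a)" "real d < real p * (\<eta> / 2 - \<delta>)"
    using p a \<delta> by (auto simp: pos_divide_less_eq)
  have "0 < real p" using p a by (smt (verit) divide_pos_pos max.cobounded1)
  then have p2: "p \<ge> 1" by simp
  define N where "N k = (2::nat) ^ Suc k" for k
  define net where "net k Z \<longleftrightarrow> finite Z \<and> Z \<subseteq> sphere 0 1 \<and> real (card Z) \<le> (84 * real d * real (N k)) ^ d \<and>
    (\<forall>f B x. poly_deg (N k) f \<longrightarrow> (\<forall>z\<in>Z. \<bar>f z\<bar> \<le> B) \<longrightarrow> norm x = 1 \<longrightarrow> \<bar>f x\<bar> \<le> 2 * B)" for k and Z :: "(real^'n) set"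
  have "\<forall>k. \<exists>Z. net k Z"
  proof
    fix k
    have "N k \<ge> 1" unfolding N_def by simp
    then obtain Z :: "(real^'n) set" where "finite Z" "Z \<subseteq> sphere 0 1"
      "real (card Z) \<le> (84 * real CARD('n) * real (N k)) ^ CARD('n)"
      "\<And>f B x. poly_deg (N k) f \<Longrightarrow> (\<And>z. z \<in> Z \<Longrightarrow> \<bar>f z\<bar> \<le> B) \<Longrightarrow> norm x = 1 \<Longrightarrow> \<bar>f x\<bar> \<le> 2 * B"
      by (rule sphere_net[where 'n='n]) blast
    then have "net k Z" unfolding net_def d_def by simp
    then show "\<exists>Z. net k Z" by blast
  qed
  from choice[OF this] obtain Z where netZ: "net k (Z k)" for k by blast
  have Z: "finite (Z k)" "Z k \<subseteq> sphere 0 1" "real (card (Z k)) \<le> (84 * real d * real (N k)) ^ d" for k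
    using netZ[of k] unfolding net_def by auto
  have Zn: "norm z = 1" if "z \<in> Z k" for z k using Z(2)[of k] that by auto
  have Z_sup: "\<bar>f x\<bar> \<le> 2 * B" if "poly_deg (N k) f" "\<And>z. z \<in> Z k \<Longrightarrow> \<bar>f z\<bar> \<le> B" "norm x = 1" for k f B x
    using netZ[of k] that unfolding net_def by blast
  \<comment> \<open>The reciprocal of the claimed size of an increment, so the claim reads
    \<open>w * \<bar>\<Delta>\<bar>\<close> bounded.\<close>
  define w where "w k n = 2 powr (real k * \<delta>) * 2 powr (real n * a)" for k n
  have w: "w k n > 0" for k n unfolding w_def by simp
  define \<Delta> where "\<Delta> k n j x \<omega> = W (block k) (T * (real (Suc j) / 2 ^ n)) x \<omega> - W (block k) (T * (real j / 2 ^ n)) x \<omega>"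
    for k n j x \<omega>
  have [measurable]: "\<Delta> k n j x \<in> borel_measurable M" for k n j x
    unfolding \<Delta>_def using T by (intro borel_measurable_diff W_measurable) auto
  define f where "f k n \<omega> = (\<Sum>j<2 ^ n. \<Sum>z\<in>Z k. ennreal ((w k n * \<Delta> k n j z \<omega>) ^ (2 * p)))" for k n \<omega>
  define G where "G = gauss_moment p * (C0 * B) ^ p"
  have G: "G \<ge> 0" unfolding G_def gauss_moment_def using C0_pos B_nonneg by simp
  define r1 :: real where "r1 = 2 powr (real d + 2 * real p * \<delta> - \<eta> * real p)"
  define r2 :: real where "r2 = 2 powr (1 + 2 * real p * a - 2 * real p * H)"
  define q where "q k n = w k n ^ (2 * p) * (G * (2 ^ k) powr (- \<eta> * real p) * (T / 2 ^ n) powr (2 * real p * H))" for k n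
  have q0: "q k n \<ge> 0" for k n unfolding q_def using G w[of k n] by simp
  have int1: "(\<integral>\<^sup>+\<omega>. ennreal ((w k n * \<Delta> k n j z \<omega>) ^ (2 * p)) \<partial>M) \<le> ennreal (q k n)" if z: "norm z = 1" for k n j z
  proof -
    have "(\<integral>\<^sup>+\<omega>. ennreal ((w k n * \<Delta> k n j z \<omega>) ^ (2 * p)) \<partial>M) =
        (\<integral>\<^sup>+\<omega>. ennreal (w k n ^ (2 * p)) * ennreal (\<Delta> k n j z \<omega> ^ (2 * p)) \<partial>M)"
      using w[of k n] by (simp add: power_mult_distrib ennreal_mult zero_le_even_power)
    also have "\<dots> = ennreal (w k n ^ (2 * p)) * (\<integral>\<^sup>+\<omega>. ennreal (\<Delta> k n j z \<omega> ^ (2 * p)) \<partial>M)"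
      by (intro nn_integral_cmult) measurable
    also have "\<dots> \<le> ennreal (w k n ^ (2 * p)) * ennreal (G * (2 ^ k) powr (- \<eta> * real p) * (T / 2 ^ n) powr (2 * real p * H))"
    proof (rule mult_left_mono)
      have "\<bar>T * (real (Suc j) / 2 ^ n) - T * (real j / 2 ^ n)\<bar> = T / 2 ^ n"
        using T by (simp add: field_simps)
      then show "(\<integral>\<^sup>+\<omega>. ennreal (\<Delta> k n j z \<omega> ^ (2 * p)) \<partial>M) \<le>
          ennreal (G * (2 ^ k) powr (- \<eta> * real p) * (T / 2 ^ n) powr (2 * real p * H))"
        unfolding \<Delta>_def G_def
        using W_moment[of "block k" "2 ^ k" z "T * (real j / 2 ^ n)" "T * (real (Suc j) / 2 ^ n)" p] block_bounds(2) z T p2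
        by simp
    qed simp
    also have "\<dots> = ennreal (q k n)" unfolding q_def using w[of k n] by (intro ennreal_mult'[symmetric]) simp
    finally show ?thesis .
  qed
  have count: "2 ^ n * (real (card (Z k)) * q k n) \<le> G * T powr (2 * real p * H) * (168 * real d) ^ d * r1 ^ k * r2 ^ n" for k n
  proof -
    have q_eq: "q k n = G * T powr (2 * real p * H) * (2 powr (real k * \<delta> * (2 * real p)) * 2 powr (real n * a * (2 * real p)) *
        2 powr (real k * (- \<eta> * real p)) * 2 powr (- real n * (2 * real p * H)))"
    proof -
      have "w k n ^ (2 * p) = 2 powr (real k * \<delta> * (2 * real p)) * 2 powr (real n * a * (2 * real p))"
        unfolding w_def power_mult_distrib by (simp add: powr_power mult_ac)
      moreover have "(2 ^ k) powr (- \<eta> * real p) = (2::real) powr (real k * (- \<eta> * real p))"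
        by (simp add: powr_realpow[symmetric] powr_powr)
      moreover have "(T / 2 ^ n) powr (2 * real p * H) = T powr (2 * real p * H) * 2 powr (- real n * (2 * real p * H))"
      proof -
        have "T / 2 ^ n = T * 2 powr (- real n)" by (simp add: powr_minus powr_realpow divide_inverse)
        then show ?thesis by (simp only: powr_mult powr_powr)
      qed
      ultimately show ?thesis unfolding q_def by (simp only: mult_ac)
    qed
    \<comment> \<open>The net constant 84 doubles to 168 because the degree bound of block
      \<open>k\<close> is \<open>2 ^ Suc k\<close>.\<close>
    have "(84 * real d * real (N k)) ^ d = (168 * real d) ^ d * 2 powr (real k * real d)"
      unfolding N_def by (simp add: power_mult_distrib powr_realpow[symmetric] powr_power) (simp add: powr_realpow powr_powr[symmetric])
    then have "real (card (Z k)) \<le> (168 * real d) ^ d * 2 powr (real k * real d)" using Z(3)[of k] by simp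
    then have "2 ^ n * (real (card (Z k)) * q k n) \<le> 2 powr real n * (((168 * real d) ^ d * 2 powr (real k * real d)) * q k n)"
      unfolding powr_realpow[OF zero_less_numeral] using q0[of k n] by (intro mult_left_mono mult_right_mono) auto
    also have "\<dots> =
      G * T powr (2 * real p * H) * (168 * real d) ^ d *
        (2 powr (real k * real d) * 2 powr (real k * \<delta> * (2 * real p)) * 2 powr (real k * (- \<eta> * real p))) *
        (2 powr real n * 2 powr (real n * a * (2 * real p)) * 2 powr (- real n * (2 * real p * H)))"
      unfolding q_eq by (simp only: mult_ac)
    also have "2 powr (real k * real d) * 2 powr (real k * \<delta> * (2 * real p)) * 2 powr (real k * (- \<eta> * real p)) = r1 ^ k"
      unfolding r1_def by (simp add: powr_power powr_add[symmetric]) (simp add: algebra_simps)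
    also have "2 powr real n * 2 powr (real n * a * (2 * real p)) * 2 powr (- real n * (2 * real p * H)) = r2 ^ n"
      unfolding r2_def by (simp add: powr_power powr_add[symmetric]) (simp add: algebra_simps)
    finally show ?thesis .
  qed
  have int: "(\<integral>\<^sup>+\<omega>. f k n \<omega> \<partial>M) \<le> ennreal (G * T powr (2 * real p * H) * (168 * real d) ^ d * r1 ^ k * r2 ^ n)" for k n
  proof -
    have "(\<integral>\<^sup>+\<omega>. f k n \<omega> \<partial>M) = (\<Sum>j<2 ^ n. \<Sum>z\<in>Z k. \<integral>\<^sup>+\<omega>. ennreal ((w k n * \<Delta> k n j z \<omega>) ^ (2 * p)) \<partial>M)"
      unfolding f_def by (simp add: nn_integral_sum del: sum_ennreal)
    also have "\<dots> \<le> (\<Sum>j<(2::nat) ^ n. \<Sum>z\<in>Z k. ennreal (q k n))"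
      by (intro sum_mono int1 Zn)
    also have "\<dots> = ennreal (2 ^ n * (real (card (Z k)) * q k n))"
    proof -
      have "ennreal (2 ^ n) = 2 ^ n" by (subst ennreal_power[symmetric]) auto
      then show ?thesis
        using q0[of k n] by (simp add: ennreal_mult ennreal_of_nat_eq_real_of_nat del: sum_ennreal)
    qed
    also have "\<dots> \<le> ennreal (G * T powr (2 * real p * H) * (168 * real d) ^ d * r1 ^ k * r2 ^ n)"
      by (rule ennreal_leI[OF count])
    finally show ?thesis .
  qed
  have "AE \<omega> in M. \<exists>Z\<ge>0. \<forall>k n. f k n \<omega> \<le> ennreal Z"
  proof (rule AE_bounded_of_geometric_integrals[OF _ int])
    show "f k n \<in> borel_measurable M" for k n unfolding f_def by measurable
    show "r1 < 1" unfolding r1_def using p1 by (simp add: powr_less_one algebra_simps)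
    show "r2 < 1" unfolding r2_def using p1 by (simp add: powr_less_one algebra_simps)
  qed (use G in \<open>auto simp: r1_def r2_def\<close>)
  then show ?thesis
  proof eventually_elim
    case (elim \<omega>)
    then obtain K where K: "K \<ge> 0" "\<And>k n. f k n \<omega> \<le> ennreal K" by blast
    have "\<bar>\<Delta> k n j x \<omega>\<bar> \<le> 2 * (1 + K) * 2 powr (- real k * \<delta>) * (2 powr - a) ^ n" if j: "j < 2 ^ n" and x: "norm x = 1" for k n j x
    proof -
      have zb: "\<bar>\<Delta> k n j z \<omega>\<bar> \<le> (1 + K) / w k n" if z: "z \<in> Z k" for z
      proof -
        have "ennreal ((w k n * \<Delta> k n j z \<omega>) ^ (2 * p)) \<le> (\<Sum>z\<in>Z k. ennreal ((w k n * \<Delta> k n j z \<omega>) ^ (2 * p)))"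
          using z Z(1) by (intro member_le_sum) auto
        also have "\<dots> \<le> f k n \<omega>" unfolding f_def
          using j by (intro member_le_sum[of j _ "\<lambda>j. \<Sum>z\<in>Z k. ennreal ((w k n * \<Delta> k n j z \<omega>) ^ (2 * p))"]) auto
        also have "\<dots> \<le> ennreal K" by (rule K)
        finally have "(w k n * \<Delta> k n j z \<omega>) ^ (2 * p) \<le> K" using K(1) by (simp add: ennreal_le_iff)
        then have "\<bar>w k n * \<Delta> k n j z \<omega>\<bar> \<le> 1 + K" using p2 K(1) by (rule abs_le_of_even_power_le)
        then show ?thesis using w[of k n] by (simp add: abs_mult pos_le_divide_eq mult.commute)
      qed
      \<comment> \<open>For fixed \<open>\<omega>\<close> the increment is a polynomial in
        \<open>x\<close>, so the net bound extends to the sphere at the price of a factor 2.\<close>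
      obtain f1 where f1: "poly_deg (N k) f1"
        "\<And>x. norm x = 1 \<Longrightarrow> W (block k) (T * (real (Suc j) / 2 ^ n)) x \<omega> = f1 x"
        using W_poly[of "block k" "N k" "T * (real (Suc j) / 2 ^ n)" \<omega>] block_bounds(1)[of _ k] unfolding N_def by blast
      obtain f2 where f2: "poly_deg (N k) f2"
        "\<And>x. norm x = 1 \<Longrightarrow> W (block k) (T * (real j / 2 ^ n)) x \<omega> = f2 x"
        using W_poly[of "block k" "N k" "T * (real j / 2 ^ n)" \<omega>] block_bounds(1)[of _ k] unfolding N_def by blast
      have \<Delta>f: "\<Delta> k n j x \<omega> = f1 x - f2 x" if "norm x = 1" for x
        unfolding \<Delta>_def using f1(2)[OF that] f2(2)[OF that] by simp
      have "\<bar>f1 x - f2 x\<bar> \<le> 2 * ((1 + K) / w k n)"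
      proof (rule Z_sup[OF poly_deg_diff[OF f1(1) f2(1)] _ x])
        show "\<bar>f1 z - f2 z\<bar> \<le> (1 + K) / w k n" if "z \<in> Z k" for z
          using zb[OF that] \<Delta>f[OF Zn[OF that]] by simp
      qed
      also have "2 * ((1 + K) / w k n) = 2 * (1 + K) * 2 powr (- real k * \<delta>) * (2 powr - a) ^ n"
      proof -
        have "inverse (w k n) = 2 powr (- (real k * \<delta>)) * 2 powr (- (real n * a))"
          unfolding w_def powr_minus by (rule inverse_mult_distrib)
        moreover have "((2::real) powr - a) ^ n = 2 powr (- (real n * a))"
          by (subst powr_power) (auto simp: mult.commute)
        ultimately show ?thesis by (simp add: divide_inverse)
      qed
      finally show ?thesis using \<Delta>f[OF x] by simp
    qed
    then show ?case unfolding \<Delta>_def using K(1) by (intro exI[of _ "2 * (1 + K)"]) auto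
  qed
qed

lemma AE_block_holder:
  assumes a: "0 < a" "a < H" and \<delta>: "0 < \<delta>" "\<delta> < \<eta> / 2"
  shows "AE \<omega> in M. \<exists>C\<ge>0. \<forall>k. \<forall>s\<in>{0..T}. \<forall>t\<in>{0..T}. \<forall>x. norm x = 1 \<longrightarrow>
     \<bar>W (block k) t x \<omega> - W (block k) s x \<omega>\<bar> \<le> C * 2 powr (- real k * \<delta>) * \<bar>t - s\<bar> powr a"
proof -
  obtain C where C: "C \<ge> 0" "\<And>(f :: real \<Rightarrow> real) K s t. continuous_on {0..T} f \<Longrightarrow> K \<ge> 0 \<Longrightarrow>
    (\<And>n j. j < 2 ^ n \<Longrightarrow> \<bar>f (T * (real (Suc j) / 2 ^ n)) - f (T * (real j / 2 ^ n))\<bar> \<le> K * (2 powr - a) ^ n) \<Longrightarrow>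
    s \<in> {0..T} \<Longrightarrow> t \<in> {0..T} \<Longrightarrow> \<bar>f t - f s\<bar> \<le> C * K * \<bar>t - s\<bar> powr a"
    using holder_of_dyadic_increments[OF T a(1)] by blast
  from AE_dyadic_increments[OF a \<delta>] AE_W_zero_continuous show ?thesis
  proof eventually_elim
    case (elim \<omega>)
    then obtain Z where Z: "Z \<ge> 0" "\<And>k n j x. j < 2 ^ n \<Longrightarrow> norm x = 1 \<Longrightarrow>
     \<bar>W (block k) (T * (real (Suc j) / 2 ^ n)) x \<omega> - W (block k) (T * (real j / 2 ^ n)) x \<omega>\<bar>
       \<le> Z * 2 powr (- real k * \<delta>) * (2 powr - a) ^ n" by blast
    have "\<bar>W (block k) t x \<omega> - W (block k) s x \<omega>\<bar> \<le> (C * Z) * 2 powr (- real k * \<delta>) * \<bar>t - s\<bar> powr a"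
      if "s \<in> {0..T}" "t \<in> {0..T}" "norm x = 1" for k s t x
    proof -
      have "continuous_on {0..T} (\<lambda>t. W (block k) t x \<omega>)"
        by (rule continuous_on_subset[of "{0..}"]) (use elim(2) in auto)
      then have "\<bar>W (block k) t x \<omega> - W (block k) s x \<omega>\<bar> \<le> C * (Z * 2 powr (- real k * \<delta>)) * \<bar>t - s\<bar> powr a"
        using Z that by (intro C(2)[of "\<lambda>t. W (block k) t x \<omega>"]) auto
      then show ?thesis by (simp only: mult.assoc)
    qed
    then show ?case using C(1) Z(1) by (intro exI[of _ "C * Z"]) auto
  qed
qed

text \<open>There are uncountably many pairs of exponents but only one null set is allowed:
  exponents scaled by \<open>c i\<close>, tending to 1, form a countable family that dominates all
  pairs.\<close>

lemma AE_block_holder_all: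
  "AE \<omega> in M. \<forall>a \<delta>. 0 < a \<longrightarrow> a < H \<longrightarrow> 0 < \<delta> \<longrightarrow> \<delta> < \<eta> / 2 \<longrightarrow>
    (\<exists>C\<ge>0. \<forall>k. \<forall>s\<in>{0..T}. \<forall>t\<in>{0..T}. \<forall>x. norm x = 1 \<longrightarrow>
     \<bar>W (block k) t x \<omega> - W (block k) s x \<omega>\<bar> \<le> C * 2 powr (- real k * \<delta>) * \<bar>t - s\<bar> powr a)"
proof -
  define c where "c i = 1 - 1 / (real i + 2)" for i :: nat
  have c: "0 < c i" "c i < 1" for i unfolding c_def by auto
  have "AE \<omega> in M. \<forall>i. \<exists>C\<ge>0. \<forall>k. \<forall>s\<in>{0..T}. \<forall>t\<in>{0..T}. \<forall>x. norm x = 1 \<longrightarrow>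
     \<bar>W (block k) t x \<omega> - W (block k) s x \<omega>\<bar> \<le> C * 2 powr (- real k * (\<eta> / 2 * c i)) * \<bar>t - s\<bar> powr (H * c i)"
    unfolding AE_all_countable using c H \<eta> by (intro allI AE_block_holder) auto
  then show ?thesis
  proof eventually_elim
    case (elim \<omega>)
    show ?case
    proof (intro allI impI)
      fix a \<delta> assume a: "0 < a" "a < H" and \<delta>: "0 < \<delta>" "\<delta> < \<eta> / 2"
      define r where "r = max (a / H) (\<delta> / (\<eta> / 2))"
      have r: "r < 1" unfolding r_def using a \<delta> by auto
      obtain i :: nat where i: "1 / (1 - r) < real i" using reals_Archimedean2 by blast
      have "1 < (1 - r) * (real i + 2)"
        using i r by (simp add: pos_divide_less_eq algebra_simps)
      then have "r < c i" unfolding c_def by (simp add: field_simps)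
      then have "a / H \<le> c i" "\<delta> / (\<eta> / 2) \<le> c i" unfolding r_def by auto
      then have ac: "a \<le> H * c i" and \<delta>c: "\<delta> \<le> \<eta> / 2 * c i" using H \<eta> by (auto simp: field_simps)
      obtain C where C: "C \<ge> 0" "\<And>k s t x. s \<in> {0..T} \<Longrightarrow> t \<in> {0..T} \<Longrightarrow> norm x = 1 \<Longrightarrow>
        \<bar>W (block k) t x \<omega> - W (block k) s x \<omega>\<bar> \<le> C * 2 powr (- real k * (\<eta> / 2 * c i)) * \<bar>t - s\<bar> powr (H * c i)"
        using elim by blast
      have "\<bar>W (block k) t x \<omega> - W (block k) s x \<omega>\<bar> \<le> (C * T powr (H * c i - a)) * 2 powr (- real k * \<delta>) * \<bar>t - s\<bar> powr a"
        if "s \<in> {0..T}" "t \<in> {0..T}" "norm x = 1" for k s t x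
      proof -
        have "\<bar>W (block k) t x \<omega> - W (block k) s x \<omega>\<bar> \<le> C * 2 powr (- real k * (\<eta> / 2 * c i)) * \<bar>t - s\<bar> powr (H * c i)"
          using C(2)[OF that] .
        also have "\<dots> \<le> C * 2 powr (- real k * \<delta>) * (T powr (H * c i - a) * \<bar>t - s\<bar> powr a)"
        proof (intro mult_mono mult_left_mono)
          show "2 powr (- real k * (\<eta> / 2 * c i)) \<le> 2 powr (- real k * \<delta>)"
            using \<delta>c by (intro powr_mono mult_left_mono_neg) auto
          \<comment> \<open>Lowering the time exponent is paid for by a power of \<open>T\<close>,
            since \<open>\<bar>t - s\<bar> \<le> T\<close>.\<close>
          have "\<bar>t - s\<bar> powr (H * c i) = \<bar>t - s\<bar> powr (H * c i - a) * \<bar>t - s\<bar> powr a"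
            unfolding powr_add[symmetric] by simp
          also have "\<dots> \<le> T powr (H * c i - a) * \<bar>t - s\<bar> powr a"
            using that ac by (intro mult_right_mono powr_mono2) auto
          finally show "\<bar>t - s\<bar> powr (H * c i) \<le> T powr (H * c i - a) * \<bar>t - s\<bar> powr a" .
        qed (use C(1) in auto)
        finally show ?thesis by (simp only: mult_ac)
      qed
      then show "\<exists>C\<ge>0. \<forall>k. \<forall>s\<in>{0..T}. \<forall>t\<in>{0..T}. \<forall>x. norm x = 1 \<longrightarrow>
        \<bar>W (block k) t x \<omega> - W (block k) s x \<omega>\<bar> \<le> C * 2 powr (- real k * \<delta>) * \<bar>t - s\<bar> powr a"
        using C(1) by (intro exI[of _ "C * T powr (H * c i - a)"]) auto
    qed
  qed
qed

text \<open>High moments make the crude union bound over the incomplete blocks summable.\<close>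
lemma AE_incomplete_block_tendsto_0:
  assumes t: "0 \<le> t" and x: "norm x = 1"
  shows "AE \<omega> in M. (\<lambda>n. W {2 ^ floor_log (Suc n) - 1..<n} t x \<omega>) \<longlonglongrightarrow> 0"
proof -
  define L where "L n = {2 ^ floor_log (Suc n) - 1..<n}" for n :: nat
  define N where "N n = (2::real) ^ floor_log (Suc n)" for n
  have N1: "N n \<ge> 1" for n unfolding N_def by simp
  have N2: "real (Suc n) \<le> 2 * N n" for n
  proof -
    have "real (Suc n) \<le> real (2 * 2 ^ floor_log (Suc n))" by (rule of_nat_mono[OF floor_log_exp2_ge])
    then show ?thesis unfolding N_def by simp
  qed
  have LN: "N n \<le> real l + 1" if "l \<in> L n" for l n
  proof -
    have "2 ^ floor_log (Suc n) \<le> l + 1" using that unfolding L_def by auto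
    then have "real (2 ^ floor_log (Suc n)) \<le> real (l + 1)" by (rule of_nat_mono)
    then show ?thesis unfolding N_def by simp
  qed
  \<comment> \<open>With \<open>\<eta> * p > 2\<close> the moment of the incomplete block ending
    before \<open>n\<close> is of order \<open>n\<close> to the power -2, summable over
    \<open>n\<close> by itself.\<close>
  obtain p :: nat where "2 / \<eta> < real p" using reals_Archimedean2 by blast
  then have p: "2 < \<eta> * real p" using \<eta> by (simp add: pos_divide_less_eq mult.commute)
  then have p1: "p \<ge> 1" by (cases p) auto
  define G where "G = gauss_moment p * (C0 * B) ^ p * \<bar>t - 0\<bar> powr (2 * real p * H)"
  have G: "G \<ge> 0" unfolding G_def gauss_moment_def using C0_pos B_nonneg by simp
  \<comment> \<open>\<open>W_moment\<close> concerns increments, so the value at time 0, almost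
    surely 0, is subtracted.\<close>
  define D where "D n \<omega> = W (L n) t x \<omega> - W (L n) 0 x \<omega>" for n \<omega>
  have [measurable]: "D n \<in> borel_measurable M" for n
    unfolding D_def using t by (intro borel_measurable_diff W_measurable) auto
  have int: "(\<integral>\<^sup>+\<omega>. ennreal (D n \<omega> ^ (2 * p)) \<partial>M) \<le> ennreal (4 * G * inverse (real (Suc n) ^ 2))" for n
  proof -
    have "(\<integral>\<^sup>+\<omega>. ennreal (D n \<omega> ^ (2 * p)) \<partial>M) \<le>
       ennreal (gauss_moment p * (C0 * B) ^ p * N n powr (- \<eta> * real p) * \<bar>t - 0\<bar> powr (2 * real p * H))"
      unfolding D_def
      by (rule W_moment[OF _ LN _ x _ t p1]) (use N1[of n] in \<open>auto simp: L_def\<close>)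
    also have "\<dots> \<le> ennreal (4 * G * inverse (real (Suc n) ^ 2))"
    proof (rule ennreal_leI)
      have "N n powr (- \<eta> * real p) \<le> N n powr (- 2)" using N1[of n] p by (intro powr_mono) auto
      also have "\<dots> = inverse (N n ^ 2)" using N1[of n] by (simp add: powr_minus)
      also have "\<dots> \<le> inverse ((real (Suc n) / 2) ^ 2)"
        using N2[of n] N1[of n] by (intro le_imp_inverse_le power_mono) auto
      also have "\<dots> = 4 * inverse (real (Suc n) ^ 2)" by (simp add: power_divide inverse_eq_divide)
      finally have "G * N n powr (- \<eta> * real p) \<le> G * (4 * inverse (real (Suc n) ^ 2))"
        using G by (intro mult_left_mono)
      then show "gauss_moment p * (C0 * B) ^ p * N n powr (- \<eta> * real p) * \<bar>t - 0\<bar> powr (2 * real p * H)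
        \<le> 4 * G * inverse (real (Suc n) ^ 2)"
        unfolding G_def by (simp only: mult_ac)
    qed
    finally show ?thesis .
  qed
  have sm: "summable (\<lambda>n. 4 * G * inverse (real (Suc n) ^ 2))"
    using inverse_power_summable[of 2, where 'a = real] by (intro summable_mult) (subst summable_Suc_iff, simp)
  have "(\<integral>\<^sup>+\<omega>. (\<Sum>n. ennreal (D n \<omega> ^ (2 * p))) \<partial>M) = (\<Sum>n. \<integral>\<^sup>+\<omega>. ennreal (D n \<omega> ^ (2 * p)) \<partial>M)"
    by (intro nn_integral_suminf) measurable
  also have "\<dots> \<le> (\<Sum>n. ennreal (4 * G * inverse (real (Suc n) ^ 2)))"
    by (intro suminf_le summableI int)
  finally have le: "(\<integral>\<^sup>+\<omega>. (\<Sum>n. ennreal (D n \<omega> ^ (2 * p))) \<partial>M) \<le> (\<Sum>n. ennreal (4 * G * inverse (real (Suc n) ^ 2)))" .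
  have "(\<Sum>n. ennreal (4 * G * inverse (real (Suc n) ^ 2))) \<noteq> top"
    by (rule ennreal_suminf_neq_top[OF sm]) (use G in auto)
  with le have "(\<integral>\<^sup>+\<omega>. (\<Sum>n. ennreal (D n \<omega> ^ (2 * p))) \<partial>M) \<noteq> \<infinity>"
    unfolding infinity_ennreal_def using neq_top_trans by blast
  then have "AE \<omega> in M. (\<Sum>n. ennreal (D n \<omega> ^ (2 * p))) \<noteq> \<infinity>"
    by (intro nn_integral_noteq_infinite) measurable
  with AE_W_zero_continuous show ?thesis
  proof eventually_elim
    case (elim \<omega>)
    have "summable (\<lambda>n. D n \<omega> ^ (2 * p))"
      using elim(2) by (intro summable_suminf_not_top) (auto simp: zero_le_even_power)
    then have "(\<lambda>n. root (2 * p) (D n \<omega> ^ (2 * p))) \<longlonglongrightarrow> root (2 * p) 0"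
      by (intro tendsto_real_root summable_LIMSEQ_zero)
    moreover have "root (2 * p) (D n \<omega> ^ (2 * p)) = \<bar>D n \<omega>\<bar>" for n
      using p1 real_root_power_cancel[of "2 * p" "\<bar>D n \<omega>\<bar>"] by (simp add: power_even_abs)
    ultimately have "(\<lambda>n. \<bar>D n \<omega>\<bar>) \<longlonglongrightarrow> 0" by simp
    then have "(\<lambda>n. D n \<omega>) \<longlonglongrightarrow> 0" by (rule tendsto_rabs_zero_cancel)
    moreover have "D n \<omega> = W (L n) t x \<omega>" for n unfolding D_def L_def using elim(1) by simp
    ultimately show ?case unfolding L_def by simp
  qed
qed

section \<open>From blocks back to the original series\<close>

lemma W_blocks: "W {..<2 ^ K - 1} t x \<omega> = (\<Sum>j<K. W (block j) t x \<omega>)"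
proof (induction K)
  case 0
  show ?case by (simp add: W_def)
next
  case (Suc K)
  have "{..<2 ^ Suc K - 1} = {..<2 ^ K - 1} \<union> block K" "{..<2 ^ K - 1} \<inter> block K = {}"
    unfolding block_def by auto
  then have "W {..<2 ^ Suc K - 1} t x \<omega> = W {..<2 ^ K - 1} t x \<omega> + W (block K) t x \<omega>"
    unfolding W_def by (simp add: sum.union_disjoint)
  then show ?case using Suc by simp
qed

text \<open>Convergence of the block sums is convergence along a subsequence of partial sums only;
  the vanishing incomplete block upgrades it to the full sequence.\<close>

lemma X_sums:
  assumes blocks: "(\<lambda>k. W (block k) t x \<omega>) sums y"
    and rem: "(\<lambda>n. W {2 ^ floor_log (Suc n) - 1..<n} t x \<omega>) \<longlonglongrightarrow> 0"
  shows "(\<lambda>l. X l t x \<omega>) sums y"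
proof -
  have split: "(\<Sum>l<n. X l t x \<omega>) =
     (\<Sum>j<floor_log (Suc n). W (block j) t x \<omega>) + W {2 ^ floor_log (Suc n) - 1..<n} t x \<omega>" for n
  proof -
    have "2 ^ floor_log (Suc n) - 1 \<le> n" using floor_log_exp2_le[of "Suc n"] by simp
    then have "(\<Sum>l<n. X l t x \<omega>) = W {..<2 ^ floor_log (Suc n) - 1} t x \<omega> + W {2 ^ floor_log (Suc n) - 1..<n} t x \<omega>"
      unfolding W_def lessThan_atLeast0 by (intro sum.atLeastLessThan_concat[symmetric]) auto
    then show ?thesis unfolding W_blocks .
  qed
  have "filterlim (\<lambda>n. floor_log (Suc n)) at_top sequentially"
    unfolding filterlim_at_top
  proof
    fix K
    have "K \<le> floor_log (Suc n)" if "n \<ge> 2 ^ K" for n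
      using floor_log_le_iff[of "2 ^ K" "Suc n"] that by simp
    then show "\<forall>\<^sub>F n in sequentially. K \<le> floor_log (Suc n)"
      unfolding eventually_sequentially by blast
  qed
  then have "(\<lambda>n. \<Sum>j<floor_log (Suc n). W (block j) t x \<omega>) \<longlonglongrightarrow> y"
    using blocks unfolding sums_def by (rule filterlim_compose[rotated])
  from tendsto_add[OF this rem] show ?thesis unfolding sums_def split by simp
qed

lemma continuous_modification:
  "\<exists>Y :: real \<Rightarrow> real^'n \<Rightarrow> 'a \<Rightarrow> real.
     (\<forall>t\<in>{0..T}. \<forall>x\<in>sphere 0 1. Y t x \<in> borel_measurable M \<and> (AE \<omega> in M. Y t x \<omega> = QfBm A \<beta> S t x \<omega>)) \<and>
     (\<forall>\<omega>\<in>space M. continuous_on ({0..T} \<times> sphere 0 1) (\<lambda>(t, x). Y t x \<omega>) \<and>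
         space_time_holder_minus T H (\<eta> / 2) (\<lambda>t x. Y t x \<omega>))"
proof -
  define good where "good \<omega> \<longleftrightarrow> (\<forall>L x. finite L \<longrightarrow> W L 0 x \<omega> = 0) \<and>
    (\<forall>a \<delta>. 0 < a \<longrightarrow> a < H \<longrightarrow> 0 < \<delta> \<longrightarrow> \<delta> < \<eta> / 2 \<longrightarrow>
    (\<exists>C\<ge>0. \<forall>k. \<forall>s\<in>{0..T}. \<forall>t\<in>{0..T}. \<forall>x. norm x = 1 \<longrightarrow>
     \<bar>W (block k) t x \<omega> - W (block k) s x \<omega>\<bar> \<le> C * 2 powr (- real k * \<delta>) * \<bar>t - s\<bar> powr a))" for \<omega>
  have "AE \<omega> in M. good \<omega>"
    using AE_W_zero_continuous AE_block_holder_all by eventually_elim (simp add: good_def)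
  \<comment> \<open>The set of bad paths is covered by a measurable null set \<open>E\<close>, so
    that changing the process on \<open>E\<close> keeps \<open>Y t x\<close> measurable.\<close>
  then obtain E where E: "{\<omega> \<in> space M. \<not> good \<omega>} \<subseteq> E" "emeasure M E = 0" "E \<in> sets M"
    by (rule AE_E)
  have AE_E': "AE \<omega> in M. \<omega> \<notin> E" using E by (intro AE_not_in) auto
  \<comment> \<open>Setting all blocks to 0 on \<open>E\<close> makes the path regular for every
    \<open>\<omega>\<close> in the space, not merely for almost every one.\<close>
  define y where "y \<omega> k t x = (if \<omega> \<in> E then 0 else W (block k) t x \<omega>)" for \<omega> k t x
  define Y where "Y t x \<omega> = (\<Sum>k. y \<omega> k t x)" for t x \<omega>
  have reg: "\<And>t x. t \<in> {0..T} \<Longrightarrow> norm x = 1 \<Longrightarrow> (\<lambda>k. y \<omega> k t x) sums Y t x \<omega>"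
    "continuous_on ({0..T} \<times> sphere 0 1) (\<lambda>(t, x). Y t x \<omega>)"
    "space_time_holder_minus T H (\<eta> / 2) (\<lambda>t x. Y t x \<omega>)" if \<omega>: "\<omega> \<in> space M" for \<omega>
  proof -
    have good: "good \<omega>" if "\<omega> \<notin> E" using \<omega> that E(1) by blast
    have poly: "\<exists>f. poly_deg (2 ^ Suc k) f \<and> (\<forall>x. norm x = 1 \<longrightarrow> y \<omega> k t x = f x)" for k t
    proof (cases "\<omega> \<in> E")
      case True
      then show ?thesis unfolding y_def by (intro exI[of _ "\<lambda>x. 0"]) (auto intro: poly_deg_const)
    next
      case False
      then show ?thesis unfolding y_def using W_poly[of "block k" "2 ^ Suc k" t \<omega>] block_bounds(1) by auto
    qed
    have zero: "y \<omega> k 0 x = 0" for k x using good unfolding y_def good_def by auto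
    have hold: "\<exists>C\<ge>0. \<forall>k. \<forall>s\<in>{0..T}. \<forall>t\<in>{0..T}. \<forall>x. norm x = 1 \<longrightarrow>
        \<bar>y \<omega> k t x - y \<omega> k s x\<bar> \<le> C * 2 powr (- real k * \<delta>) * \<bar>t - s\<bar> powr a"
      if "0 < a" "a < H" "0 < \<delta>" "\<delta> < \<eta> / 2" for a \<delta>
    proof (cases "\<omega> \<in> E")
      case True
      then show ?thesis unfolding y_def by (intro exI[of _ 0]) auto
    next
      case False
      then show ?thesis using good[OF False] that unfolding good_def y_def by simp
    qed
    note R = space_time_regularity[where y = "y \<omega>", OF T H half_gt_zero[OF \<eta>] poly zero hold]
    show "\<And>t x. t \<in> {0..T} \<Longrightarrow> norm x = 1 \<Longrightarrow> (\<lambda>k. y \<omega> k t x) sums Y t x \<omega>"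
      "continuous_on ({0..T} \<times> sphere 0 1) (\<lambda>(t, x). Y t x \<omega>)"
      "space_time_holder_minus T H (\<eta> / 2) (\<lambda>t x. Y t x \<omega>)"
      unfolding Y_def using R by blast+
  qed
  have meas: "Y t x \<in> borel_measurable M" if t: "t \<in> {0..T}" for t x
  proof -
    have [measurable]: "E \<in> sets M" by (rule E)
    have [measurable]: "W (block k) t x \<in> borel_measurable M" for k using t by (intro W_measurable) auto
    have "(\<lambda>\<omega>. y \<omega> k t x) \<in> borel_measurable M" for k unfolding y_def by measurable
    then show ?thesis unfolding Y_def[abs_def] by (rule borel_measurable_suminf)
  qed
  have modif: "AE \<omega> in M. Y t x \<omega> = QfBm A \<beta> S t x \<omega>" if t: "t \<in> {0..T}" and x: "norm x = 1" for t x
  proof -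
    have "AE \<omega> in M. (\<lambda>n. W {2 ^ floor_log (Suc n) - 1..<n} t x \<omega>) \<longlonglongrightarrow> 0"
      using t x by (intro AE_incomplete_block_tendsto_0) auto
    with AE_E' AE_space show ?thesis
    proof eventually_elim
      case (elim \<omega>)
      have "(\<lambda>k. W (block k) t x \<omega>) sums Y t x \<omega>"
        using reg(1)[OF elim(2) t x] elim(1) unfolding y_def by simp
      then have "(\<lambda>l. X l t x \<omega>) sums Y t x \<omega>" using elim(3) by (rule X_sums)
      then show ?case unfolding QfBm_def X_def by (rule sums_unique)
    qed
  qed
  show ?thesis
    by (rule exI[of _ Y]) (use meas modif reg(2,3) in auto)
qed

end

theorem theorem4p2:
  fixes M :: "'a measure" and H T \<eta> :: real and A :: "nat \<Rightarrow> real"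
    and \<beta> :: "nat \<times> nat \<Rightarrow> real \<Rightarrow> 'a \<Rightarrow> real"
    and S :: "nat \<Rightarrow> nat \<Rightarrow> real^'n \<Rightarrow> real"
  assumes "prob_space M"
    and "CARD('n) \<ge> 3"
    and "0 < H" "H < 1" "0 < T"
    and "\<forall>l. 0 \<le> A l"
    and "0 < \<eta>"
    and "summable (\<lambda>l. A l * real l powr (real CARD('n) - 2 + \<eta>))"
    and "spherical_harmonics S"
    and "\<forall>l m. 1 \<le> m \<and> m \<le> harm_dim l CARD('n) \<longrightarrow> fbm M H (\<beta> (l, m))"
    and "prob_space.indep_vars M (\<lambda>_. PiM {0..} (\<lambda>_. borel)) (\<lambda>i \<omega>. restrict (\<lambda>t. \<beta> i t \<omega>) {0..})
           {(l, m). 1 \<le> m \<and> m \<le> harm_dim l CARD('n)}"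
  shows "\<exists>Y :: real \<Rightarrow> real^'n \<Rightarrow> 'a \<Rightarrow> real.
           (\<forall>t\<in>{0..T}. \<forall>x\<in>sphere 0 1. Y t x \<in> borel_measurable M \<and>
               (AE \<omega> in M. Y t x \<omega> = QfBm A \<beta> S t x \<omega>)) \<and>
           (\<forall>\<omega>\<in>space M. continuous_on ({0..T} \<times> sphere 0 1) (\<lambda>(t, x). Y t x \<omega>) \<and>
               space_time_holder_minus T H (\<eta> / 2) (\<lambda>t x. Y t x \<omega>))"
proof -
  interpret isotropic_qfbm M H T \<eta> A \<beta> S
    by (rule isotropic_qfbm.intro) (use assms in \<open>auto intro!: isotropic_qfbm_axioms.intro\<close>)
  show ?thesis by (rule continuous_modification)
qed

end
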